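(* Let $G$ be a topological group and $0<p<q<\infty$. Then for every $\psi\in K^p(G)$ there exist a continuous measure preserving action $\sigma:G\curvearrowright(Y,\nu)$ on a $\sigma$-finite standard measure space and a function $h\in L_\infty(Y,\nu)$ such that for all $g\in G$, $b(g)=\sigma_g(h)-h$ belongs to $L_q(Y,\nu)$ and $\psi(g)=\|b(g)\|_{L_q}^q$. In particular $\psi\in K^q(G)$.
   Context: $K^p(G)$ is the set of continuous functions $\psi:G\to\mathbf{R}_+$ of the form $\psi(g)=\|\alpha_g(0)\|_{L_p}^p$ for a continuous affine isometric action $\alpha$ of $G$ on some $L_p$ space ($L_p(X,\mu)$, $(X,\mu)$ $\sigma$-finite standard; for $0<p<1$ with metric $\int|f-f'|^p$). A continuous measure preserving action is a continuous homomorphism $G\to\mathrm{Aut}(Y,\nu)$ (topology of pointwise convergence on probability measures equivalent to $\nu$), and $\sigma_g(h)=h\circ\sigma_g^{-1}$. *)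

theory Defs
  imports "HOL-Analysis.Analysis" "HOL-Probability.Probability"
begin

definition borel_of :: "'a topology \<Rightarrow> 'a measure" where
  "borel_of T = sigma (topspace T) {U. openin T U}"

definition Polish_space :: "'a topology \<Rightarrow> bool" where
  "Polish_space T \<longleftrightarrow> completely_metrizable_space T \<and> separable_space T"

definition standard_measure_space :: "'a measure \<Rightarrow> bool" where
  "standard_measure_space M \<longleftrightarrow>
     (\<exists>T. Polish_space T \<and> topspace T = space M \<and> sets M = sets (borel_of T))"

definition sigma_finite_standard :: "'a measure \<Rightarrow> bool" where
  "sigma_finite_standard M \<longleftrightarrow> sigma_finite_measure M \<and> standard_measure_space M"

(* Real L_p spaces, 0 < p < \<infinity>, represented by measurable functions (a.e. classes) *)

definition Lp_int :: "'x measure \<Rightarrow> real \<Rightarrow> ('x \<Rightarrow> real) \<Rightarrow> ennreal" where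
  "Lp_int M p f = (\<integral>\<^sup>+ x. ennreal (\<bar>f x\<bar> powr p) \<partial>M)"

definition Lp :: "'x measure \<Rightarrow> real \<Rightarrow> ('x \<Rightarrow> real) set" where
  "Lp M p = {f \<in> borel_measurable M. Lp_int M p f < \<infinity>}"

definition Lp_norm :: "'x measure \<Rightarrow> real \<Rightarrow> ('x \<Rightarrow> real) \<Rightarrow> real" where
  "Lp_norm M p f = enn2real (Lp_int M p f) powr (1 / p)"

definition Lp_dist :: "'x measure \<Rightarrow> real \<Rightarrow> ('x \<Rightarrow> real) \<Rightarrow> ('x \<Rightarrow> real) \<Rightarrow> real" where
  "Lp_dist M p f f' =
     (if p < 1 then enn2real (Lp_int M p (\<lambda>x. f x - f' x)) else Lp_norm M p (\<lambda>x. f x - f' x))"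

definition Linf :: "'x measure \<Rightarrow> ('x \<Rightarrow> real) set" where
  "Linf M = {h \<in> borel_measurable M. \<exists>C. AE x in M. \<bar>h x\<bar> \<le> C}"

(* Continuous affine isometric actions of a topological group (written additively,
   not necessarily commutative) on L_p(M); \<alpha> g acts on representatives, equality a.e. *)

definition affine_isometric_action ::
  "real \<Rightarrow> 'x measure \<Rightarrow> ('g::topological_group_add \<Rightarrow> ('x \<Rightarrow> real) \<Rightarrow> ('x \<Rightarrow> real)) \<Rightarrow> bool" where
  "affine_isometric_action p M \<alpha> \<longleftrightarrow>
     (\<forall>g f. f \<in> Lp M p \<longrightarrow> \<alpha> g f \<in> Lp M p) \<and>
     (\<forall>g f f'. f \<in> Lp M p \<longrightarrow> f' \<in> Lp M p \<longrightarrow>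
         Lp_dist M p (\<alpha> g f) (\<alpha> g f') = Lp_dist M p f f') \<and>
     (\<forall>g h. h \<in> Lp M p \<longrightarrow> (\<exists>f \<in> Lp M p. AE x in M. \<alpha> g f x = h x)) \<and>
     (\<forall>g f f' t. f \<in> Lp M p \<longrightarrow> f' \<in> Lp M p \<longrightarrow>
         (AE x in M. \<alpha> g (\<lambda>y. t * f y + (1 - t) * f' y) x = t * \<alpha> g f x + (1 - t) * \<alpha> g f' x)) \<and>
     (\<forall>f. f \<in> Lp M p \<longrightarrow> (AE x in M. \<alpha> 0 f x = f x)) \<and>
     (\<forall>g g' f. f \<in> Lp M p \<longrightarrow> (AE x in M. \<alpha> (g + g') f x = \<alpha> g (\<alpha> g' f) x))"

definition continuous_affine_isometric_action ::
  "real \<Rightarrow> 'x measure \<Rightarrow> ('g::topological_group_add \<Rightarrow> ('x \<Rightarrow> real) \<Rightarrow> ('x \<Rightarrow> real)) \<Rightarrow> bool" where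
  "continuous_affine_isometric_action p M \<alpha> \<longleftrightarrow>
     affine_isometric_action p M \<alpha> \<and>
     (\<forall>f \<in> Lp M p. \<forall>g0. \<forall>\<epsilon>>0. \<forall>\<^sub>F g in nhds g0. Lp_dist M p (\<alpha> g f) (\<alpha> g0 f) < \<epsilon>)"

definition Kp :: "'x itself \<Rightarrow> real \<Rightarrow> ('g::topological_group_add \<Rightarrow> real) set" where
  "Kp _ p = {\<psi>. continuous_on UNIV \<psi> \<and> (\<forall>g. 0 \<le> \<psi> g) \<and>
      (\<exists>(M::'x measure) \<alpha>. sigma_finite_standard M \<and> continuous_affine_isometric_action p M \<alpha> \<and>
          (\<forall>g. \<psi> g = Lp_norm M p (\<alpha> g (\<lambda>_. 0)) powr p))}"

definition mp_action :: "'y measure \<Rightarrow> ('g::topological_group_add \<Rightarrow> 'y \<Rightarrow> 'y) \<Rightarrow> bool" where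
  "mp_action N \<sigma> \<longleftrightarrow>
     (\<forall>g. \<sigma> g \<in> measurable N N \<and> distr N N (\<sigma> g) = N) \<and>
     (AE y in N. \<sigma> 0 y = y) \<and>
     (\<forall>g g'. AE y in N. \<sigma> (g + g') y = \<sigma> g (\<sigma> g' y))"

definition equiv_prob :: "'y measure \<Rightarrow> 'y measure \<Rightarrow> bool" where
  "equiv_prob N \<mu> \<longleftrightarrow> prob_space \<mu> \<and> sets \<mu> = sets N \<and>
     (\<forall>A \<in> sets N. emeasure \<mu> A = 0 \<longleftrightarrow> emeasure N A = 0)"

definition tv_dist :: "'y measure \<Rightarrow> 'y measure \<Rightarrow> real" where
  "tv_dist \<mu> \<mu>' = (SUP A \<in> sets \<mu>. \<bar>measure \<mu> A - measure \<mu>' A\<bar>)"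

definition continuous_mp_action :: "'y measure \<Rightarrow> ('g::topological_group_add \<Rightarrow> 'y \<Rightarrow> 'y) \<Rightarrow> bool" where
  "continuous_mp_action N \<sigma> \<longleftrightarrow> mp_action N \<sigma> \<and>
     (\<forall>\<mu>. equiv_prob N \<mu> \<longrightarrow>
        (\<forall>g0. \<forall>\<epsilon>>0. \<forall>\<^sub>F g in nhds g0. tv_dist (distr \<mu> N (\<sigma> g)) (distr \<mu> N (\<sigma> g0)) < \<epsilon>))"

text \<open>Koopman operator: \<sigma>_g(h) = h \<circ> \<sigma>_g^{-1} = h \<circ> \<sigma>_{-g} (a.e.).\<close>
definition koopman :: "('g::topological_group_add \<Rightarrow> 'y \<Rightarrow> 'y) \<Rightarrow> 'g \<Rightarrow> ('y \<Rightarrow> real) \<Rightarrow> ('y \<Rightarrow> real)" where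
  "koopman \<sigma> g h = (\<lambda>y. h (\<sigma> (- g) y))"

end

theory Submission
  imports Defs
begin

text \<open>
  After a change of variables the \<open>L\<^sub>p\<close> space lives over a finite Borel measure \<open>M\<close> on the real
  line. Suppose that the affine action has the form \<open>\<alpha>\<^sub>g f = c\<^sub>g \<cdot> (f \<circ> S\<^sub>g) + b\<^sub>g\<close>. It extends to
  \<open>M \<otimes> du \<otimes> e\<^bsup>(p-1)s\<^esup> ds\<close>, with \<open>u \<mapsto> c u + b\<close> on positions and \<open>s \<mapsto> s + ln |c|\<close> on logarithmic scales: this
  multiplies \<open>du\<close> by \<open>|c|\<close> and the weight by \<open>|c|\<^bsup>p-1\<^esup>\<close>, which compensates exactly for the density
  \<open>|c|\<^sup>p\<close> of \<open>S\<^sub>g\<close>. For the even bump function \<open>h = tent (u e\<^bsup>-s\<^esup>)\<close> one finds, fibre by fibre and by scaling,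
  \<open>\<parallel>\<sigma>\<^sub>g h - h\<parallel>\<^sup>q = C \<integral> |b\<^sub>g|\<^sup>p\<close>; the constant is finite because the integrand decays like \<open>e\<^bsup>(p-q)s\<^esup>\<close>
  at large scales and like \<open>e\<^bsup>ps\<^esup>\<close> at small ones, so exactly because \<open>0 < p < q\<close>.

  The form \<open>c\<^sub>g \<cdot> (f \<circ> S\<^sub>g) + b\<^sub>g\<close> is Lamperti's theorem if \<open>p \<noteq> 2\<close>: equality in Clarkson's inequality
  characterises disjointness of supports. If \<open>p = 2\<close>, the Hilbert space is first replaced by the
  Gaussian Hilbert space over it, on which orthogonal maps act by measure preserving point maps.
\<close>

section \<open>The spaces \<open>L\<^sub>p\<close>\<close>

text \<open>The displacement of a bounded function must remember \<open>b\<close> and forget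
  \<open>c\<close>. The extension moves a position and its scale by the same factor, so the ratio of
  the two changes only by the translation and a sign, and an even function of the ratio forgets the
  sign as well. Integrated over all positions and scales, what remains is homogeneous of degree p in
  b, for every q: one degree comes from du, the other p - 1 from the weight. Unless the base is
  null, \<open>h\<close> itself is not in L_q, since the integral of its q-th power is a multiple of
  that of exp(p s) over all s. The representation acts on functions, whereas the construction needs
  point maps \<open>S\<close>. For p different from 2 they come from the induced map on sets: on the
  line a point is recovered from countably many rational cuts, which keeps the exceptional null sets
  countable. Moving to the line takes only a countably generated sigma-algebra and a positive
  integrable weight. For p = 2 an orthogonal map need not preserve disjointness of supports, but it
  preserves Gaussian laws; there the density \<open>c\<close> is 1.\<close>

lemma powr_add_le:
  fixes a b p :: real
  assumes "0 < p"
  shows "\<bar>a + b\<bar> powr p \<le> 2 powr p * (\<bar>a\<bar> powr p + \<bar>b\<bar> powr p)"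
proof -
  have "\<bar>a + b\<bar> powr p \<le> (2 * max \<bar>a\<bar> \<bar>b\<bar>) powr p"
    using assms by (intro powr_mono2) auto
  also have "\<dots> = 2 powr p * (max \<bar>a\<bar> \<bar>b\<bar>) powr p"
    by (simp add: powr_mult)
  also have "(max \<bar>a\<bar> \<bar>b\<bar>) powr p \<le> \<bar>a\<bar> powr p + \<bar>b\<bar> powr p"
    by (auto simp: max_def)
  finally show ?thesis by (simp add: mult_left_mono)
qed

lemma Lp_measurable: "f \<in> Lp M p \<Longrightarrow> f \<in> borel_measurable M"
  by (simp add: Lp_def)

lemma Lp_int_cong_AE: "AE x in M. f x = g x \<Longrightarrow> Lp_int M p f = Lp_int M p g"
  unfolding Lp_int_def by (intro nn_integral_cong_AE) auto

text \<open>A quasi-triangle inequality for the integral of the p-th power serves p < 1 and p >= 1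
  alike and replaces Minkowski's inequality. The factor \<open>2 powr p\<close> is harmless, because
  only smallness is ever deduced from it.\<close>

lemma Lp_int_add_le:
  assumes "0 < p" "f \<in> borel_measurable M" "g \<in> borel_measurable M"
  shows "Lp_int M p (\<lambda>x. f x + g x) \<le> ennreal (2 powr p) * (Lp_int M p f + Lp_int M p g)"
proof -
  note [measurable] = assms(2,3)
  have "Lp_int M p (\<lambda>x. f x + g x)
     \<le> (\<integral>\<^sup>+x. ennreal (2 powr p) * (ennreal (\<bar>f x\<bar> powr p) + ennreal (\<bar>g x\<bar> powr p)) \<partial>M)"
    unfolding Lp_int_def
    by (intro nn_integral_mono)
       (simp flip: ennreal_plus ennreal_mult add: powr_add_le[OF assms(1)])
  also have "\<dots> = ennreal (2 powr p) * (Lp_int M p f + Lp_int M p g)"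
    unfolding Lp_int_def by (simp add: nn_integral_cmult nn_integral_add)
  finally show ?thesis .
qed

lemma Lp_int_scale:
  assumes "f \<in> borel_measurable M"
  shows "Lp_int M p (\<lambda>x. s * f x) = ennreal (\<bar>s\<bar> powr p) * Lp_int M p f"
  using assms unfolding Lp_int_def
  by (simp add: abs_mult powr_mult ennreal_mult nn_integral_cmult)

lemma Lp_int_minus: "Lp_int M p (\<lambda>x. - f x) = Lp_int M p f"
  by (simp add: Lp_int_def)

lemma Lp_int_minus_commute: "Lp_int M p (\<lambda>x. f x - g x) = Lp_int M p (\<lambda>x. g x - f x)"
  by (simp add: Lp_int_def abs_minus_commute)

lemma Lp_int_diff_le:
  assumes "0 < p" "f \<in> borel_measurable M" "g \<in> borel_measurable M"
  shows "Lp_int M p (\<lambda>x. f x - g x) \<le> ennreal (2 powr p) * (Lp_int M p f + Lp_int M p g)"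
  using Lp_int_add_le[OF assms(1,2), of "\<lambda>x. - g x"] assms(3) by (simp add: Lp_int_minus)

lemma Lp_int_triangle:
  assumes "0 < p" "f \<in> borel_measurable M" "g \<in> borel_measurable M" "h \<in> borel_measurable M"
  shows "Lp_int M p (\<lambda>x. f x - h x)
    \<le> ennreal (2 powr p) * (Lp_int M p (\<lambda>x. f x - g x) + Lp_int M p (\<lambda>x. g x - h x))"
  using Lp_int_add_le[OF assms(1), of "\<lambda>x. f x - g x" M "\<lambda>x. g x - h x"] assms by simp

lemma Lp_zero: "(\<lambda>_. 0) \<in> Lp M p"
  by (simp add: Lp_def Lp_int_def)

lemma Lp_int_zero: "Lp_int M p (\<lambda>_. 0) = 0"
  by (simp add: Lp_int_def)

lemma Lp_add:
  assumes "0 < p" "f \<in> Lp M p" "g \<in> Lp M p"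
  shows "(\<lambda>x. f x + g x) \<in> Lp M p"
proof -
  have "Lp_int M p (\<lambda>x. f x + g x) \<le> ennreal (2 powr p) * (Lp_int M p f + Lp_int M p g)"
    using assms by (intro Lp_int_add_le) (auto simp: Lp_def)
  also have "\<dots> < \<infinity>" using assms by (auto simp: Lp_def ennreal_mult_less_top)
  finally have "Lp_int M p (\<lambda>x. f x + g x) < \<infinity>" .
  with assms show ?thesis by (auto simp: Lp_def)
qed

lemma Lp_scale:
  assumes "f \<in> Lp M p"
  shows "(\<lambda>x. s * f x) \<in> Lp M p"
  using assms by (auto simp: Lp_def Lp_int_scale ennreal_mult_less_top)

lemma Lp_diff:
  assumes "0 < p" "f \<in> Lp M p" "g \<in> Lp M p"
  shows "(\<lambda>x. f x - g x) \<in> Lp M p"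
  using Lp_add[OF assms(1,2) Lp_scale[OF assms(3), of "-1"]] by simp

lemma Lp_int_eq_0_iff:
  assumes "f \<in> borel_measurable M"
  shows "Lp_int M p f = 0 \<longleftrightarrow> (AE x in M. f x = 0)"
  using assms unfolding Lp_int_def by (subst nn_integral_0_iff_AE) auto

lemma indicator_Lp:
  assumes "A \<in> sets M" "emeasure M A < \<infinity>"
  shows "(indicator A :: 'a \<Rightarrow> real) \<in> Lp M p"
    and "Lp_int M p (indicator A) = emeasure M A"
proof -
  have "Lp_int M p (indicator A) = (\<integral>\<^sup>+x. indicator A x \<partial>M)"
    unfolding Lp_int_def by (intro nn_integral_cong) (auto split: split_indicator)
  then show "Lp_int M p (indicator A) = emeasure M A" using assms by simp
  with assms show "(indicator A :: 'a \<Rightarrow> real) \<in> Lp M p"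
    by (auto simp: Lp_def)
qed

text \<open>The sum of all |f n|^p has finite integral, so it is finite almost everywhere and its
  terms tend to 0. The geometric rate spares the choice of a subsequence.\<close>

lemma Lp_int_fast_AE_tendsto:
  assumes f: "\<And>n. f n \<in> borel_measurable M"
    and le: "\<And>n. Lp_int M p (f n) \<le> ennreal ((1/2) ^ n)" and p: "0 < p"
  shows "AE x in M. (\<lambda>n. f n x) \<longlonglongrightarrow> 0"
proof -
  note [measurable] = f
  have "(\<integral>\<^sup>+x. (\<Sum>n. ennreal (\<bar>f n x\<bar> powr p)) \<partial>M) = (\<Sum>n. Lp_int M p (f n))"
    unfolding Lp_int_def by (intro nn_integral_suminf) auto
  also have "\<dots> \<le> (\<Sum>n. ennreal ((1/2) ^ n))"
    by (intro suminf_le le) auto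
  also have "\<dots> = ennreal (\<Sum>n. (1/2)^n)"
    by (intro suminf_ennreal2) auto
  also have "\<dots> < \<infinity>" by simp
  finally have "AE x in M. (\<Sum>n. ennreal (\<bar>f n x\<bar> powr p)) \<noteq> \<infinity>"
    by (intro nn_integral_PInf_AE) auto
  then show ?thesis
  proof eventually_elim
    case (elim x)
    then have "summable (\<lambda>n. \<bar>f n x\<bar> powr p)"
      by (intro summable_suminf_not_top) auto
    then have "(\<lambda>n. \<bar>f n x\<bar> powr p) \<longlonglongrightarrow> 0" by (rule summable_LIMSEQ_zero)
    then have "(\<lambda>n. (\<bar>f n x\<bar> powr p) powr (1/p)) \<longlonglongrightarrow> 0 powr (1/p)"
      by (rule tendsto_powr2) (use p in \<open>auto\<close>)
    then have "(\<lambda>n. \<bar>f n x\<bar>) \<longlonglongrightarrow> 0" using p by (simp add: powr_powr)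
    then show ?case by (simp add: tendsto_rabs_zero_iff)
  qed
qed

lemma Lp_simple_approx:
  fixes f :: "'a \<Rightarrow> real" and e :: ennreal
  assumes f: "f \<in> Lp M p" and p: "0 < p" and e: "0 < e"
  obtains s where "simple_function M s" "s \<in> Lp M p" "Lp_int M p (\<lambda>x. f x - s x) < e"
proof -
  note fm[measurable] = Lp_measurable[OF f]
  \<comment> \<open>The base point 0 yields |F i| <= 2 |f|, hence |f - F i| <= 3 |f|, which is the
    origin of the dominating function below.\<close>
  from borel_measurable_implies_sequence_metric[OF fm, of 0] obtain F where
    F: "\<And>i. simple_function M (F i)" "\<And>x. x \<in> space M \<Longrightarrow> (\<lambda>i. F i x) \<longlonglongrightarrow> f x"
       "\<And>i x. x \<in> space M \<Longrightarrow> \<bar>F i x\<bar> \<le> 2 * \<bar>f x\<bar>"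
    by (simp add: Ball_def) blast
  note [measurable] = borel_measurable_simple_function[OF F(1)]
  have fin: "Lp_int M p (\<lambda>x. 3 * f x) < \<infinity>" using Lp_scale[OF f, of 3] by (simp add: Lp_def)
  have "(\<lambda>i. \<integral>\<^sup>+x. ennreal (\<bar>f x - F i x\<bar> powr p) \<partial>M) \<longlonglongrightarrow> (\<integral>\<^sup>+x. 0 \<partial>M)"
  proof (rule nn_integral_dominated_convergence[where w="\<lambda>x. ennreal (\<bar>3 * f x\<bar> powr p)"])
    show "AE x in M. ennreal (\<bar>f x - F j x\<bar> powr p) \<le> ennreal (\<bar>3 * f x\<bar> powr p)" for j
    proof (rule AE_I2)
      fix x assume "x \<in> space M"
      then have "\<bar>f x - F j x\<bar> \<le> \<bar>3 * f x\<bar>" using F(3)[of x j] by auto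
      then show "ennreal (\<bar>f x - F j x\<bar> powr p) \<le> ennreal (\<bar>3 * f x\<bar> powr p)"
        using p by (intro ennreal_leI powr_mono2) auto
    qed
    show "AE x in M. (\<lambda>i. ennreal (\<bar>f x - F i x\<bar> powr p)) \<longlonglongrightarrow> 0"
    proof (rule AE_I2)
      fix x assume "x \<in> space M"
      from tendsto_diff[OF tendsto_const[of "f x"] F(2)[OF this]]
      have "(\<lambda>i. \<bar>f x - F i x\<bar>) \<longlonglongrightarrow> 0" by (intro tendsto_rabs_zero) simp
      then have "(\<lambda>i. \<bar>f x - F i x\<bar> powr p) \<longlonglongrightarrow> 0 powr p"
        by (rule tendsto_powr2) (use p in auto)
      then have "(\<lambda>i. ennreal (\<bar>f x - F i x\<bar> powr p)) \<longlonglongrightarrow> ennreal 0" using p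
        by (intro tendsto_ennrealI) simp
      then show "(\<lambda>i. ennreal (\<bar>f x - F i x\<bar> powr p)) \<longlonglongrightarrow> 0" by simp
    qed
    show "(\<integral>\<^sup>+ x. ennreal (\<bar>3 * f x\<bar> powr p) \<partial>M) < \<infinity>" using fin by (simp add: Lp_int_def)
  qed auto
  then have "\<forall>\<^sub>F i in sequentially. Lp_int M p (\<lambda>x. f x - F i x) < e"
    using e by (simp add: Lp_int_def order_tendstoD(2))
  then obtain i where i: "Lp_int M p (\<lambda>x. f x - F i x) < e"
    by (auto simp: eventually_sequentially)
  have "Lp_int M p (F i) \<le> Lp_int M p (\<lambda>x. 3 * f x)"
    unfolding Lp_int_def
  proof (intro nn_integral_mono ennreal_leI powr_mono2)
    fix x assume "x \<in> space M"
    then show "\<bar>F i x\<bar> \<le> \<bar>3 * f x\<bar>" using F(3)[of x i] by auto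
  qed (use p in auto)
  with fin have "F i \<in> Lp M p" by (auto simp: Lp_def)
  with F(1)[of i] i show thesis by (intro that)
qed

text \<open>The closure step is phrased by approximation in \<open>Lp_int\<close>, since the
  predicates of interest are identities and continuity statements between isometric operations, and
  these survive L_p limits.\<close>

lemma Lp_induct [consumes 2, case_names indicator lin dense]:
  fixes f :: "'a \<Rightarrow> real"
  assumes f: "f \<in> Lp M p" and p: "0 < p"
    and ind: "\<And>A. A \<in> sets M \<Longrightarrow> emeasure M A < \<infinity> \<Longrightarrow> P (indicator A)"
    and lin: "\<And>s f g. f \<in> Lp M p \<Longrightarrow> g \<in> Lp M p \<Longrightarrow> P f \<Longrightarrow> P g \<Longrightarrow> P (\<lambda>x. s * f x + g x)"
    and dense: "\<And>f. f \<in> Lp M p \<Longrightarrow>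
      (\<And>e::ennreal. 0 < e \<Longrightarrow> \<exists>g\<in>Lp M p. P g \<and> Lp_int M p (\<lambda>x. f x - g x) < e) \<Longrightarrow> P f"
  shows "P f"
proof (rule dense[OF f])
  fix e :: ennreal assume "0 < e"
  then obtain s where s: "simple_function M s" "s \<in> Lp M p" "Lp_int M p (\<lambda>x. f x - s x) < e"
    by (rule Lp_simple_approx[OF f p])
  \<comment> \<open>The value 0 is left out: its level set may have infinite measure, while every
    other level set has finite measure by Chebyshev's inequality.\<close>
  define V where "V = s ` space M - {0}"
  define B where "B y = s -` {y} \<inter> space M" for y
  have V: "finite V" using s(1) by (auto simp: V_def simple_function_def)
  have B: "B y \<in> sets M" "emeasure M (B y) < \<infinity>" if "y \<in> V" for y
  proof -
    show 1: "B y \<in> sets M" using s(1) by (simp add: B_def simple_functionD)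
    have y: "\<bar>y\<bar> powr p > 0" using that by (auto simp: V_def)
    have "ennreal (\<bar>y\<bar> powr p) * emeasure M (B y) = (\<integral>\<^sup>+x. ennreal (\<bar>y\<bar> powr p) * indicator (B y) x \<partial>M)"
      using 1 by (simp add: nn_integral_cmult)
    also have "\<dots> \<le> Lp_int M p s"
      unfolding Lp_int_def by (intro nn_integral_mono) (auto simp: B_def split: split_indicator)
    also have "\<dots> < \<infinity>" using s(2) by (simp add: Lp_def)
    finally show "emeasure M (B y) < \<infinity>"
      using y by (auto simp: ennreal_mult_less_top)
  qed
  have "V' \<subseteq> V \<Longrightarrow> (\<lambda>x. \<Sum>y\<in>V'. y * indicator (B y) x) \<in> Lp M p \<and> P (\<lambda>x. \<Sum>y\<in>V'. y * indicator (B y) x)"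
    if "finite V'" for V'
    using that
  proof (induction V')
    case empty
    have "P (indicator {})" by (rule ind) auto
    also have "indicator {} = (\<lambda>x::'a. 0::real)" by auto
    finally show ?case by (simp add: Lp_zero)
  next
    case (insert y V')
    then have "B y \<in> sets M" "emeasure M (B y) < \<infinity>" using B by auto
    then have i: "indicator (B y) \<in> Lp M p" "P (indicator (B y))"
      using indicator_Lp(1) ind by auto
    have eq: "(\<Sum>y\<in>insert y V'. y * indicator (B y) x)
        = y * indicator (B y) x + (\<Sum>y\<in>V'. y * indicator (B y) x)" for x :: 'a
      using insert by (subst sum.insert) auto
    from insert have IH: "(\<lambda>x. \<Sum>y\<in>V'. y * indicator (B y) x) \<in> Lp M p"
      "P (\<lambda>x. \<Sum>y\<in>V'. y * indicator (B y) x)" by auto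
    show ?case
      unfolding eq by (intro conjI Lp_add[OF p] Lp_scale lin i IH)
  qed
  from this[OF V order_refl] have P: "(\<lambda>x. \<Sum>y\<in>V. y * indicator (B y) x) \<in> Lp M p"
    "P (\<lambda>x. \<Sum>y\<in>V. y * indicator (B y) x)" by auto
  have "(\<Sum>y\<in>V. y * indicator (B y) x) = s x" if "x \<in> space M" for x
  proof -
    have "(\<Sum>y\<in>V. y * indicator (B y) x) = (\<Sum>y\<in>V. if y = s x then s x else 0)"
      using that by (intro sum.cong) (auto simp: B_def)
    also have "\<dots> = s x" using V that by (auto simp: V_def)
    finally show ?thesis .
  qed
  then have "Lp_int M p (\<lambda>x. f x - (\<Sum>y\<in>V. y * indicator (B y) x)) = Lp_int M p (\<lambda>x. f x - s x)"
    by (intro Lp_int_cong_AE) auto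
  with P s(3) show "\<exists>g\<in>Lp M p. P g \<and> Lp_int M p (\<lambda>x. f x - g x) < e" by auto
qed

section \<open>Countably generated \<open>\<sigma>\<close>-algebras\<close>

text \<open>Deletes the first \<open>n\<close> ternary digits of a number all of whose digits are 0 or 1; the unit digit of the
  result is then read off by comparison with 1.\<close>
primrec ternary_shift :: "nat \<Rightarrow> real \<Rightarrow> real" where
  "ternary_shift 0 y = y"
| "ternary_shift (Suc n) y = 3 * (ternary_shift n y - (if 1 \<le> ternary_shift n y then 1 else 0))"

lemma ternary_shift_measurable [measurable]: "ternary_shift n \<in> borel_measurable borel"
  by (induction n) auto

lemma ternary_summable: "summable (\<lambda>n. (1/3) ^ n * indicator (B n) x :: real)"
  by (rule summable_comparison_test[where g="\<lambda>n. (1/3) ^ n"])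
     (auto intro!: exI[of _ 0] split: split_indicator)

text \<open>Base 3 leaves a gap: everything after the leading digit amounts to at most 1/3 * 3/2 =
  1/2 < 1, so comparison with 1 reveals that digit. In base 2 the remaining digits could add up to
  1.\<close>

lemma ternary_sum_le: "(\<Sum>n. (1/3) ^ n * indicator (B n) x :: real) \<le> 3/2"
proof -
  have "(\<Sum>n. (1/3) ^ n * indicator (B n) x :: real) \<le> (\<Sum>n. (1/3) ^ n)"
    by (intro suminf_le ternary_summable) (auto split: split_indicator)
  also have "\<dots> = 3/2" by (subst suminf_geometric) auto
  finally show ?thesis .
qed

lemma ternary_sum_nonneg: "0 \<le> (\<Sum>n. (1/3) ^ n * indicator (B n) x :: real)"
  by (intro suminf_nonneg ternary_summable) auto

lemma ternary_sum_split:
  "(\<Sum>n. (1/3) ^ n * indicator (B n) x :: real)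
     = indicator (B 0) x + (1/3) * (\<Sum>n. (1/3) ^ n * indicator (B (Suc n)) x)"
  using suminf_split_head[OF ternary_summable, of B x] suminf_mult[OF ternary_summable, of "1/3" "\<lambda>n. B (Suc n)" x]
  by (simp add: mult.assoc)

lemma ternary_shift_sum:
  "ternary_shift n (\<Sum>k. (1/3) ^ k * indicator (B k) x)
     = (\<Sum>k. (1/3) ^ k * indicator (B (n + k)) x)"
proof (induction n)
  case (Suc n)
  define t where "t = (\<Sum>k. (1/3) ^ k * indicator (B (Suc n + k)) x :: real)"
  have t: "0 \<le> t" "t \<le> 3/2" unfolding t_def
    by (rule ternary_sum_nonneg[of "\<lambda>k. B (Suc n + k)"], rule ternary_sum_le[of "\<lambda>k. B (Suc n + k)"])
  have "(\<Sum>k. (1/3) ^ k * indicator (B (n + k)) x :: real) = indicator (B n) x + 1/3 * t"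
    using ternary_sum_split[of "\<lambda>k. B (n + k)" x] by (simp add: t_def)
  with t Suc have "ternary_shift (Suc n) (\<Sum>k. (1/3) ^ k * indicator (B k) x) = t"
    by (auto split: split_indicator)
  then show ?case by (simp only: t_def)
qed simp

lemma ternary_shift_ge_1_iff:
  "1 \<le> ternary_shift n (\<Sum>k. (1/3) ^ k * indicator (B k) x) \<longleftrightarrow> x \<in> B n"
proof -
  define t where "t = (\<Sum>k. (1/3) ^ k * indicator (B (Suc n + k)) x :: real)"
  have t: "0 \<le> t" "t \<le> 3/2" unfolding t_def
    by (rule ternary_sum_nonneg[of "\<lambda>k. B (Suc n + k)"], rule ternary_sum_le[of "\<lambda>k. B (Suc n + k)"])
  have "(\<Sum>k. (1/3) ^ k * indicator (B (n + k)) x :: real) = indicator (B n) x + 1/3 * t"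
    using ternary_sum_split[of "\<lambda>k. B (n + k)" x] by (simp add: t_def)
  with t show ?thesis by (auto simp: ternary_shift_sum split: split_indicator)
qed

text \<open>A weak substitute for a Borel isomorphism onto a subset of the line: \<open>j\<close>
  pulls the Borel sets back onto the whole sigma-algebra, and no question about the image of
  \<open>j\<close> arises.\<close>

definition generating_map :: "'a measure \<Rightarrow> ('a \<Rightarrow> real) \<Rightarrow> bool" where
  "generating_map M j \<longleftrightarrow> j \<in> borel_measurable M \<and>
     (\<forall>A\<in>sets M. \<exists>C\<in>sets borel. A = j -` C \<inter> space M)"

text \<open>Digit number n of \<open>j x\<close> records whether x lies in \<open>B n\<close>; each
  generator is then the preimage of a condition on a single digit.\<close>

lemma countably_generated_generating_map:
  fixes B :: "nat \<Rightarrow> 'a set"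
  assumes M: "sets M = sigma_sets (space M) (range B)"
  obtains j where "generating_map M j" "\<And>x. 0 \<le> j x \<and> j x \<le> 2"
proof
  define j where "j x = (\<Sum>k. (1/3) ^ k * indicator (B k) x :: real)" for x
  have [measurable]: "B n \<in> sets M" for n unfolding M by auto
  have j[measurable]: "j \<in> borel_measurable M" unfolding j_def by measurable
  show "0 \<le> j x \<and> j x \<le> 2" for x
    using ternary_sum_nonneg[of B x] ternary_sum_le[of B x] by (simp add: j_def)
  have B: "B n = j -` {y. 1 \<le> ternary_shift n y}" for n
    by (auto simp: j_def ternary_shift_ge_1_iff)
  have C: "{y. 1 \<le> ternary_shift n y} \<in> sets borel" for n by measurable
  have "sets M \<subseteq> sets (vimage_algebra (space M) j borel)"
    unfolding M
  proof (rule sets.sigma_sets_subset[of _ "vimage_algebra (space M) j borel", simplified])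
    show "range B \<subseteq> sets (vimage_algebra (space M) j borel)"
    proof safe
      fix n
      have "B n = j -` {y. 1 \<le> ternary_shift n y} \<inter> space M"
        using B[of n] sets.sets_into_space[OF \<open>\<And>n. B n \<in> sets M\<close>, of n] by blast
      then show "B n \<in> sets (vimage_algebra (space M) j borel)"
        using C[of n] by (subst sets_vimage_algebra2) (simp, blast)
    qed
  qed
  then show "generating_map M j"
    using j by (auto simp: generating_map_def sets_vimage_algebra2)
qed

lemma generating_map_factor_simple:
  assumes j: "generating_map M j" and F: "simple_function M F"
  shows "\<exists>F'. F' \<in> borel_measurable borel \<and> (\<forall>x\<in>space M. F' (j x) = F x)"
proof -
  have "\<exists>C\<in>sets borel. F -` {v} \<inter> space M = j -` C \<inter> space M" for v
    using j simple_functionD(2)[OF F, of "{v}"] by (auto simp: generating_map_def)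
  then obtain C where C[measurable]: "\<And>v. C v \<in> sets borel"
    and CF: "\<And>v. F -` {v} \<inter> space M = j -` C v \<inter> space M" by metis
  have "\<exists>F'. F' \<in> borel_measurable borel \<and> (\<forall>x\<in>space M. F x \<in> V \<longrightarrow> F' (j x) = F x)"
    if "finite V" for V
    using that
  proof (induction V)
    case empty
    show ?case by (auto intro: exI[of _ "\<lambda>_. undefined"])
  next
    case (insert v V)
    then obtain F' where [measurable]: "F' \<in> borel_measurable borel"
      and F': "\<And>x. x \<in> space M \<Longrightarrow> F x \<in> V \<Longrightarrow> F' (j x) = F x" by auto
    have "j x \<in> C v \<longleftrightarrow> F x = v" if "x \<in> space M" for x
      using CF[of v] that by auto
    then show ?case
      using F' by (intro exI[of _ "\<lambda>y. if y \<in> C v then v else F' y"]) auto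
  qed
  from this[of "F ` space M"] F show ?thesis by (auto simp: simple_function_def)
qed

text \<open>Doob-Dynkin factorisation through \<open>j\<close>: simple functions factor value by
  value, and the factors of a simple approximation converge on the image of
  \<open>j\<close>.\<close>

lemma generating_map_factor:
  fixes f :: "'a \<Rightarrow> 'b::{second_countable_topology, complete_space}"
  assumes j: "generating_map M j" and f[measurable]: "f \<in> borel_measurable M"
  obtains f' where "f' \<in> borel_measurable borel" "\<And>x. x \<in> space M \<Longrightarrow> f' (j x) = f x"
proof -
  from borel_measurable_implies_sequence_metric[OF f] obtain F where
    F: "\<And>i. simple_function M (F i)" "\<And>x. x \<in> space M \<Longrightarrow> (\<lambda>i. F i x) \<longlonglongrightarrow> f x"
    by metis
  from generating_map_factor_simple[OF j F(1)]
  obtain F' where [measurable]: "\<And>i. F' i \<in> borel_measurable borel"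
    and F': "\<And>i x. x \<in> space M \<Longrightarrow> F' i (j x) = F i x" by metis
  \<comment> \<open>Off the image of \<open>j\<close> nothing controls the sequence
    \<open>F' i y\<close>. Making it constant wherever it is not Cauchy forces convergence at every
    point, so that the limit is measurable.\<close>
  define G where "G i y = (if Cauchy (\<lambda>i. F' i y) then F' i y else undefined)" for i y
  have G: "G i \<in> borel_measurable borel" for i unfolding G_def by measurable
  have conv: "convergent (\<lambda>i. G i y)" for y
    unfolding G_def using Cauchy_convergent[of "\<lambda>i. F' i y"]
    by (cases "Cauchy (\<lambda>i. F' i y)") (simp_all add: convergent_const)
  show thesis
  proof (rule that)
    show "(\<lambda>y. lim (\<lambda>i. G i y)) \<in> borel_measurable borel"
    proof (rule borel_measurable_LIMSEQ_metric[where f=G])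
      show "(\<lambda>i. G i y) \<longlonglongrightarrow> lim (\<lambda>i. G i y)" for y
        using conv by (simp add: convergent_LIMSEQ_iff)
    qed (rule G)
    fix x assume x: "x \<in> space M"
    have "(\<lambda>i. F' i (j x)) \<longlonglongrightarrow> f x" using F(2)[OF x] F'[OF x] by simp
    then have "(\<lambda>i. G i (j x)) \<longlonglongrightarrow> f x"
      using LIMSEQ_imp_Cauchy[of "\<lambda>i. F' i (j x)"] by (simp add: G_def)
    then show "lim (\<lambda>i. G i (j x)) = f x" by (rule limI)
  qed
qed

text \<open>Factoring the identity through a generating map gives a measurable left inverse. This is
  all that the final transport to the line uses.\<close>

lemma borel_code:
  obtains j :: "'a::{second_countable_topology, complete_space} \<Rightarrow> real" and k
  where "j \<in> borel_measurable borel" "k \<in> borel_measurable borel" "\<And>y. k (j y) = y"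
proof -
  obtain \<B> :: "'a set set" where \<B>: "countable \<B>" "topological_basis \<B>"
    using ex_countable_basis by auto
  define B where "B = from_nat_into (insert {} \<B>)"
  have rB: "range B = insert {} \<B>"
    unfolding B_def using \<B> by (intro range_from_nat_into) auto
  have "sets (borel::'a measure) = sigma_sets UNIV (range B)"
  proof -
    have "sets (borel::'a measure) = sigma_sets UNIV \<B>"
      using borel_eq_countable_basis[OF \<B>] by (metis sets_measure_of top_greatest Pow_UNIV)
    also have "\<dots> = sigma_sets UNIV (insert {} \<B>)"
      by (rule sigma_sets_eqI) (auto intro: sigma_sets.Empty)
    finally show ?thesis by (simp add: rB)
  qed
  then obtain j where j: "generating_map (borel::'a measure) j"
    using countably_generated_generating_map[of "borel::'a measure" B] by (metis space_borel)
  from generating_map_factor[OF j, of "\<lambda>x. x"] obtain k where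
    "k \<in> borel_measurable borel" "\<And>y. k (j y) = y" by auto
  with j that show thesis by (auto simp: generating_map_def)
qed

lemma Polish_space_countable_generator:
  assumes "Polish_space T"
  obtains B :: "nat \<Rightarrow> 'a set" where "sets (borel_of T) = sigma_sets (topspace T) (range B)"
proof -
  from assms obtain M d where "Metric_space M d" and T: "T = Metric_space.mtopology M d"
    by (auto simp: Polish_space_def completely_metrizable_space_def)
  then interpret Metric_space M d by simp
  from assms obtain D where D: "countable D" "D \<subseteq> M" "T closure_of D = M"
    by (auto simp: Polish_space_def separable_space_def T)
  \<comment> \<open>The empty set keeps the family nonempty even over an empty space, as the
    enumeration by \<open>from_nat_into\<close> demands.\<close>
  define \<B> where "\<B> = insert {} ((\<lambda>(x, n). mball x (1 / Suc n)) ` (D \<times> (UNIV::nat set)))"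
  have cB: "countable \<B>" using D by (auto simp: \<B>_def)
  have opB: "openin T V" if "V \<in> \<B>" for V using that by (auto simp: \<B>_def T)
  have un: "U = \<Union>{V\<in>\<B>. V \<subseteq> U}" if U: "openin T U" for U
  proof (intro equalityI subsetI)
    fix x assume x: "x \<in> U"
    from U x obtain r where r: "r > 0" "mball x r \<subseteq> U" and xM: "x \<in> M"
      unfolding T openin_mtopology by blast
    obtain n where n: "1 / Suc n < r / 2" using r nat_approx_posE[of "r/2"] by auto
    have "x \<in> T closure_of D" using D xM by simp
    then obtain y where y: "y \<in> D" "y \<in> mball x (1 / Suc n)"
      unfolding T metric_closure_of using xM by (auto elim!: allE[of _ "1 / real (Suc n)"])
    have "mball y (1 / Suc n) \<subseteq> U"
    proof
      fix z assume z: "z \<in> mball y (1 / Suc n)"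
      have "d x z \<le> d x y + d y z" using y z xM by (intro triangle) auto
      also have "\<dots> < r" using y z n by auto
      finally show "z \<in> U" using r z xM by auto
    qed
    moreover have "x \<in> mball y (1 / Suc n)" using y xM by (auto simp: commute)
    moreover have "mball y (1 / Suc n) \<in> \<B>" using y by (auto simp: \<B>_def)
    ultimately show "x \<in> \<Union>{V\<in>\<B>. V \<subseteq> U}" by blast
  qed blast
  show thesis
  proof (rule that)
    have "sets (borel_of T) = sigma_sets (topspace T) {U. openin T U}"
      unfolding borel_of_def by (rule sets_measure_of) (auto dest: openin_subset)
    also have "\<dots> = sigma_sets (topspace T) \<B>"
    proof (rule sigma_sets_eqI)
      fix U assume "U \<in> {U. openin T U}"
      then have eq: "U = \<Union>{V\<in>\<B>. V \<subseteq> U}" by (intro un) blast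
      have "countable {V\<in>\<B>. V \<subseteq> U}"
        using cB by (rule countable_subset[rotated]) auto
      then have "\<Union>{V\<in>\<B>. V \<subseteq> U} \<in> sigma_sets (topspace T) \<B>"
        by (rule sigma_sets_UNION) auto
      then show "U \<in> sigma_sets (topspace T) \<B>" by (rule subst[OF eq[symmetric]])
    qed (use opB in \<open>simp add: sigma_sets.Basic\<close>)
    also have "\<B> = range (from_nat_into \<B>)"
      using cB by (intro range_from_nat_into[symmetric]) (simp_all add: \<B>_def)
    finally show "sets (borel_of T) = sigma_sets (topspace T) (range (from_nat_into \<B>))" .
  qed
qed

lemma standard_measure_space_generating_map:
  assumes "standard_measure_space M"
  obtains j where "generating_map M j" "\<And>x. 0 \<le> j x \<and> j x \<le> 2"
proof -
  from assms obtain T where T: "Polish_space T" "topspace T = space M" "sets M = sets (borel_of T)"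
    by (auto simp: standard_measure_space_def)
  obtain B :: "nat \<Rightarrow> 'a set" where "sets (borel_of T) = sigma_sets (topspace T) (range B)"
    using Polish_space_countable_generator[OF T(1)] by blast
  with T have "sets M = sigma_sets (space M) (range B)" by simp
  from countably_generated_generating_map[OF this] that show thesis by metis
qed

section \<open>Reduction to a finite measure on the real line\<close>

text \<open>\<open>U\<close> is the linear part of the action and \<open>b g\<close> the image of 0,
  so \<open>b_add\<close> is the cocycle identity of \<alpha>_g f = \<open>U g f\<close> +
  \<open>b g\<close>. The support condition \<open>bounded\<close> puts the identity function into
  L_p, and its images under \<open>U\<close> later give access to the point maps. Continuity is
  stated through \<open>Lp_int\<close>, which treats p < 1 and p >= 1 uniformly.\<close>

locale Lp_rep = finite_measure M for M :: "real measure" +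
  fixes p :: real
    and U :: "'g::topological_group_add \<Rightarrow> (real \<Rightarrow> real) \<Rightarrow> real \<Rightarrow> real"
    and b :: "'g \<Rightarrow> real \<Rightarrow> real"
  assumes p_pos: "0 < p"
    and sets_M [measurable_cong]: "sets M = sets borel"
    and bounded: "AE x in M. 0 \<le> x \<and> x \<le> 2"
    and U_Lp: "\<And>g f. f \<in> Lp M p \<Longrightarrow> U g f \<in> Lp M p"
    and U_iso: "\<And>g f. f \<in> Lp M p \<Longrightarrow> Lp_int M p (U g f) = Lp_int M p f"
    and U_lin: "\<And>g s f f'. f \<in> Lp M p \<Longrightarrow> f' \<in> Lp M p \<Longrightarrow>
        AE x in M. U g (\<lambda>x. s * f x + f' x) x = s * U g f x + U g f' x"
    and U_0: "\<And>f. f \<in> Lp M p \<Longrightarrow> AE x in M. U 0 f x = f x"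
    and U_add: "\<And>g g' f. f \<in> Lp M p \<Longrightarrow> AE x in M. U (g + g') f x = U g (U g' f) x"
    and b_Lp: "\<And>g. b g \<in> Lp M p"
    and b_add: "\<And>g g'. AE x in M. b (g + g') x = U g (b g') x + b g x"
    and U_cont: "\<And>g0 f e. f \<in> Lp M p \<Longrightarrow> 0 < e \<Longrightarrow>
        \<forall>\<^sub>F g in nhds g0. Lp_int M p (\<lambda>x. U g f x - U g0 f x) < ennreal e"
    and b_cont: "\<And>g0 e. 0 < e \<Longrightarrow>
        \<forall>\<^sub>F g in nhds g0. Lp_int M p (\<lambda>x. b g x - b g0 x) < ennreal e"

lemma powr_cancel_nonneg:
  fixes x y a :: real
  assumes "0 \<le> x" "0 \<le> y" "a \<noteq> 0" "x powr a = y powr a"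
  shows "x = y"
proof -
  have "x = (x powr a) powr (1 / a)" using assms(1,3) by (simp add: powr_powr)
  also have "\<dots> = y" using assms(2,3) unfolding assms(4) by (simp add: powr_powr)
  finally show ?thesis .
qed

lemma Lp_dist_eq_imp_Lp_int_eq:
  assumes "0 < p" "f \<in> Lp M p" "f' \<in> Lp M p" "h \<in> Lp M p" "h' \<in> Lp M p"
    and "Lp_dist M p f f' = Lp_dist M p h h'"
  shows "Lp_int M p (\<lambda>x. f x - f' x) = Lp_int M p (\<lambda>x. h x - h' x)"
proof -
  have fin: "Lp_int M p (\<lambda>x. f x - f' x) < \<infinity>" "Lp_int M p (\<lambda>x. h x - h' x) < \<infinity>"
    using Lp_diff[OF assms(1-3)] Lp_diff[OF assms(1,4,5)] by (auto simp: Lp_def)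
  have "enn2real (Lp_int M p (\<lambda>x. f x - f' x)) = enn2real (Lp_int M p (\<lambda>x. h x - h' x))"
    using assms(1,6) powr_cancel_nonneg[of "enn2real (Lp_int M p (\<lambda>x. f x - f' x))"
        "enn2real (Lp_int M p (\<lambda>x. h x - h' x))" "1 / p"]
    by (auto simp: Lp_dist_def Lp_norm_def split: if_splits)
  with fin show ?thesis by (metis ennreal_enn2real infinity_ennreal_def)
qed

lemma Lp_dist_less_imp_Lp_int_less:
  assumes "0 < p" "f \<in> Lp M p" "f' \<in> Lp M p" "0 < e"
    and "Lp_dist M p f f' < (if p < 1 then e else e powr (1 / p))"
  shows "Lp_int M p (\<lambda>x. f x - f' x) < ennreal e"
proof -
  have fin: "Lp_int M p (\<lambda>x. f x - f' x) < \<infinity>"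
    using Lp_diff[OF assms(1-3)] by (auto simp: Lp_def)
  have "enn2real (Lp_int M p (\<lambda>x. f x - f' x)) < e"
  proof (cases "p < 1")
    case False
    with assms have "enn2real (Lp_int M p (\<lambda>x. f x - f' x)) powr (1 / p) < e powr (1 / p)"
      by (simp add: Lp_dist_def Lp_norm_def)
    then show ?thesis
      using assms by (meson powr_mono2 not_less less_eq_real_def enn2real_nonneg zero_le_divide_1_iff)
  qed (use assms in \<open>simp add: Lp_dist_def\<close>)
  with fin show ?thesis
    by (metis ennreal_enn2real ennreal_lessI infinity_ennreal_def assms(4))
qed

section \<open>The linear part of a continuous affine isometric action\<close>

locale Lp_action =
  fixes p :: real and M :: "'x measure"
    and \<alpha> :: "'g::topological_group_add \<Rightarrow> ('x \<Rightarrow> real) \<Rightarrow> 'x \<Rightarrow> real"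
  assumes p_pos: "0 < p" and act: "continuous_affine_isometric_action p M \<alpha>"
begin

lemma act_Lp: "f \<in> Lp M p \<Longrightarrow> \<alpha> g f \<in> Lp M p"
  using act by (auto simp: continuous_affine_isometric_action_def affine_isometric_action_def)

lemma act_dist:
  assumes "f \<in> Lp M p" "f' \<in> Lp M p"
  shows "Lp_int M p (\<lambda>x. \<alpha> g f x - \<alpha> g f' x) = Lp_int M p (\<lambda>x. f x - f' x)"
  using assms act
  by (intro Lp_dist_eq_imp_Lp_int_eq p_pos act_Lp)
     (auto simp: continuous_affine_isometric_action_def affine_isometric_action_def)

lemma act_affine:
  assumes "f \<in> Lp M p" "f' \<in> Lp M p"
  shows "AE x in M. \<alpha> g (\<lambda>y. t * f y + (1 - t) * f' y) x = t * \<alpha> g f x + (1 - t) * \<alpha> g f' x"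
  using assms act
  by (auto simp: continuous_affine_isometric_action_def affine_isometric_action_def)

lemma act_0: "f \<in> Lp M p \<Longrightarrow> AE x in M. \<alpha> 0 f x = f x"
  using act by (auto simp: continuous_affine_isometric_action_def affine_isometric_action_def)

lemma act_add: "f \<in> Lp M p \<Longrightarrow> AE x in M. \<alpha> (g + g') f x = \<alpha> g (\<alpha> g' f) x"
  using act by (auto simp: continuous_affine_isometric_action_def affine_isometric_action_def)

lemma act_cont:
  assumes "f \<in> Lp M p" "0 < e"
  shows "\<forall>\<^sub>F g in nhds g0. Lp_int M p (\<lambda>x. \<alpha> g f x - \<alpha> g0 f x) < ennreal e"
proof -
  have "\<forall>\<^sub>F g in nhds g0. Lp_dist M p (\<alpha> g f) (\<alpha> g0 f) < (if p < 1 then e else e powr (1 / p))"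
    using assms act by (simp add: continuous_affine_isometric_action_def)
  then show ?thesis
    by eventually_elim (intro Lp_dist_less_imp_Lp_int_less p_pos act_Lp assms)
qed

definition lin :: "'g \<Rightarrow> ('x \<Rightarrow> real) \<Rightarrow> 'x \<Rightarrow> real" where
  "lin g f x = \<alpha> g f x - \<alpha> g (\<lambda>_. 0) x"

lemma lin_Lp: "f \<in> Lp M p \<Longrightarrow> lin g f \<in> Lp M p"
  unfolding lin_def using Lp_diff[OF p_pos act_Lp act_Lp[OF Lp_zero], of f] by simp

lemma lin_iso: "f \<in> Lp M p \<Longrightarrow> Lp_int M p (lin g f) = Lp_int M p f"
  unfolding lin_def using act_dist[OF _ Lp_zero, of f] by simp

text \<open>The action is defined on representatives and is not assumed to respect almost everywhere
  equality; preservation of distances forces it to.\<close>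

lemma lin_cong:
  assumes "f \<in> Lp M p" "f' \<in> Lp M p" "AE x in M. f x = f' x"
  shows "AE x in M. lin g f x = lin g f' x"
proof -
  have "Lp_int M p (\<lambda>x. f x - f' x) = 0"
    using assms by (subst Lp_int_eq_0_iff) (auto simp: Lp_def)
  with act_dist[OF assms(1,2)] have "Lp_int M p (\<lambda>x. \<alpha> g f x - \<alpha> g f' x) = 0" by simp
  moreover have "(\<lambda>x. \<alpha> g f x - \<alpha> g f' x) \<in> borel_measurable M"
    using assms by (intro borel_measurable_diff Lp_measurable[OF act_Lp])
  ultimately show ?thesis by (auto simp: Lp_int_eq_0_iff lin_def)
qed

text \<open>Affinity concerns combinations with weights t and 1 - t only. Combining with the zero
  function at t = 2s and t = 2 gives the images of 2 s f and 2 f', and the midpoint of these two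
  functions is s f + f'.\<close>

lemma lin_lin:
  assumes f: "f \<in> Lp M p" and f': "f' \<in> Lp M p"
  shows "AE x in M. lin g (\<lambda>x. s * f x + f' x) x = s * lin g f x + lin g f' x"
proof -
  have 1: "AE x in M. \<alpha> g (\<lambda>y. 2 * s * f y) x = 2 * s * \<alpha> g f x + (1 - 2 * s) * \<alpha> g (\<lambda>_. 0) x"
    using act_affine[OF f Lp_zero, of g "2 * s"] by simp
  have 2: "AE x in M. \<alpha> g (\<lambda>y. 2 * f' y) x = 2 * \<alpha> g f' x - \<alpha> g (\<lambda>_. 0) x"
    using act_affine[OF f' Lp_zero, of g 2] by simp
  have "AE x in M. \<alpha> g (\<lambda>y. 1/2 * (2 * s * f y) + (1 - 1/2) * (2 * f' y)) x
      = 1/2 * \<alpha> g (\<lambda>y. 2 * s * f y) x + (1 - 1/2) * \<alpha> g (\<lambda>y. 2 * f' y) x"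
    by (rule act_affine) (intro Lp_scale f f')+
  moreover have "(\<lambda>y. 1/2 * (2 * s * f y) + (1 - 1/2) * (2 * f' y)) = (\<lambda>y. s * f y + f' y)"
    by (simp add: fun_eq_iff)
  ultimately have "AE x in M. \<alpha> g (\<lambda>y. s * f y + f' y) x
      = 1/2 * \<alpha> g (\<lambda>y. 2 * s * f y) x + 1/2 * \<alpha> g (\<lambda>y. 2 * f' y) x" by simp
  with 1 2 show ?thesis
    by eventually_elim (simp add: lin_def algebra_simps)
qed

lemma lin_diff:
  assumes "f \<in> Lp M p" "f' \<in> Lp M p"
  shows "AE x in M. lin g (\<lambda>x. f x - f' x) x = lin g f x - lin g f' x"
  using lin_lin[OF assms(2,1), of g "-1"] by simp

lemma lin_add:
  assumes f: "f \<in> Lp M p"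
  shows "AE x in M. lin (g + g') f x = lin g (lin g' f) x"
proof -
  have "AE x in M. lin g (lin g' f) x = lin g (\<alpha> g' f) x - lin g (\<alpha> g' (\<lambda>_. 0)) x"
    using lin_diff[OF act_Lp[OF f] act_Lp[OF Lp_zero], of g g' g'] by (simp add: lin_def[of g', abs_def])
  with act_add[OF f, of g g'] act_add[OF Lp_zero, of g g'] show ?thesis
    by eventually_elim (simp add: lin_def)
qed

lemma lin_cont:
  assumes f: "f \<in> Lp M p" and e: "0 < e"
  shows "\<forall>\<^sub>F g in nhds g0. Lp_int M p (\<lambda>x. lin g f x - lin g0 f x) < ennreal e"
proof -
  define c where "c = 2 powr p"
  have c: "c > 0" by (simp add: c_def)
  have "\<forall>\<^sub>F g in nhds g0. Lp_int M p (\<lambda>x. \<alpha> g f x - \<alpha> g0 f x) < ennreal (e / (2 * c))"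
    "\<forall>\<^sub>F g in nhds g0. Lp_int M p (\<lambda>x. \<alpha> g (\<lambda>_. 0) x - \<alpha> g0 (\<lambda>_. 0) x) < ennreal (e / (2 * c))"
    using e c by (auto intro!: act_cont f Lp_zero)
  then show ?thesis
  proof eventually_elim
    case (elim g)
    have [measurable]: "\<alpha> g f \<in> borel_measurable M" "\<alpha> g (\<lambda>_. 0) \<in> borel_measurable M" for g
      using act_Lp[OF f] act_Lp[OF Lp_zero] by (auto simp: Lp_def)
    have "Lp_int M p (\<lambda>x. lin g f x - lin g0 f x)
        = Lp_int M p (\<lambda>x. (\<alpha> g f x - \<alpha> g0 f x) - (\<alpha> g (\<lambda>_. 0) x - \<alpha> g0 (\<lambda>_. 0) x))"
      by (simp add: lin_def algebra_simps)
    also have "\<dots> \<le> ennreal c * (Lp_int M p (\<lambda>x. \<alpha> g f x - \<alpha> g0 f x)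
        + Lp_int M p (\<lambda>x. \<alpha> g (\<lambda>_. 0) x - \<alpha> g0 (\<lambda>_. 0) x))"
      unfolding c_def by (intro Lp_int_diff_le p_pos) auto
    also have "\<dots> < ennreal c * (ennreal (e / (2 * c)) + ennreal (e / (2 * c)))"
      using elim c by (intro ennreal_mult_strict_left_mono add_strict_mono) auto
    also have "\<dots> = ennreal e"
      using c e by (simp flip: ennreal_plus ennreal_mult add: field_simps)
    finally show ?case .
  qed
qed

end

text \<open>The map f to w * (f o j) is an isometry from L_p of the new measure onto the old L_p
  space: it preserves integrals by the choice of density and image measure, and it is onto because
  \<open>F / w\<close> factors through \<open>j\<close>. The action is conjugated by it.\<close>

theorem Kp_imp_Lp_rep:
  fixes \<psi> :: "'g::topological_group_add \<Rightarrow> real"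
  assumes p: "0 < p" and \<psi>: "\<psi> \<in> Kp TYPE('x) p"
  obtains M U b where "Lp_rep M p (U :: 'g \<Rightarrow> _) b" "\<And>g. \<psi> g = enn2real (Lp_int M p (b g))"
proof -
  from \<psi> obtain M :: "'x measure" and \<alpha> where M: "sigma_finite_standard M"
    and \<alpha>: "continuous_affine_isometric_action p M \<alpha>"
    and \<psi>_eq: "\<And>g. \<psi> g = Lp_norm M p (\<alpha> g (\<lambda>_. 0)) powr p"
    by (auto simp: Kp_def)
  interpret Lp_action p M \<alpha> by standard fact+
  interpret sigma_finite_measure M using M by (simp add: sigma_finite_standard_def)
  from M obtain j where j: "generating_map M j" and j02: "\<And>x. 0 \<le> j x \<and> j x \<le> 2"
    using standard_measure_space_generating_map by (auto simp: sigma_finite_standard_def)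
  have jm[measurable]: "j \<in> borel_measurable M" using j by (simp add: generating_map_def)
  from Ex_finite_integrable_function obtain k where k[measurable]: "k \<in> borel_measurable M"
    and k1: "integral\<^sup>N M k \<noteq> \<infinity>" and k2: "\<And>x. x \<in> space M \<Longrightarrow> 0 < k x \<and> k x < \<infinity>" by blast
  \<comment> \<open>The p-th power of \<open>w\<close> is the strictly positive integrable function
    \<open>k\<close>: the weighted measure is finite and has the null sets of
    \<open>M\<close>.\<close>
  define w where "w x = enn2real (k x) powr (1 / p)" for x
  have wm[measurable]: "w \<in> borel_measurable M" unfolding w_def by measurable
  have w_pos: "0 < w x" if "x \<in> space M" for x
    using k2[OF that] by (auto simp: w_def enn2real_eq_0_iff)
  have w_powr: "ennreal (w x powr p) = k x" if "x \<in> space M" for x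
    using k2[OF that] p by (simp add: w_def powr_powr)
  define M' where "M' = distr (density M (\<lambda>x. ennreal (w x powr p))) borel j"
  have sM'[measurable_cong]: "sets M' = sets borel" by (simp add: M'_def)
  define lift where "lift f x = w x * f (j x)" for f :: "real \<Rightarrow> real" and x
  have lift_m: "lift f \<in> borel_measurable M" if [measurable]: "f \<in> borel_measurable borel" for f
    unfolding lift_def by measurable
  have Lp_int_lift: "Lp_int M' p f = Lp_int M p (lift f)" if [measurable]: "f \<in> borel_measurable borel" for f
  proof -
    have "Lp_int M' p f = (\<integral>\<^sup>+x. ennreal (w x powr p) * ennreal (\<bar>f (j x)\<bar> powr p) \<partial>M)"
      unfolding Lp_int_def M'_def by (simp add: nn_integral_distr nn_integral_density)
    also have "\<dots> = Lp_int M p (lift f)"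
      unfolding Lp_int_def lift_def
      by (intro nn_integral_cong)
         (use w_pos in \<open>force simp: abs_mult powr_mult ennreal_mult[symmetric]\<close>)
    finally show ?thesis .
  qed
  have lift_Lp: "lift f \<in> Lp M p" if "f \<in> Lp M' p" for f
    using that Lp_int_lift[of f] lift_m[of f] by (auto simp: Lp_def measurable_cong_sets[OF sM' refl])
  have AE_M': "(AE y in M'. f y = f' y) \<longleftrightarrow> (AE x in M. f (j x) = f' (j x))"
    if [measurable]: "f \<in> borel_measurable borel" "f' \<in> borel_measurable borel" for f f' :: "real \<Rightarrow> real"
  proof -
    have "(AE y in M'. f y = f' y) \<longleftrightarrow> (AE x in density M (\<lambda>x. ennreal (w x powr p)). f (j x) = f' (j x))"
      unfolding M'_def by (subst AE_distr_iff) auto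
    also have "\<dots> \<longleftrightarrow> (AE x in M. f (j x) = f' (j x))"
      using w_pos by (subst AE_density) (auto intro!: AE_cong, force)
    finally show ?thesis .
  qed
  \<comment> \<open>An inverse of \<open>lift\<close>; the factor through \<open>j\<close> is unique
    only up to null sets, so one is chosen.\<close>
  define drop where "drop F = (SOME f. f \<in> borel_measurable borel \<and> (\<forall>x\<in>space M. f (j x) = F x / w x))"
    for F :: "'x \<Rightarrow> real"
  have drop: "drop F \<in> borel_measurable borel \<and> (\<forall>x\<in>space M. drop F (j x) = F x / w x)"
    if [measurable]: "F \<in> borel_measurable M" for F
  proof -
    have "(\<lambda>x. F x / w x) \<in> borel_measurable M" by measurable
    from generating_map_factor[OF j this] show ?thesis
      unfolding drop_def by (intro someI_ex[where P="\<lambda>f. f \<in> borel_measurable borel \<and> (\<forall>x\<in>space M. f (j x) = F x / w x)"]) metis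
  qed
  have drop_m[measurable]: "drop F \<in> borel_measurable borel" if "F \<in> Lp M p" for F
    using drop[OF Lp_measurable[OF that]] by simp
  have lift_drop: "lift (drop F) x = F x" if "F \<in> Lp M p" "x \<in> space M" for F x
    using drop[OF Lp_measurable[OF that(1)]] w_pos[OF that(2)] that(2) by (simp add: lift_def)
  have Lp_int_lift_drop: "Lp_int M' p f = Lp_int M p F"
    if "f \<in> borel_measurable borel" "\<And>x. x \<in> space M \<Longrightarrow> lift f x = F x" for f F
    using that by (subst Lp_int_lift) (auto intro!: Lp_int_cong_AE)
  have drop_Lp: "drop F \<in> Lp M' p" if "F \<in> Lp M p" for F
    using Lp_int_lift_drop[OF drop_m[OF that] lift_drop[OF that]] that drop_m[OF that]
    by (auto simp: Lp_def measurable_cong_sets[OF sM' refl])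
  have AE_lift: "(AE y in M'. f y = f' y) \<longleftrightarrow> (AE x in M. lift f x = lift f' x)"
    if "f \<in> borel_measurable borel" "f' \<in> borel_measurable borel" for f f'
    unfolding AE_M'[OF that] lift_def using w_pos by (intro AE_cong) force
  have Lpm: "f \<in> borel_measurable borel" if "f \<in> Lp M' p" for f
    using Lp_measurable[OF that] by (simp add: measurable_cong_sets[OF sM' refl])
  have lift_lin: "lift (\<lambda>x. s * f x + f' x) = (\<lambda>x. s * lift f x + lift f' x)" for s f f'
    by (simp add: lift_def fun_eq_iff algebra_simps)
  have lift_diff: "lift (\<lambda>x. f x - f' x) = (\<lambda>x. lift f x - lift f' x)" for f f'
    by (simp add: lift_def fun_eq_iff algebra_simps)
  have lift_add: "lift (\<lambda>x. f x + f' x) = (\<lambda>x. lift f x + lift f' x)" for f f'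
    by (simp add: lift_def fun_eq_iff algebra_simps)
  define U where "U g f = drop (lin g (lift f))" for g f
  define b where "b g = drop (\<alpha> g (\<lambda>_. 0))" for g
  have U_Lp': "U g f \<in> Lp M' p" if "f \<in> Lp M' p" for g f
    unfolding U_def by (intro drop_Lp lin_Lp lift_Lp that)
  have b_Lp': "b g \<in> Lp M' p" for g
    unfolding b_def by (intro drop_Lp act_Lp Lp_zero)
  have lU: "lift (U g f) x = lin g (lift f) x" if "f \<in> Lp M' p" "x \<in> space M" for g f x
    unfolding U_def by (intro lift_drop lin_Lp lift_Lp that)
  have lb: "lift (b g) x = \<alpha> g (\<lambda>_. 0) x" if "x \<in> space M" for g x
    unfolding b_def by (intro lift_drop act_Lp Lp_zero that)
  have lin_lU: "AE x in M. lin g (lift (U g' f)) x = lin g (lin g' (lift f)) x" if "f \<in> Lp M' p" for g g' f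
    by (intro lin_cong lift_Lp U_Lp' lin_Lp that AE_I2 lU)
  have lin_lb: "AE x in M. lin g (lift (b g')) x = lin g (\<alpha> g' (\<lambda>_. 0)) x" for g g'
    by (intro lin_cong lift_Lp b_Lp' act_Lp Lp_zero AE_I2 lb)
  have "Lp_rep M' p U b"
  proof (rule Lp_rep.intro; (rule Lp_rep_axioms.intro)?)
    have "emeasure M' (space M') = (\<integral>\<^sup>+x. ennreal (w x powr p) \<partial>M)"
      by (simp add: M'_def emeasure_distr emeasure_density)
    also have "\<dots> = integral\<^sup>N M k" by (intro nn_integral_cong w_powr)
    finally show "finite_measure M'" using k1 by (intro finite_measureI) simp
    show "0 < p" "sets M' = sets borel" by fact+
    show "AE x in M'. 0 \<le> x \<and> x \<le> 2"
      unfolding M'_def using j02 by (subst AE_distr_iff) auto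
    fix g g' :: 'g and f f' :: "real \<Rightarrow> real" and s :: real
    show "b g \<in> Lp M' p" by (rule b_Lp')
    show "AE x in M'. b (g + g') x = U g (b g') x + b g x"
    proof (subst AE_lift)
      have "AE x in M. \<alpha> (g + g') (\<lambda>_. 0) x = lin g (\<alpha> g' (\<lambda>_. 0)) x + \<alpha> g (\<lambda>_. 0) x"
        using act_add[OF Lp_zero, of g g'] by (simp add: lin_def)
      then show "AE x in M. lift (b (g + g')) x = lift (\<lambda>x. U g (b g') x + b g x) x"
        using lin_lb[of g g'] AE_space
        by eventually_elim (simp add: lift_add lb lU[OF b_Lp'])
    qed (intro borel_measurable_add Lpm[OF U_Lp'] Lpm[OF b_Lp'] b_Lp')+
    show "\<forall>\<^sub>F h in nhds g. Lp_int M' p (\<lambda>x. b h x - b g x) < ennreal e" if "0 < e" for e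
    proof -
      have "Lp_int M' p (\<lambda>x. b h x - b g x) = Lp_int M p (\<lambda>x. \<alpha> h (\<lambda>_. 0) x - \<alpha> g (\<lambda>_. 0) x)" for h
        by (intro Lp_int_lift_drop borel_measurable_diff Lpm b_Lp') (simp add: lift_diff lb)
      with act_cont[OF Lp_zero that] show ?thesis by simp
    qed
    assume f: "f \<in> Lp M' p"
    show "U g f \<in> Lp M' p" by (rule U_Lp'[OF f])
    show "Lp_int M' p (U g f) = Lp_int M' p f"
      using Lp_int_lift_drop[OF Lpm[OF U_Lp'[OF f]] lU[OF f]] lin_iso[OF lift_Lp[OF f]]
        Lp_int_lift[OF Lpm[OF f]] by simp
    show "AE x in M'. U 0 f x = f x"
    proof (subst AE_lift)
      have "AE x in M. lin 0 (lift f) x = lift f x"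
        using act_0[OF lift_Lp[OF f]] act_0[OF Lp_zero] by eventually_elim (simp add: lin_def)
      then show "AE x in M. lift (U 0 f) x = lift f x"
        using AE_space by eventually_elim (simp add: lU[OF f])
    qed (auto intro!: Lpm U_Lp' f)
    show "AE x in M'. U (g + g') f x = U g (U g' f) x"
    proof (subst AE_lift)
      show "AE x in M. lift (U (g + g') f) x = lift (U g (U g' f)) x"
        using lin_lU[OF f, of g g'] lin_add[OF lift_Lp[OF f], of g g'] AE_space
        by eventually_elim (simp add: lU[OF f] lU[OF U_Lp'[OF f]])
    qed (auto intro!: Lpm U_Lp' f)
    show "\<forall>\<^sub>F h in nhds g. Lp_int M' p (\<lambda>x. U h f x - U g f x) < ennreal e" if "0 < e" for e
    proof -
      have "Lp_int M' p (\<lambda>x. U h f x - U g f x) = Lp_int M p (\<lambda>x. lin h (lift f) x - lin g (lift f) x)" for h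
        by (intro Lp_int_lift_drop borel_measurable_diff Lpm U_Lp' f) (simp add: lift_diff lU[OF f])
      with lin_cont[OF lift_Lp[OF f] that] show ?thesis by simp
    qed
    assume f': "f' \<in> Lp M' p"
    have ff: "(\<lambda>x. s * f x + f' x) \<in> Lp M' p" by (intro Lp_add p Lp_scale f f')
    show "AE x in M'. U g (\<lambda>x. s * f x + f' x) x = s * U g f x + U g f' x"
    proof (subst AE_lift)
      show "AE x in M. lift (U g (\<lambda>x. s * f x + f' x)) x = lift (\<lambda>x. s * U g f x + U g f' x) x"
        using lin_lin[OF lift_Lp[OF f] lift_Lp[OF f'], of g s] AE_space
        by eventually_elim (simp add: lU[OF ff] lift_lin lU[OF f] lU[OF f'])
    qed (intro borel_measurable_add borel_measurable_times borel_measurable_const Lpm[OF U_Lp'] f f' ff)+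
  qed
  moreover have "\<psi> g = enn2real (Lp_int M' p (b g))" for g
    using Lp_int_lift_drop[OF Lpm[OF b_Lp'] lb, of g] \<psi>_eq[of g] p
    by (simp add: Lp_norm_def powr_powr)
  ultimately show thesis using that by blast
qed

section \<open>Skew systems\<close>

lemma Lp_AE_eqI:
  assumes "f \<in> borel_measurable M" "g \<in> borel_measurable M"
    and le: "\<And>e::ennreal. 0 < e \<Longrightarrow> Lp_int M p (\<lambda>x. f x - g x) \<le> ennreal K * e"
  shows "AE x in M. f x = g x"
proof -
  have "Lp_int M p (\<lambda>x. f x - g x) \<le> 0"
  proof (rule ennreal_le_epsilon)
    fix e :: real assume e: "0 < e"
    have "Lp_int M p (\<lambda>x. f x - g x) \<le> ennreal K * ennreal (e / max K 1)"
      using e by (intro le) auto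
    also have "\<dots> \<le> ennreal (max K 1) * ennreal (e / max K 1)"
      by (intro mult_right_mono ennreal_leI) auto
    also have "\<dots> = ennreal e" using e by (subst ennreal_mult[symmetric]) auto
    finally show "Lp_int M p (\<lambda>x. f x - g x) \<le> 0 + ennreal e" by simp
  qed
  then show ?thesis using assms(1,2) by (auto simp: Lp_int_eq_0_iff)
qed

lemma nn_integral_push:
  assumes sets_M[measurable_cong]: "sets M = sets borel"
    and [measurable]: "S \<in> borel_measurable borel" "c \<in> borel_measurable borel" "F \<in> borel_measurable borel"
    and push: "\<And>A. A \<in> sets borel \<Longrightarrow>
        (\<integral>\<^sup>+x. ennreal (\<bar>c x\<bar> powr p) * indicator A (S x) \<partial>M) = emeasure M A"
  shows "(\<integral>\<^sup>+x. ennreal (\<bar>c x\<bar> powr p) * F (S x) \<partial>M) = (\<integral>\<^sup>+x. F x \<partial>M)"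
proof -
  have sp: "space M = UNIV" using sets_eq_imp_space_eq[OF sets_M] by simp
  have "distr (density M (\<lambda>x. ennreal (\<bar>c x\<bar> powr p))) borel S = M"
  proof (rule measure_eqI)
    fix A assume "A \<in> sets (distr (density M (\<lambda>x. ennreal (\<bar>c x\<bar> powr p))) borel S)"
    then have [measurable]: "A \<in> sets borel" by simp
    have "emeasure (distr (density M (\<lambda>x. ennreal (\<bar>c x\<bar> powr p))) borel S) A
        = (\<integral>\<^sup>+x. ennreal (\<bar>c x\<bar> powr p) * indicator (S -` A \<inter> space M) x \<partial>M)"
      by (subst emeasure_distr) (auto simp: emeasure_density)
    also have "\<dots> = (\<integral>\<^sup>+x. ennreal (\<bar>c x\<bar> powr p) * indicator A (S x) \<partial>M)"
      by (intro nn_integral_cong) (auto simp: indicator_def)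
    finally show "emeasure (distr (density M (\<lambda>x. ennreal (\<bar>c x\<bar> powr p))) borel S) A = emeasure M A"
      by (simp add: push)
  qed (simp add: sets_M)
  then have "(\<integral>\<^sup>+x. F x \<partial>M) = (\<integral>\<^sup>+x. F x \<partial>distr (density M (\<lambda>x. ennreal (\<bar>c x\<bar> powr p))) borel S)"
    by simp
  also have "\<dots> = (\<integral>\<^sup>+x. ennreal (\<bar>c x\<bar> powr p) * F (S x) \<partial>M)"
    by (subst nn_integral_distr) (auto simp: nn_integral_density)
  finally show ?thesis by simp
qed

text \<open>Since the weight vanishes nowhere, preimages of null sets under \<open>S\<close> are
  null. This permits composing almost everywhere identities with \<open>S\<close>.\<close>

lemma AE_push:
  assumes sets_M[measurable_cong]: "sets M = sets borel"
    and [measurable]: "S \<in> borel_measurable borel" "c \<in> borel_measurable borel"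
    and push: "\<And>A. A \<in> sets borel \<Longrightarrow>
        (\<integral>\<^sup>+x. ennreal (\<bar>c x\<bar> powr p) * indicator A (S x) \<partial>M) = emeasure M A"
    and c: "\<And>x. c x \<noteq> (0::real)" and P: "AE x in M. P x"
  shows "AE x in M. P (S x)"
proof -
  from P obtain N where N: "{x \<in> space M. \<not> P x} \<subseteq> N" "emeasure M N = 0" and [measurable]: "N \<in> sets M"
    by (auto elim: AE_E)
  have [measurable]: "N \<in> sets borel" using \<open>N \<in> sets M\<close> sets_M by simp
  have "(\<integral>\<^sup>+x. ennreal (\<bar>c x\<bar> powr p) * indicator N (S x) \<partial>M) = 0"
    using push[of N] N(2) by simp
  then have "AE x in M. ennreal (\<bar>c x\<bar> powr p) * indicator N (S x) = 0"
    by (subst (asm) nn_integral_0_iff_AE) auto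
  then show ?thesis
  proof eventually_elim
    case (elim x)
    then have "S x \<notin> N" using c[of x] by (auto simp: indicator_def split: if_splits)
    then show ?case using N(1) sets_eq_imp_space_eq[OF sets_M] by auto
  qed
qed

text \<open>
  The affine isometries are \<open>\<alpha>\<^sub>g f = c\<^sub>g \<cdot> (f \<circ> S\<^sub>g) + b\<^sub>g\<close>; \<open>push\<close> says that their linear parts are isometric.
  The group need not be first countable, so continuity is phrased through neighbourhoods \<open>P n\<close> which
  force almost everywhere convergence along any sequence of \<open>\<gamma> n\<close> in \<open>P n\<close>.
\<close>
locale skew_system = finite_measure M
  for M :: "'a::{second_countable_topology, complete_space} measure" +
  fixes p :: real
    and S :: "'g::topological_group_add \<Rightarrow> 'a \<Rightarrow> 'a"
    and c b :: "'g \<Rightarrow> 'a \<Rightarrow> real"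
  assumes p_pos: "0 < p"
    and sets_M [measurable_cong]: "sets M = sets borel"
    and S_measurable [measurable]: "\<And>g. S g \<in> borel_measurable borel"
    and c_measurable [measurable]: "\<And>g. c g \<in> borel_measurable borel"
    and b_measurable [measurable]: "\<And>g. b g \<in> borel_measurable borel"
    and c_nonzero: "\<And>g x. c g x \<noteq> 0"
    and push: "\<And>g A. A \<in> sets borel \<Longrightarrow>
        (\<integral>\<^sup>+x. ennreal (\<bar>c g x\<bar> powr p) * indicator A (S g x) \<partial>M) = emeasure M A"
    and S_0: "AE x in M. S 0 x = x"
    and c_0: "AE x in M. c 0 x = 1"
    and S_add: "\<And>g g'. AE x in M. S (g + g') x = S g' (S g x)"
    and c_add: "\<And>g g'. AE x in M. c (g + g') x = c g x * c g' (S g x)"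
    and b_add: "\<And>g g'. AE x in M. b (g + g') x = c g x * b g' (S g x) + b g x"
    and cont: "\<And>g0. \<exists>P. (\<forall>n::nat. \<forall>\<^sub>F g in nhds g0. P n g) \<and>
        (\<forall>\<gamma>. (\<forall>n. P n (\<gamma> n)) \<longrightarrow> (AE x in M. (\<lambda>n. S (\<gamma> n) x) \<longlonglongrightarrow> S g0 x \<and>
            (\<lambda>n. c (\<gamma> n) x) \<longlonglongrightarrow> c g0 x \<and> (\<lambda>n. b (\<gamma> n) x) \<longlonglongrightarrow> b g0 x))"

section \<open>Isometries of \<open>L\<^sub>p\<close> for \<open>p \<noteq> 2\<close>\<close>

lemma powr_le_tangent:
  fixes x k :: real
  assumes "0 < k" "k < 1" "0 \<le> x"
  shows "x powr k \<le> 1 + k * (x - 1)"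
proof (cases "x = 0")
  case False
  with assms have x: "0 < x" by simp
  \<comment> \<open>Convexity of exp between 0 and \<open>ln x\<close> with weight k is Bernoulli's
    inequality; the convex case then follows by applying it to the exponent 1 / k.\<close>
  have "exp ((1 - k) * 0 + k * ln x) \<le> (1 - k) * exp 0 + k * exp (ln x)"
    using convex_onD[OF exp_convex, of k 0 "ln x"] assms by simp
  with x show ?thesis by (simp add: powr_def algebra_simps)
qed (use assms in auto)

lemma tangent_le_powr:
  fixes x k :: real
  assumes "1 < k" "0 \<le> x"
  shows "1 + k * (x - 1) \<le> x powr k"
proof -
  have "(x powr k) powr (1 / k) \<le> 1 + 1 / k * (x powr k - 1)"
    using assms by (intro powr_le_tangent) auto
  then have "x \<le> 1 + (x powr k - 1) / k" using assms by (simp add: powr_powr)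
  then show ?thesis using assms by (simp add: field_simps)
qed

text \<open>After division by s both terms are compared with the tangent line at 1, and the linear
  parts cancel.\<close>

lemma powr_midpoint_concave:
  fixes s d k :: real
  assumes k: "0 < k" "k < 1" and d: "\<bar>d\<bar> \<le> s"
  shows "(s + d) powr k + (s - d) powr k \<le> 2 * s powr k"
proof (cases "s = 0")
  case False
  with d have s: "0 < s" by auto
  have 1: "(1 + d / s) powr k \<le> 1 + k * (d / s)" "(1 - d / s) powr k \<le> 1 - k * (d / s)"
    using powr_le_tangent[OF k, of "1 + d / s"] powr_le_tangent[OF k, of "1 - d / s"] d s
    by (auto simp: field_simps abs_le_iff)
  have "(s + d) powr k = s powr k * (1 + d / s) powr k" "(s - d) powr k = s powr k * (1 - d / s) powr k"
    using s d by (simp_all flip: powr_mult add: distrib_left right_diff_distrib)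
  then have "(s + d) powr k + (s - d) powr k = s powr k * ((1 + d / s) powr k + (1 - d / s) powr k)"
    by (simp add: algebra_simps)
  also have "\<dots> \<le> s powr k * 2" using 1 by (intro mult_left_mono) auto
  finally show ?thesis by simp
qed (use d in auto)

lemma powr_midpoint_convex:
  fixes s d k :: real
  assumes k: "1 < k" and d: "\<bar>d\<bar> \<le> s"
  shows "2 * s powr k \<le> (s + d) powr k + (s - d) powr k"
proof (cases "s = 0")
  case False
  with d have s: "0 < s" by auto
  have 1: "1 + k * (d / s) \<le> (1 + d / s) powr k" "1 - k * (d / s) \<le> (1 - d / s) powr k"
    using tangent_le_powr[OF k, of "1 + d / s"] tangent_le_powr[OF k, of "1 - d / s"] d s
    by (auto simp: field_simps abs_le_iff)
  have "(s + d) powr k = s powr k * (1 + d / s) powr k" "(s - d) powr k = s powr k * (1 - d / s) powr k"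
    using s d by (simp_all flip: powr_mult add: distrib_left right_diff_distrib)
  then have "(s + d) powr k + (s - d) powr k = s powr k * ((1 + d / s) powr k + (1 - d / s) powr k)"
    by (simp add: algebra_simps)
  moreover have "s powr k * 2 \<le> \<dots>" using 1 by (intro mult_left_mono) auto
  ultimately show ?thesis by simp
qed (use d in auto)

text \<open>Write z^k = z * z^(k-1); the second factor is strictly decreasing when k < 1 and
  strictly increasing when k > 1.\<close>

lemma powr_subadditive_strict:
  fixes x y k :: real
  assumes "0 < k" "k < 1" "0 < x" "0 < y"
  shows "(x + y) powr k < x powr k + y powr k"
proof -
  have *: "z powr k = z * z powr (k - 1)" if "0 < z" for z :: real
    using that by (simp add: powr_diff)
  have "(x + y) powr k = x * (x + y) powr (k - 1) + y * (x + y) powr (k - 1)"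
    using assms *[of "x + y"] by (simp add: algebra_simps)
  also have "\<dots> < x * x powr (k - 1) + y * y powr (k - 1)"
    using assms by (intro add_strict_mono mult_strict_left_mono powr_less_mono2_neg) auto
  finally show ?thesis using assms by (simp add: *[symmetric])
qed

lemma powr_superadditive_strict:
  fixes x y k :: real
  assumes "1 < k" "0 < x" "0 < y"
  shows "x powr k + y powr k < (x + y) powr k"
proof -
  have *: "z powr k = z * z powr (k - 1)" if "0 < z" for z :: real
    using that by (simp add: powr_diff)
  have "(x + y) powr k = x * (x + y) powr (k - 1) + y * (x + y) powr (k - 1)"
    using assms *[of "x + y"] by (simp add: algebra_simps)
  moreover have "\<dots> > x * x powr (k - 1) + y * y powr (k - 1)"
    using assms by (intro add_strict_mono mult_strict_left_mono powr_less_mono2) auto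
  ultimately show ?thesis using assms by (simp add: *[symmetric])
qed

lemma abs_powr_eq_square: "\<bar>x::real\<bar> powr p = (x\<^sup>2) powr (p / 2)"
proof -
  have "(x\<^sup>2) powr (p / 2) = (\<bar>x\<bar> powr 2) powr (p / 2)"
    by (cases "x = 0") (auto simp: powr_realpow[symmetric] powr_numeral)
  then show ?thesis by (simp only: powr_powr) simp
qed

text \<open>The squares of a + b and a - b are a^2 + b^2 shifted by 2ab in both directions, so
  concavity of the power p/2 bounds the left side by 2 (a^2 + b^2)^(p/2). Subadditivity of the same
  power finishes, strictly unless ab = 0. At p = 2 this power is linear and the strictness is
  lost.\<close>

lemma clarkson_le:
  fixes a b p :: real
  assumes p: "0 < p" "p < 2"
  shows "\<bar>a + b\<bar> powr p + \<bar>a - b\<bar> powr p \<le> 2 * \<bar>a\<bar> powr p + 2 * \<bar>b\<bar> powr p"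
    and "\<bar>a + b\<bar> powr p + \<bar>a - b\<bar> powr p = 2 * \<bar>a\<bar> powr p + 2 * \<bar>b\<bar> powr p \<Longrightarrow> a * b = 0"
proof -
  have d: "\<bar>2 * a * b\<bar> \<le> a\<^sup>2 + b\<^sup>2"
    using sum_squares_bound[of a b] sum_squares_bound[of a "- b"] by (simp add: abs_le_iff)
  have sq: "(a + b)\<^sup>2 = (a\<^sup>2 + b\<^sup>2) + 2 * a * b" "(a - b)\<^sup>2 = (a\<^sup>2 + b\<^sup>2) - 2 * a * b"
    by (simp_all add: power2_eq_square algebra_simps)
  have 1: "\<bar>a + b\<bar> powr p + \<bar>a - b\<bar> powr p \<le> 2 * (a\<^sup>2 + b\<^sup>2) powr (p / 2)"
    unfolding abs_powr_eq_square sq using p d by (intro powr_midpoint_concave) auto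
  have 2: "(a\<^sup>2 + b\<^sup>2) powr (p / 2) < \<bar>a\<bar> powr p + \<bar>b\<bar> powr p" if "a * b \<noteq> 0"
    unfolding abs_powr_eq_square using p that by (intro powr_subadditive_strict) auto
  show "\<bar>a + b\<bar> powr p + \<bar>a - b\<bar> powr p \<le> 2 * \<bar>a\<bar> powr p + 2 * \<bar>b\<bar> powr p"
    using 1 2 by (cases "a * b = 0") auto
  show "a * b = 0" if "\<bar>a + b\<bar> powr p + \<bar>a - b\<bar> powr p = 2 * \<bar>a\<bar> powr p + 2 * \<bar>b\<bar> powr p"
    using 1 2 that by argo
qed

lemma clarkson_ge:
  fixes a b p :: real
  assumes p: "2 < p"
  shows "2 * \<bar>a\<bar> powr p + 2 * \<bar>b\<bar> powr p \<le> \<bar>a + b\<bar> powr p + \<bar>a - b\<bar> powr p"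
    and "\<bar>a + b\<bar> powr p + \<bar>a - b\<bar> powr p = 2 * \<bar>a\<bar> powr p + 2 * \<bar>b\<bar> powr p \<Longrightarrow> a * b = 0"
proof -
  have d: "\<bar>2 * a * b\<bar> \<le> a\<^sup>2 + b\<^sup>2"
    using sum_squares_bound[of a b] sum_squares_bound[of a "- b"] by (simp add: abs_le_iff)
  have sq: "(a + b)\<^sup>2 = (a\<^sup>2 + b\<^sup>2) + 2 * a * b" "(a - b)\<^sup>2 = (a\<^sup>2 + b\<^sup>2) - 2 * a * b"
    by (simp_all add: power2_eq_square algebra_simps)
  have 1: "2 * (a\<^sup>2 + b\<^sup>2) powr (p / 2) \<le> \<bar>a + b\<bar> powr p + \<bar>a - b\<bar> powr p"
    unfolding abs_powr_eq_square sq using p d by (intro powr_midpoint_convex) auto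
  have 2: "\<bar>a\<bar> powr p + \<bar>b\<bar> powr p < (a\<^sup>2 + b\<^sup>2) powr (p / 2)" if "a * b \<noteq> 0"
    unfolding abs_powr_eq_square using p that by (intro powr_superadditive_strict) auto
  show "2 * \<bar>a\<bar> powr p + 2 * \<bar>b\<bar> powr p \<le> \<bar>a + b\<bar> powr p + \<bar>a - b\<bar> powr p"
    using 1 2 by (cases "a * b = 0") auto
  show "a * b = 0" if "\<bar>a + b\<bar> powr p + \<bar>a - b\<bar> powr p = 2 * \<bar>a\<bar> powr p + 2 * \<bar>b\<bar> powr p"
    using 1 2 that by argo
qed

lemma nn_integral_eq_imp_AE_eq:
  fixes f g :: "'a \<Rightarrow> ennreal"
  assumes [measurable]: "f \<in> borel_measurable M" "g \<in> borel_measurable M"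
    and le: "\<And>x. f x \<le> g x" and eq: "integral\<^sup>N M f = integral\<^sup>N M g" and fin: "integral\<^sup>N M f < \<infinity>"
  shows "AE x in M. f x = g x"
proof -
  have "(\<integral>\<^sup>+x. g x - f x \<partial>M) = 0"
    using fin eq le by (subst nn_integral_diff) auto
  then have "AE x in M. g x - f x = 0" by (subst (asm) nn_integral_0_iff_AE) auto
  moreover have "AE x in M. f x \<noteq> \<infinity>" using fin by (intro nn_integral_PInf_AE) auto
  ultimately show ?thesis
    by eventually_elim (use le in \<open>auto simp: ennreal_minus_eq_0 intro!: antisym\<close>)
qed

section \<open>Elementary consequences of linearity and isometry\<close>

lemma (in Lp_rep) space_M: "space M = UNIV"
  using sets_eq_imp_space_eq[OF sets_M] by simp

lemma (in Lp_rep) Lp_borel: "f \<in> Lp M p \<Longrightarrow> f \<in> borel_measurable borel"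
  using Lp_measurable[of f M p] by (simp add: measurable_cong_sets[OF sets_M refl])

lemma (in Lp_rep) ind_Lp: "A \<in> sets borel \<Longrightarrow> (indicator A :: real \<Rightarrow> real) \<in> Lp M p"
  and Lp_int_ind: "A \<in> sets borel \<Longrightarrow> Lp_int M p (indicator A) = emeasure M A"
  using indicator_Lp[of A M p] by (auto simp: sets_M emeasure_eq_measure)

lemma (in Lp_rep) one_Lp: "(\<lambda>_. 1 :: real) \<in> Lp M p"
  using ind_Lp[of UNIV] by (simp add: indicator_def[abs_def])

lemma (in Lp_rep) id_Lp: "(\<lambda>x. x) \<in> Lp M p"
proof -
  have "Lp_int M p (\<lambda>x. x) \<le> (\<integral>\<^sup>+x. ennreal (2 powr p) \<partial>M)"
    unfolding Lp_int_def
    by (rule nn_integral_mono_AE, use bounded in eventually_elim)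
       (use p_pos in \<open>auto intro!: powr_mono2\<close>)
  also have "\<dots> < \<infinity>" by (simp add: ennreal_mult_less_top emeasure_eq_measure)
  finally show ?thesis by (auto simp: Lp_def)
qed

lemma (in Lp_rep) U_sum:
  assumes "f \<in> Lp M p" "f' \<in> Lp M p"
  shows "AE x in M. U g (\<lambda>x. f x + f' x) x = U g f x + U g f' x"
  using U_lin[OF assms, of g 1] by simp

lemma (in Lp_rep) U_diff:
  assumes "f \<in> Lp M p" "f' \<in> Lp M p"
  shows "AE x in M. U g (\<lambda>x. f x - f' x) x = U g f x - U g f' x"
  using U_lin[OF assms(2,1), of g "-1"] by simp

lemma (in Lp_rep) U_dist:
  assumes "f \<in> Lp M p" "f' \<in> Lp M p"
  shows "Lp_int M p (\<lambda>x. U g f x - U g f' x) = Lp_int M p (\<lambda>x. f x - f' x)"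
  using Lp_int_cong_AE[OF U_diff[OF assms, of g], of p] U_iso[OF Lp_diff[OF p_pos assms], of g] by simp

lemma (in Lp_rep) U_cong:
  assumes "f \<in> Lp M p" "f' \<in> Lp M p" "AE x in M. f x = f' x"
  shows "AE x in M. U g f x = U g f' x"
proof -
  have "Lp_int M p (\<lambda>x. f x - f' x) = 0"
    using assms by (subst Lp_int_eq_0_iff) (auto simp: Lp_def)
  then have "Lp_int M p (\<lambda>x. U g f x - U g f' x) = 0" using U_dist[OF assms(1,2)] by simp
  moreover have "(\<lambda>x. U g f x - U g f' x) \<in> borel_measurable M"
    using assms by (intro borel_measurable_diff Lp_measurable[OF U_Lp])
  ultimately show ?thesis by (auto simp: Lp_int_eq_0_iff)
qed

section \<open>Lamperti's theorem\<close>

locale Lp_rep_lamperti = Lp_rep M p U b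
  for M p and U :: "'g::topological_group_add \<Rightarrow> (real \<Rightarrow> real) \<Rightarrow> real \<Rightarrow> real" and b +
  assumes p_ne: "p \<noteq> 2"
begin

lemma clarkson_int:
  assumes [measurable]: "u \<in> borel_measurable M" "v \<in> borel_measurable M"
  shows "(\<integral>\<^sup>+x. ennreal (\<bar>u x + v x\<bar> powr p + \<bar>u x - v x\<bar> powr p) \<partial>M)
      = Lp_int M p (\<lambda>x. u x + v x) + Lp_int M p (\<lambda>x. u x - v x)"
    and "(\<integral>\<^sup>+x. ennreal (2 * \<bar>u x\<bar> powr p + 2 * \<bar>v x\<bar> powr p) \<partial>M)
      = 2 * Lp_int M p u + 2 * Lp_int M p v"
  unfolding Lp_int_def
  by (simp_all add: nn_integral_add[symmetric] nn_integral_cmult[symmetric] ennreal_mult'' )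

lemma disjoint_imp_clarkson:
  assumes [measurable]: "u \<in> borel_measurable M" "v \<in> borel_measurable M"
    and "AE x in M. u x * v x = 0"
  shows "Lp_int M p (\<lambda>x. u x + v x) + Lp_int M p (\<lambda>x. u x - v x) = 2 * Lp_int M p u + 2 * Lp_int M p v"
  unfolding clarkson_int[symmetric, OF assms(1,2)]
  by (rule nn_integral_cong_AE, use assms(3) in eventually_elim)
     (rule arg_cong[where f=ennreal], auto)

text \<open>The pointwise inequality points in one direction; if the finite integrals agree,
  equality holds almost everywhere, and the case of equality applies at each such point.\<close>

lemma clarkson_imp_disjoint:
  assumes u: "u \<in> Lp M p" and v: "v \<in> Lp M p"
    and eq: "Lp_int M p (\<lambda>x. u x + v x) + Lp_int M p (\<lambda>x. u x - v x) = 2 * Lp_int M p u + 2 * Lp_int M p v"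
  shows "AE x in M. u x * v x = 0"
proof -
  note [measurable] = Lp_measurable[OF u] Lp_measurable[OF v]
  let ?L = "\<lambda>x. ennreal (\<bar>u x + v x\<bar> powr p + \<bar>u x - v x\<bar> powr p)"
  let ?R = "\<lambda>x. ennreal (2 * \<bar>u x\<bar> powr p + 2 * \<bar>v x\<bar> powr p)"
  have int: "integral\<^sup>N M ?L = integral\<^sup>N M ?R"
    using eq by (simp only: clarkson_int[OF Lp_measurable[OF u] Lp_measurable[OF v]])
  have fin: "integral\<^sup>N M ?R < \<infinity>"
    using u v by (subst clarkson_int) (auto simp: Lp_def ennreal_mult_less_top)
  have "AE x in M. ?L x = ?R x"
  proof (cases "p < 2")
    case True
    show ?thesis
      using int fin p_pos True by (intro nn_integral_eq_imp_AE_eq ennreal_leI clarkson_le(1)) auto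
  next
    case False
    with p_ne have p: "2 < p" by simp
    have "AE x in M. ?R x = ?L x"
      using int fin p by (intro nn_integral_eq_imp_AE_eq ennreal_leI clarkson_ge(1)) auto
    then show ?thesis by eventually_elim simp
  qed
  then show ?thesis
  proof eventually_elim
    case (elim x)
    then have "\<bar>u x + v x\<bar> powr p + \<bar>u x - v x\<bar> powr p = 2 * \<bar>u x\<bar> powr p + 2 * \<bar>v x\<bar> powr p"
      by (subst (asm) ennreal_inj) auto
    then show ?case
      using clarkson_le(2)[of p "u x" "v x"] clarkson_ge(2)[of p "u x" "v x"] p_pos p_ne
      by (cases "p < 2") auto
  qed
qed

text \<open>Disjointness has been expressed through the integrals of u, v, u + v and u - v alone,
  and \<open>U g\<close> preserves these.\<close>

lemma U_disjoint:
  assumes f: "f \<in> Lp M p" and f': "f' \<in> Lp M p" and dis: "AE x in M. f x * f' x = 0"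
  shows "AE x in M. U g f x * U g f' x = 0"
proof (rule clarkson_imp_disjoint)
  have "Lp_int M p (\<lambda>x. U g f x + U g f' x) = Lp_int M p (\<lambda>x. f x + f' x)"
    using Lp_int_cong_AE[OF U_sum[OF f f', of g], of p] U_iso[OF Lp_add[OF p_pos f f'], of g] by simp
  then show "Lp_int M p (\<lambda>x. U g f x + U g f' x) + Lp_int M p (\<lambda>x. U g f x - U g f' x)
      = 2 * Lp_int M p (U g f) + 2 * Lp_int M p (U g f')"
    using disjoint_imp_clarkson[OF Lp_measurable[OF f] Lp_measurable[OF f'] dis]
    by (simp add: U_dist[OF f f'] U_iso[OF f] U_iso[OF f'])
qed (intro U_Lp f f')+

text \<open>Invertibility gives full support: the indicator of the zero set \<open>B\<close> is
  disjoint from \<open>U g 1\<close>, so its image under \<open>U (- g)\<close> is disjoint from the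
  constant 1 and therefore null.\<close>

lemma U_one_nonzero: "AE x in M. U g (\<lambda>_. 1) x \<noteq> 0"
proof -
  define B where "B = {x. U g (\<lambda>_. 1) x = 0}"
  note [measurable] = Lp_borel[OF U_Lp[OF one_Lp]]
  have B: "B \<in> sets borel" unfolding B_def by measurable
  have "AE x in M. indicator B x * U g (\<lambda>_. 1) x = 0" by (auto simp: B_def)
  from U_disjoint[OF ind_Lp[OF B] U_Lp[OF one_Lp] this, of "- g"]
    U_add[OF one_Lp, of "- g" g] U_0[OF one_Lp]
  have "AE x in M. U (- g) (indicator B) x = 0"
    by (simp, eventually_elim) auto
  then have "Lp_int M p (U (- g) (indicator B)) = 0"
    using Lp_measurable[OF U_Lp[OF ind_Lp[OF B]]] by (subst Lp_int_eq_0_iff) auto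
  then have "emeasure M B = 0" by (simp add: U_iso ind_Lp B Lp_int_ind)
  then have "AE x in M. x \<notin> B" using B by (intro AE_not_in) (auto simp: null_sets_def sets_M)
  then show ?thesis by (simp add: B_def)
qed

text \<open>The zeros of \<open>U g 1\<close> form a null set; the value there is irrelevant.\<close>
definition c :: "'g \<Rightarrow> real \<Rightarrow> real" where
  "c g x = (if U g (\<lambda>_. 1) x = 0 then 1 else U g (\<lambda>_. 1) x)"

lemma c_eq: "AE x in M. c g x = U g (\<lambda>_. 1) x"
  using U_one_nonzero[of g] by eventually_elim (simp add: c_def)

lemma c_nonzero: "c g x \<noteq> 0"
  by (simp add: c_def)

lemma c_measurable [measurable]: "c g \<in> borel_measurable borel"
proof -
  note [measurable] = Lp_borel[OF U_Lp[OF one_Lp]]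
  show ?thesis unfolding c_def by measurable
qed

text \<open>The set map induced by the isometry. Up to null sets it will turn out to be the preimage
  of \<open>A\<close> under the point map \<open>S g\<close>.\<close>

definition \<Phi> :: "'g \<Rightarrow> real set \<Rightarrow> real set" where
  "\<Phi> g A = {x. U g (indicator A) x \<noteq> 0}"

lemma \<Phi>_measurable [measurable]: "A \<in> sets borel \<Longrightarrow> \<Phi> g A \<in> sets borel"
proof -
  assume "A \<in> sets borel"
  note [measurable] = Lp_borel[OF U_Lp[OF ind_Lp[OF this]]]
  show ?thesis unfolding \<Phi>_def by measurable
qed

lemma U_ind_disjoint_union:
  assumes "A \<in> sets borel" "B \<in> sets borel" "A \<inter> B = {}"
  shows "AE x in M. U g (indicator (A \<union> B)) x = U g (indicator A) x + U g (indicator B) x"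
    and "AE x in M. \<not> (x \<in> \<Phi> g A \<and> x \<in> \<Phi> g B)"
proof -
  have "indicator (A \<union> B) = (\<lambda>x. indicator A x + indicator B x :: real)"
    using assms by (auto simp: indicator_def fun_eq_iff)
  with U_sum[OF ind_Lp ind_Lp, of A B g] assms
  show "AE x in M. U g (indicator (A \<union> B)) x = U g (indicator A) x + U g (indicator B) x" by simp
  have "AE x in M. indicator A x * indicator B x = (0::real)"
    using assms by (auto simp: indicator_def)
  from U_disjoint[OF ind_Lp ind_Lp this, of g] assms
  show "AE x in M. \<not> (x \<in> \<Phi> g A \<and> x \<in> \<Phi> g B)" by (simp add: \<Phi>_def)
qed

text \<open>The constant 1 is the sum of the indicators of \<open>A\<close> and of its complement.
  Their images have disjoint supports, so on the support of the first image the whole of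
  \<open>U g 1\<close> comes from it.\<close>

lemma U_ind:
  assumes "A \<in> sets borel"
  shows "AE x in M. U g (indicator A) x = c g x * indicator (\<Phi> g A) x"
proof -
  have [simp]: "A \<union> - A = UNIV" "indicator UNIV = (\<lambda>_. 1::real)" by (auto simp: indicator_def[abs_def])
  from U_ind_disjoint_union[of A "- A" g] assms
  have "AE x in M. U g (\<lambda>_. 1) x = U g (indicator A) x + U g (indicator (- A)) x"
    "AE x in M. \<not> (x \<in> \<Phi> g A \<and> x \<in> \<Phi> g (- A))" by simp_all
  with c_eq[of g] show ?thesis
    by eventually_elim (auto simp: \<Phi>_def indicator_def)
qed

lemma \<Phi>_compl:
  assumes "A \<in> sets borel"
  shows "AE x in M. x \<in> \<Phi> g (- A) \<longleftrightarrow> x \<notin> \<Phi> g A"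
proof -
  have [simp]: "A \<union> - A = UNIV" "indicator UNIV = (\<lambda>_. 1::real)" by (auto simp: indicator_def[abs_def])
  from U_ind_disjoint_union[of A "- A" g] assms
  have "AE x in M. U g (\<lambda>_. 1) x = U g (indicator A) x + U g (indicator (- A)) x"
    "AE x in M. \<not> (x \<in> \<Phi> g A \<and> x \<in> \<Phi> g (- A))" by simp_all
  with U_one_nonzero[of g] show ?thesis
    by eventually_elim (auto simp: \<Phi>_def)
qed

lemma \<Phi>_UNIV: "AE x in M. x \<in> \<Phi> g UNIV"
proof -
  have "indicator UNIV = (\<lambda>_::real. 1::real)" by (auto simp: indicator_def[abs_def])
  with U_one_nonzero[of g] show ?thesis by (simp add: \<Phi>_def)
qed

lemma \<Phi>_empty: "AE x in M. x \<notin> \<Phi> g {}"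
proof -
  have "AE x in M. x \<in> \<Phi> g (- UNIV) \<longleftrightarrow> x \<notin> \<Phi> g UNIV" by (rule \<Phi>_compl) simp
  with \<Phi>_UNIV[of g] show ?thesis by eventually_elim simp
qed

lemma \<Phi>_mono:
  assumes "A \<in> sets borel" "B \<in> sets borel" "A \<subseteq> B"
  shows "AE x in M. x \<in> \<Phi> g A \<longrightarrow> x \<in> \<Phi> g B"
proof -
  have "A \<union> (B - A) = B" using assms by auto
  with U_ind_disjoint_union[of A "B - A" g] assms
  have "AE x in M. U g (indicator B) x = U g (indicator A) x + U g (indicator (B - A)) x"
    "AE x in M. \<not> (x \<in> \<Phi> g A \<and> x \<in> \<Phi> g (B - A))" by auto
  then show ?thesis by eventually_elim (auto simp: \<Phi>_def)
qed

lemma \<Phi>_Un: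
  assumes "A \<in> sets borel" "B \<in> sets borel"
  shows "AE x in M. x \<in> \<Phi> g (A \<union> B) \<longrightarrow> x \<in> \<Phi> g A \<or> x \<in> \<Phi> g B"
proof -
  have "AE x in M. U g (indicator (A \<union> (B - A))) x = U g (indicator A) x + U g (indicator (B - A)) x"
    using assms by (intro U_ind_disjoint_union(1)) auto
  then have "AE x in M. U g (indicator (A \<union> B)) x = U g (indicator A) x + U g (indicator (B - A)) x"
    by (simp only: Un_Diff_cancel)
  moreover have "AE x in M. x \<in> \<Phi> g (B - A) \<longrightarrow> x \<in> \<Phi> g B"
    using assms by (intro \<Phi>_mono) auto
  ultimately show ?thesis by eventually_elim (auto simp: \<Phi>_def)
qed

lemma \<Phi>_measure:
  assumes [measurable]: "A \<in> sets borel"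
  shows "(\<integral>\<^sup>+x. ennreal (\<bar>c g x\<bar> powr p) * indicator (\<Phi> g A) x \<partial>M) = emeasure M A"
proof -
  have "(\<integral>\<^sup>+x. ennreal (\<bar>c g x\<bar> powr p) * indicator (\<Phi> g A) x \<partial>M) = Lp_int M p (U g (indicator A))"
    unfolding Lp_int_def
    by (rule nn_integral_cong_AE, use U_ind[OF assms, of g] in eventually_elim)
       (auto simp: indicator_def)
  then show ?thesis by (simp add: U_iso ind_Lp Lp_int_ind)
qed

text \<open>Finite unions are handled by linearity. The part \<open>R\<close> missed by all
  \<open>\<Phi> g (A n)\<close> has |c|^p-weighted measure at most that of the union minus
  \<open>B n\<close>, which tends to 0 because \<open>M\<close> is finite.\<close>

lemma \<Phi>_UN:
  fixes A :: "nat \<Rightarrow> real set"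
  assumes A[measurable]: "\<And>n. A n \<in> sets borel"
  shows "AE x in M. x \<in> \<Phi> g (\<Union>n. A n) \<longleftrightarrow> (\<exists>n. x \<in> \<Phi> g (A n))"
proof -
  define B where "B n = (\<Union>i<n. A i)" for n
  define R where "R = \<Phi> g (\<Union>n. A n) - (\<Union>n. \<Phi> g (A n))"
  have B[measurable]: "B n \<in> sets borel" for n unfolding B_def by measurable
  have R[measurable]: "R \<in> sets borel" unfolding R_def by measurable
  have "AE x in M. x \<in> \<Phi> g (B n) \<longrightarrow> (\<exists>i. x \<in> \<Phi> g (A i))" for n
  proof (induction n)
    case 0
    show ?case using \<Phi>_empty[of g] by eventually_elim (simp add: B_def)
  next
    case (Suc n)
    have "B (Suc n) = B n \<union> A n" by (auto simp: B_def lessThan_Suc)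
    with \<Phi>_Un[OF B[of n] A[of n], of g] have "AE x in M. x \<in> \<Phi> g (B (Suc n)) \<longrightarrow> x \<in> \<Phi> g (B n) \<or> x \<in> \<Phi> g (A n)"
      by simp
    with Suc show ?case by eventually_elim auto
  qed
  note fin = this
  have le: "(\<integral>\<^sup>+x. ennreal (\<bar>c g x\<bar> powr p) * indicator R x \<partial>M) \<le> emeasure M ((\<Union>n. A n) - B n)" for n
  proof -
    have "B n \<union> ((\<Union>n. A n) - B n) = (\<Union>n. A n)" by (auto simp: B_def)
    with \<Phi>_Un[of "B n" "(\<Union>n. A n) - B n" g]
    have "AE x in M. x \<in> \<Phi> g (\<Union>n. A n) \<longrightarrow> x \<in> \<Phi> g (B n) \<or> x \<in> \<Phi> g ((\<Union>n. A n) - B n)" by simp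
    with fin[of n] have "AE x in M. x \<in> R \<longrightarrow> x \<in> \<Phi> g ((\<Union>n. A n) - B n)"
      by eventually_elim (auto simp: R_def)
    then have "(\<integral>\<^sup>+x. ennreal (\<bar>c g x\<bar> powr p) * indicator R x \<partial>M)
        \<le> (\<integral>\<^sup>+x. ennreal (\<bar>c g x\<bar> powr p) * indicator (\<Phi> g ((\<Union>n. A n) - B n)) x \<partial>M)"
      by (intro nn_integral_mono_AE) (auto elim!: eventually_mono simp: indicator_def)
    then show ?thesis by (simp add: \<Phi>_measure)
  qed
  have "(\<lambda>n. emeasure M ((\<Union>n. A n) - B n)) \<longlonglongrightarrow> emeasure M (\<Inter>n. (\<Union>n. A n) - B n)"
    by (intro Lim_emeasure_decseq) (auto simp: sets_M decseq_def B_def)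
  moreover have "(\<Inter>n. (\<Union>n. A n) - B n) = {}" unfolding B_def by blast
  ultimately have "(\<lambda>n. emeasure M ((\<Union>n. A n) - B n)) \<longlonglongrightarrow> 0" by (simp only: emeasure_empty)
  then have "(\<integral>\<^sup>+x. ennreal (\<bar>c g x\<bar> powr p) * indicator R x \<partial>M) \<le> 0"
    by (rule tendsto_lowerbound) (use le in auto)
  then have "AE x in M. ennreal (\<bar>c g x\<bar> powr p) * indicator R x = 0"
    by (subst nn_integral_0_iff_AE[symmetric]) auto
  moreover have "AE x in M. \<forall>n. x \<in> \<Phi> g (A n) \<longrightarrow> x \<in> \<Phi> g (\<Union>n. A n)"
    unfolding AE_all_countable by (intro allI \<Phi>_mono) auto
  ultimately show ?thesis
    by eventually_elim (use c_nonzero in \<open>auto simp: R_def indicator_def split: if_splits\<close>)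
qed

text \<open>The point whose position relative to rational cuts is prescribed by
  \<open>\<Phi>\<close>. Cuts in [0, 2] suffice because \<open>M\<close> lives there; the bound 0
  makes the infimum finite, and the inserted 2 keeps the set nonempty.\<close>

definition S :: "'g \<Rightarrow> real \<Rightarrow> real" where
  "S g x = Inf (insert 2 {r \<in> \<rat>. 0 \<le> r \<and> r \<le> 2 \<and> x \<in> \<Phi> g {..r}})"

lemma S_less_iff:
  "S g x < a \<longleftrightarrow> 2 < a \<or> (\<exists>r\<in>\<rat>. 0 \<le> r \<and> r \<le> 2 \<and> r < a \<and> x \<in> \<Phi> g {..r})"
  unfolding S_def by (subst cInf_less_iff) (auto intro!: bdd_belowI[of _ 0])

lemma S_measurable [measurable]: "S g \<in> borel_measurable borel"
proof (rule borel_measurableI_less)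
  fix a
  have "{x \<in> space borel. S g x < a} = (if 2 < a then UNIV else (\<Union>r\<in>{r\<in>\<rat>. 0 \<le> r \<and> r \<le> 2 \<and> r < a}. \<Phi> g {..r}))"
    by (auto simp: S_less_iff)
  also have "\<dots> \<in> sets borel"
    by (auto intro!: sets.countable_UN'' countable_subset[OF _ countable_rat])
  finally show "{x \<in> space borel. S g x < a} \<in> sets borel" .
qed

lemma \<Phi>_cong:
  assumes "A \<in> sets borel" "B \<in> sets borel" "AE x in M. x \<in> A \<longleftrightarrow> x \<in> B"
  shows "AE x in M. x \<in> \<Phi> g A \<longleftrightarrow> x \<in> \<Phi> g B"
proof -
  have "AE x in M. U g (indicator A) x = U g (indicator B) x"
    by (intro U_cong ind_Lp assms, use assms(3) in eventually_elim) (simp add: indicator_def)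
  then show ?thesis by eventually_elim (simp add: \<Phi>_def)
qed

lemma S_lessThan: "AE x in M. x \<in> \<Phi> g {..<a} \<longleftrightarrow> S g x < a"
proof -
  define r :: "nat \<Rightarrow> real" where "r n = of_rat (from_nat_into UNIV n)" for n
  have r: "range r = \<rat>"
    unfolding r_def Rats_def by (auto simp: image_iff) (metis from_nat_into_surj UNIV_I countableI_type)
  \<comment> \<open>Up to a null set \<open>{..<a}\<close> is a countable union of the half-lines
    from which \<open>S\<close> is built; for a > 2 it has full measure, so \<open>UNIV\<close> may
    stand for it.\<close>
  define A where "A n = (if 2 < a then UNIV else if 0 \<le> r n \<and> r n \<le> 2 \<and> r n < a then {..r n} else {})" for n
  have A: "A n \<in> sets borel" for n by (auto simp: A_def)
  have "AE x in M. x \<in> {..<a} \<longleftrightarrow> x \<in> (\<Union>n. A n)"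
    using bounded
  proof eventually_elim
    case (elim x)
    show ?case
    proof (cases "2 < a")
      case False
      have "\<exists>n. 0 \<le> r n \<and> r n \<le> 2 \<and> r n < a \<and> x \<le> r n" if xa: "x < a"
      proof -
        obtain t where t: "t \<in> \<rat>" "x < t" "t < a" using Rats_dense_in_real[OF xa] by auto
        then obtain n where "t = r n" using r by (metis imageE)
        with t elim False show ?thesis by (intro exI[of _ n]) auto
      qed
      with False show ?thesis by (auto simp: A_def split: if_splits)
    qed (use elim in \<open>auto simp: A_def\<close>)
  qed
  then have "AE x in M. x \<in> \<Phi> g {..<a} \<longleftrightarrow> x \<in> \<Phi> g (\<Union>n. A n)"
    using A by (intro \<Phi>_cong) auto
  moreover have "AE x in M. x \<in> \<Phi> g (\<Union>n. A n) \<longleftrightarrow> (\<exists>n. x \<in> \<Phi> g (A n))" by (rule \<Phi>_UN[OF A])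
  moreover note \<Phi>_UNIV[of g]
  moreover note \<Phi>_empty[of g]
  ultimately show ?thesis
  proof eventually_elim
    case (elim x)
    show ?case
    proof (cases "2 < a")
      case True
      then show ?thesis using elim by (simp add: A_def S_less_iff)
    next
      case False
      have "(\<exists>n. x \<in> \<Phi> g (A n)) \<longleftrightarrow> (\<exists>n. 0 \<le> r n \<and> r n \<le> 2 \<and> r n < a \<and> x \<in> \<Phi> g {..r n})"
        using False elim(4) by (auto simp: A_def split: if_splits)
      also have "\<dots> \<longleftrightarrow> S g x < a"
        unfolding S_less_iff r[symmetric] using False by auto
      finally show ?thesis using elim(1,2) by simp
    qed
  qed
qed

text \<open>Half-lines are an intersection-stable generator, and \<open>\<Phi> g\<close> commutes
  with complements and countable unions modulo null sets.\<close>

lemma S_\<Phi>: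
  assumes "A \<in> sets borel"
  shows "AE x in M. x \<in> \<Phi> g A \<longleftrightarrow> S g x \<in> A"
proof -
  have "Int_stable (range lessThan :: real set set)"
  proof (clarsimp simp: Int_stable_def)
    fix a b :: real
    have "{..<a} \<inter> {..<b} = {..<min a b}" by auto
    then show "{..<a} \<inter> {..<b} \<in> range lessThan" by simp
  qed
  moreover have "(range lessThan :: real set set) \<subseteq> Pow UNIV" by simp
  moreover have "A \<in> sigma_sets UNIV (range lessThan)"
    using assms unfolding borel_Iio by simp
  ultimately show ?thesis
  proof (induction rule: sigma_sets_induct_disjoint)
    case empty
    show ?case using \<Phi>_empty[of g] by simp
  next
    case (basic A)
    then show ?case using S_lessThan[of g] by auto
  next
    case (compl A)
    then have "A \<in> sets borel" unfolding borel_Iio by simp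
    from \<Phi>_compl[OF this, of g] compl(2) show ?case
      unfolding Compl_eq_Diff_UNIV by eventually_elim auto
  next
    case (union A)
    then have "A n \<in> sets borel" for n unfolding borel_Iio by auto
    from \<Phi>_UN[OF this, of g] have "AE x in M. x \<in> \<Phi> g (\<Union>n. A n) \<longleftrightarrow> (\<exists>n. x \<in> \<Phi> g (A n))" .
    moreover have "AE x in M. \<forall>n. x \<in> \<Phi> g (A n) \<longleftrightarrow> S g x \<in> A n"
      unfolding AE_all_countable using union by simp
    ultimately show ?case by eventually_elim auto
  qed
qed

lemma push:
  assumes [measurable]: "A \<in> sets borel"
  shows "(\<integral>\<^sup>+x. ennreal (\<bar>c g x\<bar> powr p) * indicator A (S g x) \<partial>M) = emeasure M A"
  unfolding \<Phi>_measure[OF assms, of g, symmetric]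
  by (rule nn_integral_cong_AE, use S_\<Phi>[OF assms, of g] in eventually_elim) (simp add: indicator_def)

lemma Lp_int_weighted_comp:
  assumes "f \<in> borel_measurable borel"
  shows "Lp_int M p (\<lambda>x. c g x * f (S g x)) = Lp_int M p f"
proof -
  note [measurable] = assms
  have "Lp_int M p (\<lambda>x. c g x * f (S g x)) = (\<integral>\<^sup>+x. ennreal (\<bar>c g x\<bar> powr p) * ennreal (\<bar>f (S g x)\<bar> powr p) \<partial>M)"
    unfolding Lp_int_def by (intro nn_integral_cong) (simp add: abs_mult powr_mult ennreal_mult)
  also have "\<dots> = Lp_int M p f"
    unfolding Lp_int_def by (intro nn_integral_push[OF sets_M]) (auto simp: push)
  finally show ?thesis .
qed

text \<open>Both sides are linear and isometric in f and agree on indicators; density does the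
  rest.\<close>

theorem U_lamperti:
  assumes "f \<in> Lp M p"
  shows "AE x in M. U g f x = c g x * f (S g x)"
  using assms p_pos
proof (induction rule: Lp_induct)
  case (indicator A)
  then have A: "A \<in> sets borel" by (simp add: sets_M)
  show ?case using U_ind[OF A, of g] S_\<Phi>[OF A, of g]
    by eventually_elim (auto split: split_indicator)
next
  case (lin s f f')
  from U_lin[OF lin(1,2), of g s] lin(3,4) show ?case
    by eventually_elim (simp add: algebra_simps)
next
  case (dense f)
  show ?case
  proof (rule Lp_AE_eqI)
    note fm[measurable] = Lp_borel[OF dense(1)]
    show "U g f \<in> borel_measurable M" by (intro Lp_measurable[OF U_Lp] dense)
    show "(\<lambda>x. c g x * f (S g x)) \<in> borel_measurable M" by measurable
    fix e :: ennreal assume "0 < e"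
    from dense(2)[OF this] obtain h where h: "h \<in> Lp M p" "AE x in M. U g h x = c g x * h (S g x)"
      "Lp_int M p (\<lambda>x. f x - h x) < e" by auto
    note hm[measurable] = Lp_borel[OF h(1)]
    have "Lp_int M p (\<lambda>x. U g f x - c g x * f (S g x))
      \<le> ennreal (2 powr p) * (Lp_int M p (\<lambda>x. U g f x - U g h x) + Lp_int M p (\<lambda>x. U g h x - c g x * f (S g x)))"
      by (intro Lp_int_triangle p_pos Lp_measurable[OF U_Lp] dense h) measurable
    also have "Lp_int M p (\<lambda>x. U g f x - U g h x) = Lp_int M p (\<lambda>x. f x - h x)"
      by (rule U_dist[OF dense(1) h(1)])
    also have "Lp_int M p (\<lambda>x. U g h x - c g x * f (S g x)) = Lp_int M p (\<lambda>x. c g x * (h (S g x) - f (S g x)))"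
      by (rule Lp_int_cong_AE, use h(2) in eventually_elim) (simp add: algebra_simps)
    also have "\<dots> = Lp_int M p (\<lambda>x. h x - f x)"
      by (rule Lp_int_weighted_comp[of "\<lambda>x. h x - f x"]) measurable
    also have "\<dots> = Lp_int M p (\<lambda>x. f x - h x)" by (rule Lp_int_minus_commute)
    also have "ennreal (2 powr p) * (Lp_int M p (\<lambda>x. f x - h x) + Lp_int M p (\<lambda>x. f x - h x))
        \<le> ennreal (2 powr p) * (e + e)"
      using h(3) by (intro mult_left_mono add_mono) auto
    also have "\<dots> = ennreal (2 powr p * 2) * e"
      by (simp add: ennreal_mult mult_2[symmetric] mult.assoc)
    finally show "Lp_int M p (\<lambda>x. U g f x - c g x * f (S g x)) \<le> ennreal (2 powr p * 2) * e" .
  qed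
qed

lemma AE_S: "AE x in M. P x \<Longrightarrow> AE x in M. P (S g x)"
  by (rule AE_push[OF sets_M, where c="c g" and p=p]) (auto simp: push c_nonzero)

lemma U_id: "AE x in M. U g (\<lambda>x. x) x = c g x * S g x"
  using U_lamperti[OF id_Lp, of g] .

text \<open>Two test functions carry all the information: \<open>U g\<close> sends 1 to
  \<open>c g\<close> and the identity to \<open>c g\<close> times \<open>S g\<close>. Comparing both
  under \<open>U_add\<close> yields the identities for \<open>c\<close> and \<open>S\<close>, and
  \<open>S\<close> converges as a quotient of two convergent sequences.\<close>

theorem skew: "skew_system M p S c b"
proof (unfold_locales)
  show "0 < p" by (rule p_pos)
  show "sets M = sets borel" by (rule sets_M)
  fix g g' :: 'g
  show "S g \<in> borel_measurable borel" "c g \<in> borel_measurable borel" by measurable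
  show "b g \<in> borel_measurable borel" by (rule Lp_borel[OF b_Lp])
  show "c g x \<noteq> 0" for x by (rule c_nonzero)
  show "(\<integral>\<^sup>+x. ennreal (\<bar>c g x\<bar> powr p) * indicator A (S g x) \<partial>M) = emeasure M A"
    if "A \<in> sets borel" for A using that by (rule push)
  show c0: "AE x in M. c 0 x = 1"
    using c_eq[of 0] U_0[OF one_Lp] by eventually_elim simp
  show "AE x in M. S 0 x = x"
    using c0 U_id[of 0] U_0[OF id_Lp] by eventually_elim simp
  have U_comp: "AE x in M. U (g + g') f x = c g x * (c g' (S g x) * f (S g' (S g x)))" if f: "f \<in> Lp M p" for f
    using U_add[OF f, of g g'] U_lamperti[OF U_Lp[OF f], of g g'] AE_S[OF U_lamperti[OF f, of g'], of g]
    by eventually_elim simp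
  show cadd: "AE x in M. c (g + g') x = c g x * c g' (S g x)"
    using U_comp[OF one_Lp] c_eq[of "g + g'"] by eventually_elim simp
  show "AE x in M. S (g + g') x = S g' (S g x)"
    using U_comp[OF id_Lp] cadd U_id[of "g + g'"]
    by eventually_elim (simp add: c_nonzero)
  show "AE x in M. b (g + g') x = c g x * b g' (S g x) + b g x"
    using b_add[of g g'] U_lamperti[OF b_Lp[of g'], of g] by eventually_elim simp
  \<comment> \<open>Geometrically small errors in the three quantities, so that every sequence
    chosen from these neighbourhoods converges almost everywhere.\<close>
  define P where "P n h \<longleftrightarrow> Lp_int M p (\<lambda>x. U h (\<lambda>_. 1) x - U g (\<lambda>_. 1) x) < ennreal ((1/2) ^ n) \<and>
      Lp_int M p (\<lambda>x. U h (\<lambda>x. x) x - U g (\<lambda>x. x) x) < ennreal ((1/2) ^ n) \<and>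
      Lp_int M p (\<lambda>x. b h x - b g x) < ennreal ((1/2) ^ n)" for n :: nat and h
  have "\<forall>\<^sub>F h in nhds g. P n h" for n
    unfolding P_def by (intro eventually_conj U_cont b_cont one_Lp id_Lp) auto
  moreover have "AE x in M. (\<lambda>n. S (\<gamma> n) x) \<longlonglongrightarrow> S g x \<and> (\<lambda>n. c (\<gamma> n) x) \<longlonglongrightarrow> c g x \<and> (\<lambda>n. b (\<gamma> n) x) \<longlonglongrightarrow> b g x"
    if "\<forall>n. P n (\<gamma> n)" for \<gamma>
  proof -
    have 1: "AE x in M. (\<lambda>n. U (\<gamma> n) (\<lambda>_. 1) x - U g (\<lambda>_. 1) x) \<longlonglongrightarrow> 0"
      using that by (intro Lp_int_fast_AE_tendsto[where p=p] p_pos borel_measurable_diff Lp_measurable[OF U_Lp] one_Lp)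
        (auto simp: P_def intro: less_imp_le)
    have 2: "AE x in M. (\<lambda>n. U (\<gamma> n) (\<lambda>x. x) x - U g (\<lambda>x. x) x) \<longlonglongrightarrow> 0"
      using that by (intro Lp_int_fast_AE_tendsto[where p=p] p_pos borel_measurable_diff Lp_measurable[OF U_Lp] id_Lp)
        (auto simp: P_def intro: less_imp_le)
    have 3: "AE x in M. (\<lambda>n. b (\<gamma> n) x - b g x) \<longlonglongrightarrow> 0"
      using that by (intro Lp_int_fast_AE_tendsto[where p=p] p_pos borel_measurable_diff Lp_measurable[OF b_Lp])
        (auto simp: P_def intro: less_imp_le)
    have 4: "AE x in M. \<forall>n. c (\<gamma> n) x = U (\<gamma> n) (\<lambda>_. 1) x"
      "AE x in M. \<forall>n. U (\<gamma> n) (\<lambda>x. x) x = c (\<gamma> n) x * S (\<gamma> n) x"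
      unfolding AE_all_countable by (intro allI c_eq U_id)+
    from 1 2 3 4 c_eq[of g] U_id[of g] show ?thesis
    proof eventually_elim
      case (elim x)
      have c: "(\<lambda>n. c (\<gamma> n) x) \<longlonglongrightarrow> c g x" using elim(1,4,6) by (simp add: LIM_zero_iff)
      have "(\<lambda>n. c (\<gamma> n) x * S (\<gamma> n) x) \<longlonglongrightarrow> c g x * S g x" using elim(2,5,7) by (simp add: LIM_zero_iff)
      from tendsto_divide[OF this c c_nonzero] have "(\<lambda>n. S (\<gamma> n) x) \<longlonglongrightarrow> S g x"
        by (simp add: c_nonzero)
      with c elim(3) show ?case by (simp add: LIM_zero_iff)
    qed
  qed
  ultimately show "\<exists>P. (\<forall>n::nat. \<forall>\<^sub>F h in nhds g. P n h) \<and>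
        (\<forall>\<gamma>. (\<forall>n. P n (\<gamma> n)) \<longrightarrow> (AE x in M. (\<lambda>n. S (\<gamma> n) x) \<longlonglongrightarrow> S g x \<and>
            (\<lambda>n. c (\<gamma> n) x) \<longlonglongrightarrow> c g x \<and> (\<lambda>n. b (\<gamma> n) x) \<longlonglongrightarrow> b g x))" by blast
qed

end

section \<open>The measure preserving extension\<close>

lemma open_approximation:
  fixes \<nu> :: "'y::{second_countable_topology, complete_space} measure" and e :: real
  assumes sets_\<nu>[measurable_cong]: "sets \<nu> = sets borel"
    and V: "\<And>m::nat. open (V m)" "incseq V" "(\<Union>m. V m) = UNIV" "\<And>m. emeasure \<nu> (V m) < \<infinity>"
    and A: "A \<in> sets borel" "emeasure \<nu> A < \<infinity>" and e: "0 < e"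
  obtains U where "open U" "emeasure \<nu> U < \<infinity>" "emeasure \<nu> ((A - U) \<union> (U - A)) < ennreal e"
proof -
  note [measurable] = A(1)
  have [measurable]: "V m \<in> sets borel" for m using V(1) by simp
  have "(\<lambda>m. emeasure \<nu> (A - V m)) \<longlonglongrightarrow> emeasure \<nu> (\<Inter>m. A - V m)"
  proof (rule Lim_emeasure_decseq)
    show "decseq (\<lambda>m. A - V m)" using V(2) by (auto simp: decseq_def incseq_def)
    show "emeasure \<nu> (A - V m) \<noteq> \<infinity>" for m
      using A emeasure_mono[of "A - V m" A \<nu>] by (auto simp: sets_\<nu> top_unique)
  qed (auto simp: sets_\<nu>)
  moreover have "(\<Inter>m. A - V m) = {}" using V(3) by auto
  ultimately have "(\<lambda>m. emeasure \<nu> (A - V m)) \<longlonglongrightarrow> 0" by (simp only: emeasure_empty)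
  then have "\<forall>\<^sub>F m in sequentially. emeasure \<nu> (A - V m) < ennreal (e/2)"
    using e by (intro order_tendstoD) auto
  then obtain m where m: "emeasure \<nu> (A - V m) < ennreal (e/2)"
    by (auto simp: eventually_sequentially)
  \<comment> \<open>Outer regularity is available for finite measures, hence the restriction of
    \<open>\<nu>\<close> to one of the exhausting open sets.\<close>
  define \<mu> where "\<mu> = density \<nu> (indicator (V m))"
  have \<mu>: "emeasure \<mu> B = emeasure \<nu> (V m \<inter> B)" if "B \<in> sets borel" for B
  proof -
    have "emeasure \<mu> B = (\<integral>\<^sup>+x. indicator (V m) x * indicator B x \<partial>\<nu>)"
      unfolding \<mu>_def using that by (intro emeasure_density) (auto simp: sets_\<nu>)
    also have "\<dots> = (\<integral>\<^sup>+x. indicator (V m \<inter> B) x \<partial>\<nu>)"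
      by (intro nn_integral_cong) (auto split: split_indicator)
    finally show ?thesis using that by (simp add: sets_\<nu>)
  qed
  have fin: "emeasure \<nu> (V m \<inter> B) < \<infinity>" if "B \<in> sets borel" for B
    using that V(4)[of m] emeasure_mono[of "V m \<inter> B" "V m" \<nu>] by (auto simp: sets_\<nu> less_top[symmetric] top_unique)
  have sp: "space \<nu> = UNIV" using sets_eq_imp_space_eq[OF sets_\<nu>] by simp
  have "emeasure \<mu> A = (INF U \<in> {U. A \<subseteq> U \<and> open U}. emeasure \<mu> U)"
  proof (rule outer_regular)
    show "sets \<mu> = sets borel" by (simp add: \<mu>_def sets_\<nu>)
    show "emeasure \<mu> (space \<mu>) \<noteq> \<infinity>" using fin[of UNIV] by (simp add: \<mu> \<mu>_def[THEN arg_cong[where f=space]] sp)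
  qed (rule A(1))
  moreover have "emeasure \<mu> A < emeasure \<mu> A + ennreal (e/2)"
    using fin[OF A(1)] e \<mu>[OF A(1)] by (simp add: ennreal_add_left_cancel_less[of _ 0, simplified] less_top)
  ultimately obtain W where W: "A \<subseteq> W" "open W" "emeasure \<mu> W < emeasure \<mu> A + ennreal (e/2)"
    by (auto simp: INF_less_iff)
  have [measurable]: "W \<in> sets borel" using W by simp
  define U where "U = V m \<inter> W"
  have "emeasure \<nu> (U - A) = emeasure \<nu> (V m \<inter> W) - emeasure \<nu> (V m \<inter> A)"
    using W(1) fin[OF A(1)]
    by (subst emeasure_Diff[symmetric]) (auto simp: U_def sets_\<nu> intro!: arg_cong[where f="emeasure \<nu>"])
  also have "\<dots> < ennreal (e/2)"
    using W(3) fin[OF A(1)] fin[of W] unfolding \<mu>[OF A(1)] \<mu>[OF \<open>W \<in> sets borel\<close>]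
    by (subst minus_less_iff_ennreal) (use W(1) in \<open>auto simp: add.commute sets_\<nu> intro!: emeasure_mono\<close>)
  finally have 1: "emeasure \<nu> (U - A) < ennreal (e/2)" .
  have 2: "A - U = A - V m" using W(1) by (auto simp: U_def)
  have "emeasure \<nu> ((A - U) \<union> (U - A)) \<le> emeasure \<nu> (A - U) + emeasure \<nu> (U - A)"
    by (intro emeasure_subadditive) (auto simp: U_def sets_\<nu>)
  also have "\<dots> < ennreal (e/2) + ennreal (e/2)"
    using m 1 unfolding 2 by (intro add_strict_mono)
  also have "\<dots> = ennreal e" using e by (simp flip: ennreal_plus)
  finally show thesis using that[of U] W V(1) fin[of W] by (auto simp: U_def)
qed

text \<open>For open U, points with \<open>T' y\<close> in U eventually have \<open>T n y\<close> in
  U, so one half of the symmetric difference of the preimages shrinks by dominated convergence. The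
  other half has the same measure, because both preimages have the measure of U. A general set is
  replaced by a nearby open one; the error is not enlarged by measure preserving maps.\<close>

lemma measure_preserving_pointwise_limit:
  fixes \<nu> :: "'y::{second_countable_topology, complete_space} measure"
  assumes sets_\<nu>[measurable_cong]: "sets \<nu> = sets borel"
    and V: "\<And>m::nat. open (V m)" "incseq V" "(\<Union>m. V m) = UNIV" "\<And>m. emeasure \<nu> (V m) < \<infinity>"
    and T[measurable]: "\<And>n::nat. T n \<in> borel_measurable borel" "T' \<in> borel_measurable borel"
    and mp: "\<And>n A. A \<in> sets borel \<Longrightarrow> emeasure \<nu> (T n -` A) = emeasure \<nu> A"
      "\<And>A. A \<in> sets borel \<Longrightarrow> emeasure \<nu> (T' -` A) = emeasure \<nu> A"
    and lim: "AE y in \<nu>. (\<lambda>n. T n y) \<longlonglongrightarrow> T' y"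
    and A: "A \<in> sets borel" "emeasure \<nu> A < \<infinity>"
  shows "(\<lambda>n. emeasure \<nu> {y. (T n y \<in> A) \<noteq> (T' y \<in> A)}) \<longlonglongrightarrow> 0"
proof -
  have sp: "space \<nu> = UNIV" using sets_eq_imp_space_eq[OF sets_\<nu>] by simp
  have vm: "T n -` B \<in> sets \<nu>" "T' -` B \<in> sets \<nu>" if "B \<in> sets borel" for n B
    using measurable_sets[OF T(1) that] measurable_sets[OF T(2) that] by (auto simp: sets_\<nu>)
  have open_case: "(\<lambda>n. emeasure \<nu> {y. (T n y \<in> U) \<noteq> (T' y \<in> U)}) \<longlonglongrightarrow> 0"
    if U: "open U" "emeasure \<nu> U < \<infinity>" for U
  proof -
    have Ub[measurable]: "U \<in> sets borel" using U by simp
    have "(\<lambda>n. \<integral>\<^sup>+y. indicator (T' -` U - T n -` U) y \<partial>\<nu>) \<longlonglongrightarrow> (\<integral>\<^sup>+y. 0 \<partial>\<nu>)"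
    proof (rule nn_integral_dominated_convergence[where w="indicator (T' -` U)"])
      show "(\<integral>\<^sup>+y. indicator (T' -` U) y \<partial>\<nu>) < \<infinity>" using vm[OF Ub] mp(2)[OF Ub] U by simp
      show "AE y in \<nu>. (\<lambda>n. indicator (T' -` U - T n -` U) y :: ennreal) \<longlonglongrightarrow> 0"
        using lim
      proof eventually_elim
        case (elim y)
        show ?case
        proof (cases "T' y \<in> U")
          case True
          with elim U have "\<forall>\<^sub>F n in sequentially. T n y \<in> U" by (auto dest: topological_tendstoD)
          then show ?thesis by (intro tendsto_eventually) (auto elim!: eventually_mono)
        qed simp
      qed
    qed (use vm[OF Ub] in \<open>auto split: split_indicator\<close>)
    then have "(\<lambda>n. emeasure \<nu> (T' -` U - T n -` U)) \<longlonglongrightarrow> 0"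
      using vm[OF Ub] by simp
    then have "(\<lambda>n. emeasure \<nu> (T' -` U - T n -` U) + emeasure \<nu> (T' -` U - T n -` U)) \<longlonglongrightarrow> 0 + 0"
      by (intro tendsto_add)
    moreover have "emeasure \<nu> {y. (T n y \<in> U) \<noteq> (T' y \<in> U)}
        = emeasure \<nu> (T' -` U - T n -` U) + emeasure \<nu> (T' -` U - T n -` U)" for n
    proof -
      have finI: "emeasure \<nu> (T' -` U \<inter> T n -` U) < \<infinity>"
        using emeasure_mono[of "T' -` U \<inter> T n -` U" "T' -` U" \<nu>] vm[OF Ub] mp(2)[OF Ub] U by auto
      have "emeasure \<nu> (T n -` U - T' -` U) = emeasure \<nu> (T n -` U - (T' -` U \<inter> T n -` U))"
        by (intro arg_cong[where f="emeasure \<nu>"]) auto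
      also have "\<dots> = emeasure \<nu> (T n -` U) - emeasure \<nu> (T' -` U \<inter> T n -` U)"
        using finI vm[OF Ub] by (intro emeasure_Diff) auto
      also have "\<dots> = emeasure \<nu> (T' -` U) - emeasure \<nu> (T' -` U \<inter> T n -` U)"
        using mp[OF Ub] by simp
      also have "\<dots> = emeasure \<nu> (T' -` U - (T' -` U \<inter> T n -` U))"
        using finI vm[OF Ub] by (intro emeasure_Diff[symmetric]) auto
      also have "\<dots> = emeasure \<nu> (T' -` U - T n -` U)"
        by (intro arg_cong[where f="emeasure \<nu>"]) auto
      finally have eq: "emeasure \<nu> (T n -` U - T' -` U) = emeasure \<nu> (T' -` U - T n -` U)" .
      have "{y. (T n y \<in> U) \<noteq> (T' y \<in> U)} = (T' -` U - T n -` U) \<union> (T n -` U - T' -` U)" by auto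
      moreover have "emeasure \<nu> \<dots> = emeasure \<nu> (T' -` U - T n -` U) + emeasure \<nu> (T n -` U - T' -` U)"
        using vm[OF Ub] by (intro plus_emeasure[symmetric]) auto
      ultimately show ?thesis by (simp only: eq)
    qed
    ultimately show ?thesis by simp
  qed
  show ?thesis
  proof (rule order_tendstoI)
    fix a :: ennreal assume a: "0 < a"
    obtain e where e: "0 < e" "ennreal e \<le> a"
      using a by (cases a) (auto intro: that[of 1] simp: top_unique)
    \<comment> \<open>Three quarters will be spent: one on the open set, and one on each of the
      preimages of the symmetric difference under \<open>T n\<close> and \<open>T'\<close>.\<close>
    obtain U where U: "open U" "emeasure \<nu> U < \<infinity>" "emeasure \<nu> ((A - U) \<union> (U - A)) < ennreal (e/4)"
      using open_approximation[OF sets_\<nu> V A, of "e/4"] e by auto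
    define R where "R = (A - U) \<union> (U - A)"
    have R[measurable]: "R \<in> sets borel" using A U by (simp add: R_def)
    have Ub[measurable]: "U \<in> sets borel" using U by simp
    have "\<forall>\<^sub>F n in sequentially. emeasure \<nu> {y. (T n y \<in> U) \<noteq> (T' y \<in> U)} < ennreal (e/4)"
      using open_case[OF U(1,2)] e by (intro order_tendstoD) auto
    then show "\<forall>\<^sub>F n in sequentially. emeasure \<nu> {y. (T n y \<in> A) \<noteq> (T' y \<in> A)} < a"
    proof eventually_elim
      case (elim n)
      have D: "{y. (T n y \<in> U) \<noteq> (T' y \<in> U)} \<in> sets \<nu>" by measurable
      have "emeasure \<nu> {y. (T n y \<in> A) \<noteq> (T' y \<in> A)}
          \<le> emeasure \<nu> ({y. (T n y \<in> U) \<noteq> (T' y \<in> U)} \<union> (T n -` R \<union> T' -` R))"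
        using vm[OF R] D by (intro emeasure_mono) (auto simp: R_def)
      also have "\<dots> \<le> emeasure \<nu> {y. (T n y \<in> U) \<noteq> (T' y \<in> U)} + emeasure \<nu> (T n -` R \<union> T' -` R)"
        using vm[OF R] D by (intro emeasure_subadditive) auto
      also have "\<dots> \<le> emeasure \<nu> {y. (T n y \<in> U) \<noteq> (T' y \<in> U)} + (emeasure \<nu> (T n -` R) + emeasure \<nu> (T' -` R))"
        using vm[OF R] by (intro add_left_mono emeasure_subadditive) auto
      also have "\<dots> = emeasure \<nu> {y. (T n y \<in> U) \<noteq> (T' y \<in> U)} + (emeasure \<nu> R + emeasure \<nu> R)"
        using mp[OF R] by simp
      also have "\<dots> < ennreal (e/4) + (ennreal (e/4) + ennreal (e/4))"
        using elim U(3) by (intro add_strict_mono) (auto simp: R_def)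
      also have "\<dots> \<le> ennreal e" using e by (simp flip: ennreal_plus add: ennreal_leI)
      finally show ?case using e(2) by simp
    qed
  qed simp
qed

section \<open>The tent function and its energy over all positions and scales\<close>

definition tent :: "real \<Rightarrow> real" where
  "tent t = max 0 (1 - \<bar>t\<bar>)"

lemma tent_measurable [measurable]: "tent \<in> borel_measurable borel"
  unfolding tent_def by measurable

lemma tent_bounds: "0 \<le> tent t" "tent t \<le> 1"
  by (auto simp: tent_def)

lemma tent_abs: "tent \<bar>t\<bar> = tent t"
  by (simp add: tent_def)

text \<open>The bound 1 is used at small scales, the Lipschitz bound at large ones.\<close>

lemma tent_diff_le: "\<bar>tent s - tent t\<bar> \<le> min 1 \<bar>s - t\<bar>"
  by (auto simp: tent_def min_def max_def abs_if split: if_splits)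

lemma tent_eq_0: "1 \<le> \<bar>t\<bar> \<Longrightarrow> tent t = 0"
  by (simp add: tent_def)

text \<open>The contribution to the q-th power of the displacement of \<open>h\<close> made by a
  fibre on which the cocycle takes the value \<beta>, before normalisation by
  \<open>K\<close>.\<close>

definition tent_energy :: "real \<Rightarrow> real \<Rightarrow> real \<Rightarrow> ennreal" where
  "tent_energy p q \<beta> = (\<integral>\<^sup>+u. \<integral>\<^sup>+s. ennreal (exp ((p - 1) * s)) *
      ennreal (\<bar>tent ((u - \<beta>) * exp (- s)) - tent (u * exp (- s))\<bar> powr q) \<partial>lborel \<partial>lborel)"

text \<open>Substitute \<beta> u for u and s + ln |\<beta>| for s: the arguments of the tents change
  at most in sign, du gives the factor |\<beta>| and the weight gives |\<beta>|^(p-1).\<close>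

lemma tent_energy_scale:
  "tent_energy p q \<beta> = ennreal (\<bar>\<beta>\<bar> powr p) * tent_energy p q 1"
proof (cases "\<beta> = 0")
  case True
  then show ?thesis by (simp add: tent_energy_def)
next
  case False
  let ?G = "\<lambda>u s \<beta>. \<bar>tent ((u - \<beta>) * exp (- s)) - tent (u * exp (- s))\<bar> powr q"
  have G: "?G (\<beta> * u) (ln \<bar>\<beta>\<bar> + s) \<beta> = ?G u s 1" for u s
  proof -
    have "- (ln \<bar>\<beta>\<bar> + s) = - s - ln \<bar>\<beta>\<bar>" by simp
    then have "exp (- (ln \<bar>\<beta>\<bar> + s)) = exp (- s) / \<bar>\<beta>\<bar>"
      using False by (simp only: exp_diff) simp
    then have E: "\<bar>\<beta>\<bar> * exp (- (ln \<bar>\<beta>\<bar> + s)) = exp (- s)" using False by simp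
    have "\<bar>\<beta> * (u - 1) * exp (- (ln \<bar>\<beta>\<bar> + s))\<bar> = \<bar>u - 1\<bar> * (\<bar>\<beta>\<bar> * exp (- (ln \<bar>\<beta>\<bar> + s)))"
      "\<bar>\<beta> * u * exp (- (ln \<bar>\<beta>\<bar> + s))\<bar> = \<bar>u\<bar> * (\<bar>\<beta>\<bar> * exp (- (ln \<bar>\<beta>\<bar> + s)))"
      by (simp_all only: abs_mult abs_exp_cancel mult_ac)
    then have "\<bar>(\<beta> * u - \<beta>) * exp (- (ln \<bar>\<beta>\<bar> + s))\<bar> = \<bar>(u - 1) * exp (- s)\<bar>"
      "\<bar>(\<beta> * u) * exp (- (ln \<bar>\<beta>\<bar> + s))\<bar> = \<bar>u * exp (- s)\<bar>"
      unfolding E by (simp_all add: abs_mult right_diff_distrib)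
    then show ?thesis by (metis tent_abs)
  qed
  have E: "exp ((p - 1) * (ln \<bar>\<beta>\<bar> + s)) = \<bar>\<beta>\<bar> powr (p - 1) * exp ((p - 1) * s)" for s
    using False by (simp add: powr_def distrib_left exp_add)
  have "tent_energy p q \<beta> = ennreal \<bar>\<beta>\<bar> * (\<integral>\<^sup>+u. \<integral>\<^sup>+s. ennreal (exp ((p - 1) * s)) *
      ennreal (?G (\<beta> * u) s \<beta>) \<partial>lborel \<partial>lborel)"
    unfolding tent_energy_def using False
    by (subst nn_integral_real_affine[where c=\<beta> and t=0]) auto
  also have "\<dots> = ennreal \<bar>\<beta>\<bar> * (\<integral>\<^sup>+u. \<integral>\<^sup>+s. ennreal (exp ((p - 1) * (ln \<bar>\<beta>\<bar> + s))) *
      ennreal (?G (\<beta> * u) (ln \<bar>\<beta>\<bar> + s) \<beta>) \<partial>lborel \<partial>lborel)"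
    by (subst nn_integral_real_affine[where c=1 and t="ln \<bar>\<beta>\<bar>"]) auto
  also have "\<dots> = ennreal \<bar>\<beta>\<bar> * (ennreal (\<bar>\<beta>\<bar> powr (p - 1)) * tent_energy p q 1)"
    unfolding G E tent_energy_def
    by (simp add: ennreal_mult nn_integral_cmult mult.assoc)
  also have "\<dots> = ennreal (\<bar>\<beta>\<bar> powr p) * tent_energy p q 1"
    using False by (simp add: mult.assoc[symmetric] ennreal_mult[symmetric] powr_diff)
  finally show ?thesis .
qed

lemma nn_integral_exp_Ici:
  assumes "0 < k"
  shows "(\<integral>\<^sup>+s. ennreal (exp (- k * s)) * indicator {0..} s \<partial>lborel) = ennreal (1 / k)"
proof -
  have "((\<lambda>s. - exp (- k * s) / k) \<longlongrightarrow> - 0 / k) at_top"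
  proof (intro tendsto_divide tendsto_minus tendsto_const)
    show "((\<lambda>s. exp (- k * s)) \<longlongrightarrow> 0) at_top"
      using assms by (intro filterlim_compose[OF exp_at_bot] filterlim_tendsto_neg_mult_at_bot[of _ "- k"] filterlim_ident) auto
  qed (use assms in auto)
  then have "(\<integral>\<^sup>+s. ennreal (exp (- k * s)) * indicator {0..} s \<partial>lborel) = ennreal (- 0 / k - (- exp (- k * 0) / k))"
    using assms by (intro nn_integral_FTC_atLeast) (auto intro!: derivative_eq_intros)
  then show ?thesis by simp
qed

text \<open>At scale s the difference is supported in two intervals of half-length exp s, around 0
  and 1. The order of integration is exchanged so that u is integrated first at a fixed scale, which
  leaves one exponential for each sign of s.\<close>

lemma tent_energy_finite:
  assumes p: "0 < p" and q: "p < q"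
  shows "tent_energy p q 1 < \<infinity>"
proof -
  let ?G = "\<lambda>u s. exp ((p - 1) * s) * \<bar>tent ((u - 1) * exp (- s)) - tent (u * exp (- s))\<bar> powr q"
  let ?I = "\<lambda>s. {- exp s..exp s}" and ?J = "\<lambda>s. {1 - exp s..1 + exp s}"
  define w where "w s = exp ((p - 1) * s) * min 1 (exp (- s)) powr q" for s :: real
  have G: "?G u s \<le> w s * (indicator (?I s) u + indicator (?J s) u)" for u s
  proof (cases "u \<in> ?I s \<or> u \<in> ?J s")
    case True
    have "\<bar>tent ((u - 1) * exp (- s)) - tent (u * exp (- s))\<bar> \<le> min 1 \<bar>(u - 1) * exp (- s) - u * exp (- s)\<bar>"
      by (rule tent_diff_le)
    also have "(u - 1) * exp (- s) - u * exp (- s) = - exp (- s)" by (simp add: algebra_simps)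
    finally have "\<bar>tent ((u - 1) * exp (- s)) - tent (u * exp (- s))\<bar> powr q \<le> min 1 (exp (- s)) powr q"
      using p q by (intro powr_mono2) auto
    then have "?G u s \<le> w s * 1" unfolding w_def by simp
    also have "\<dots> \<le> w s * (indicator (?I s) u + indicator (?J s) u)"
      using True by (intro mult_left_mono) (auto simp: w_def indicator_def)
    finally show ?thesis .
  next
    case False
    then have "exp s \<le> \<bar>u\<bar>" "exp s \<le> \<bar>u - 1\<bar>" by auto
    then have "1 \<le> \<bar>u * exp (- s)\<bar>" "1 \<le> \<bar>(u - 1) * exp (- s)\<bar>"
      by (auto simp: abs_mult exp_minus field_simps)
    then show ?thesis by (simp add: tent_eq_0 w_def)
  qed
  \<comment> \<open>Here \<open>4 * exp s\<close> is the total length of the two intervals.\<close>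
  have wle: "w s * (4 * exp s) \<le> 4 * (exp (- p * - s) * indicator {0..} (- s) + exp (- (q - p) * s) * indicator {0..} s)" for s
  proof (cases "0 \<le> s")
    case True
    have "w s * (4 * exp s) = 4 * (exp ((p - 1) * s) * exp (- s) powr q * exp s)"
      using True by (simp add: w_def min_def)
    also have "exp ((p - 1) * s) * exp (- s) powr q * exp s = exp (- (q - p) * s)"
      by (simp add: exp_powr_real mult_exp_exp algebra_simps)
    finally have eq: "w s * (4 * exp s) = 4 * exp (- (q - p) * s)" .
    show ?thesis unfolding eq using True by (auto simp: indicator_def)
  next
    case False
    then have "w s * (4 * exp s) = 4 * (exp ((p - 1) * s) * exp s)"
      by (simp add: w_def min_def)
    also have "exp ((p - 1) * s) * exp s = exp (- p * - s)"
      by (simp add: mult_exp_exp algebra_simps)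
    finally show ?thesis using False by (simp add: indicator_def)
  qed
  have "tent_energy p q 1 = (\<integral>\<^sup>+s. \<integral>\<^sup>+u. ennreal (?G u s) \<partial>lborel \<partial>lborel)"
    unfolding tent_energy_def
    by (subst lborel_pair.Fubini'[symmetric]) (auto simp: ennreal_mult)
  also have "\<dots> \<le> (\<integral>\<^sup>+s. ennreal (w s * (4 * exp s)) \<partial>lborel)"
  proof (intro nn_integral_mono)
    fix s :: real
    have w0: "0 \<le> w s" by (simp add: w_def)
    have "(\<integral>\<^sup>+u. ennreal (?G u s) \<partial>lborel) \<le> (\<integral>\<^sup>+u. ennreal (w s) * (indicator (?I s) u + indicator (?J s) u) \<partial>lborel)"
    proof (intro nn_integral_mono)
      fix u :: real
      have "ennreal (?G u s) \<le> ennreal (w s * (indicator (?I s) u + indicator (?J s) u))"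
        by (intro ennreal_leI G)
      also have "\<dots> = ennreal (w s) * (indicator (?I s) u + indicator (?J s) u)"
        using w0 by (auto simp: ennreal_mult indicator_def)
      finally show "ennreal (?G u s) \<le> ennreal (w s) * (indicator (?I s) u + indicator (?J s) u)" .
    qed
    also have "\<dots> = ennreal (w s) * (ennreal (2 * exp s) + ennreal (2 * exp s))"
      by (simp add: nn_integral_cmult nn_integral_add)
    also have "\<dots> = ennreal (w s * (4 * exp s))"
      using w0 by (simp flip: ennreal_plus ennreal_mult)
    finally show "(\<integral>\<^sup>+u. ennreal (?G u s) \<partial>lborel) \<le> ennreal (w s * (4 * exp s))" .
  qed
  also have "\<dots> \<le> (\<integral>\<^sup>+s. 4 * (ennreal (exp (- p * - s)) * indicator {0..} (- s) + ennreal (exp (- (q - p) * s)) * indicator {0..} s) \<partial>lborel)"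
  proof (intro nn_integral_mono)
    fix s :: real
    have "ennreal (w s * (4 * exp s)) \<le> ennreal (4 * (exp (- p * - s) * indicator {0..} (- s) + exp (- (q - p) * s) * indicator {0..} s))"
      by (intro ennreal_leI wle)
    also have "\<dots> = 4 * (ennreal (exp (- p * - s)) * indicator {0..} (- s) + ennreal (exp (- (q - p) * s)) * indicator {0..} s)"
      by (auto simp: ennreal_mult indicator_def)
    finally show "ennreal (w s * (4 * exp s)) \<le> \<dots>" .
  qed
  also have "\<dots> = 4 * ((\<integral>\<^sup>+s. ennreal (exp (- p * - s)) * indicator {0..} (- s) \<partial>lborel) + (\<integral>\<^sup>+s. ennreal (exp (- (q - p) * s)) * indicator {0..} s \<partial>lborel))"
    by (subst nn_integral_cmult, measurable) (subst nn_integral_add, auto)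
  also have "(\<integral>\<^sup>+s. ennreal (exp (- p * - s)) * indicator {0..} (- s) \<partial>lborel) = (\<integral>\<^sup>+s. ennreal (exp (- p * s)) * indicator {0..} s \<partial>lborel)"
    by (subst (2) nn_integral_real_affine[where c="-1" and t=0]) auto
  also have "4 * (\<dots> + (\<integral>\<^sup>+s. ennreal (exp (- (q - p) * s)) * indicator {0..} s \<partial>lborel)) = 4 * (ennreal (1 / p) + ennreal (1 / (q - p)))"
    using p q by (simp only: nn_integral_exp_Ici diff_gt_0_iff_gt)
  also have "\<dots> < \<infinity>" by (simp add: ennreal_mult_less_top)
  finally show ?thesis .
qed

text \<open>On the rectangle 0 < u < exp(-2), -2 < s < -1 the tent around 0 is positive while the
  tent around 1 vanishes, since there exp(-s) lies between 2 and exp 2. Positivity allows division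
  by the energy.\<close>

lemma tent_energy_pos: "0 < tent_energy p q 1"
proof (rule ccontr)
  assume "\<not> 0 < tent_energy p q 1"
  then have 0: "tent_energy p q 1 = 0" by simp
  have "AE u in lborel. (\<integral>\<^sup>+s. ennreal (exp ((p - 1) * s)) *
      ennreal (\<bar>tent ((u - 1) * exp (- s)) - tent (u * exp (- s))\<bar> powr q) \<partial>lborel) = 0"
    using 0 unfolding tent_energy_def by (subst (asm) nn_integral_0_iff_AE) auto
  then have "AE u in lborel. AE s in lborel. tent ((u - 1) * exp (- s)) = tent (u * exp (- s))"
    by eventually_elim (subst (asm) nn_integral_0_iff_AE, auto elim!: eventually_mono)
  moreover have "\<not> (AE s in lborel. tent ((u - 1) * exp (- s)) = tent (u * exp (- s)))" if u: "0 < u" "u < exp (- 2)" for u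
  proof
    assume *: "AE s in lborel. tent ((u - 1) * exp (- s)) = tent (u * exp (- s))"
    have **: "s \<notin> {-2<..<-1}" if s: "tent ((u - 1) * exp (- s)) = tent (u * exp (- s))" for s
    proof
      assume s2: "s \<in> {-2<..<-1}"
      have "u * exp (- s) < exp (- 2) * exp 2" using u s2 by (intro mult_strict_mono) auto
      then have 1: "u * exp (- s) < 1" by (simp add: mult_exp_exp)
      have e: "2 \<le> exp (- s)" using exp_ge_add_one_self[of "- s"] s2 by auto
      have "u < 1/2"
      proof -
        have "exp (2::real) \<ge> 3" using exp_ge_add_one_self[of 2] by simp
        then have "exp (- 2 :: real) \<le> 1/3" by (simp add: exp_minus field_simps)
        with u show ?thesis by simp
      qed
      have "1/2 * 2 \<le> (1 - u) * exp (- s)" using e \<open>u < 1/2\<close> by (intro mult_mono) auto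
      also have "\<dots> = \<bar>(u - 1) * exp (- s)\<bar>" using \<open>u < 1/2\<close> by (simp add: abs_mult)
      finally have "tent ((u - 1) * exp (- s)) = 0" by (intro tent_eq_0) simp
      moreover have "tent (u * exp (- s)) > 0" using 1 u by (auto simp: tent_def)
      ultimately show False using s by simp
    qed
    from * have "AE s in lborel. s \<notin> {-2<..<-1::real}" by eventually_elim (rule **)
    then have "{-2<..<-1::real} \<in> null_sets lborel" by (subst AE_iff_null_sets) auto
    then have "emeasure lborel {-2<..<-1::real} = 0" by (rule null_setsD1)
    then show False by simp
  qed
  ultimately have "AE u in lborel. u \<notin> {0<..<exp (- 2::real)}" by (auto elim!: eventually_mono)
  then have "{0<..<exp (- 2::real)} \<in> null_sets lborel" by (subst AE_iff_null_sets) auto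
  then have "emeasure lborel {0<..<exp (- 2::real)} = 0" by (rule null_setsD1)
  then show False by simp
qed

lemma borel_fst [measurable]: "fst \<in> borel_measurable (borel :: ('a::second_countable_topology \<times> 'b::second_countable_topology) measure)"
  by (intro borel_measurable_continuous_onI continuous_intros)

lemma borel_snd [measurable]: "snd \<in> borel_measurable (borel :: ('a::second_countable_topology \<times> 'b::second_countable_topology) measure)"
  by (intro borel_measurable_continuous_onI continuous_intros)

section \<open>The extension by positions and logarithmic scales\<close>

locale skew_product = skew_system M p S c b
  for M :: "'a::{second_countable_topology, complete_space} measure" and p
    and S :: "'g::topological_group_add \<Rightarrow> 'a \<Rightarrow> 'a" and c b +
  fixes K :: real
  assumes K_pos: "0 < K"
begin

text \<open>The coordinates are a base point, a position and the logarithm of a scale;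
  \<open>K\<close> will be the reciprocal of \<open>tent_energy p q 1\<close>.\<close>

definition \<nu> :: "('a \<times> real \<times> real) measure" where
  "\<nu> = density (M \<Otimes>\<^sub>M lborel) (\<lambda>(x, u, s). ennreal (K * exp ((p - 1) * s)))"

text \<open>This is the inverse of the affine extension, so \<open>\<tau>\<close> is an action on the right.\<close>
definition \<tau> :: "'g \<Rightarrow> 'a \<times> real \<times> real \<Rightarrow> 'a \<times> real \<times> real" where
  "\<tau> g y = (S g (fst y), (fst (snd y) - b g (fst y)) / c g (fst y), snd (snd y) - ln \<bar>c g (fst y)\<bar>)"

lemma space_M: "space M = UNIV"
  using sets_eq_imp_space_eq[OF sets_M] by simp

lemma sets_prod: "sets (M \<Otimes>\<^sub>M (lborel :: (real \<times> real) measure)) = sets borel"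
proof -
  have "sets (M \<Otimes>\<^sub>M (lborel :: (real \<times> real) measure)) = sets (borel \<Otimes>\<^sub>M borel)"
    by (intro sets_pair_measure_cong sets_M sets_lborel)
  then show ?thesis by (simp only: borel_prod)
qed

lemma sets_\<nu> [measurable_cong]: "sets \<nu> = sets borel"
  unfolding \<nu>_def by (simp only: sets_density sets_prod)

lemma density_measurable: "(\<lambda>(x, u, s). ennreal (K * exp ((p - 1) * s))) \<in> borel_measurable (M \<Otimes>\<^sub>M (lborel :: (real \<times> real) measure))"
proof -
  have "(\<lambda>y. ennreal (K * exp ((p - 1) * snd (snd y)))) \<in> borel_measurable (borel :: ('a \<times> real \<times> real) measure)"
    by measurable
  then show ?thesis by (simp add: measurable_cong_sets[OF sets_prod refl] case_prod_beta')
qed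

lemma \<tau>_measurable [measurable]: "\<tau> g \<in> borel_measurable borel"
  unfolding \<tau>_def by measurable

lemma sigma_finite_\<nu>: "sigma_finite_measure \<nu>"
proof -
  interpret P: pair_sigma_finite M "lborel :: (real \<times> real) measure" ..
  show ?thesis
    unfolding \<nu>_def by (subst P.sigma_finite_iff_density_finite[OF density_measurable]) auto
qed

lemma slice_measurable:
  assumes F: "F \<in> borel_measurable (borel :: ('a \<times> real \<times> real) measure)"
  shows "(\<lambda>y. ennreal (K * exp ((p - 1) * snd (snd y))) * F y) \<in> borel_measurable borel"
    and "(\<lambda>(u, s). ennreal (K * exp ((p - 1) * s)) * F (x, u, s)) \<in> borel_measurable (borel \<Otimes>\<^sub>M borel)"
    and "(\<lambda>x. \<integral>\<^sup>+u. \<integral>\<^sup>+s. ennreal (K * exp ((p - 1) * s)) * F (x, u, s) \<partial>lborel \<partial>lborel) \<in> borel_measurable borel"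
proof -
  note [measurable] = F
  show 1: "(\<lambda>y. ennreal (K * exp ((p - 1) * snd (snd y))) * F y) \<in> borel_measurable borel" by measurable
  have "(\<lambda>w. ennreal (K * exp ((p - 1) * snd w)) * F (x, w)) \<in> borel_measurable (borel :: (real \<times> real) measure)" for x
    by measurable
  then show 2: "(\<lambda>(u, s). ennreal (K * exp ((p - 1) * s)) * F (x, u, s)) \<in> borel_measurable (borel \<Otimes>\<^sub>M borel)" for x
    by (simp add: borel_prod case_prod_beta')
  have "(\<lambda>x. \<integral>\<^sup>+w. ennreal (K * exp ((p - 1) * snd w)) * F (x, w) \<partial>(lborel :: (real \<times> real) measure)) \<in> borel_measurable borel"
  proof (rule lborel.borel_measurable_nn_integral_fst[of "\<lambda>y. ennreal (K * exp ((p - 1) * snd (snd y))) * F y", simplified])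
    have "sets ((borel :: 'a measure) \<Otimes>\<^sub>M lborel) = sets (borel \<Otimes>\<^sub>M (borel :: (real \<times> real) measure))"
      by (intro sets_pair_measure_cong sets_lborel refl)
    then have "sets (borel \<Otimes>\<^sub>M lborel) = sets (borel :: ('a \<times> real \<times> real) measure)"
      by (simp only: borel_prod)
    from measurable_cong_sets[OF this refl] 1
    show "(\<lambda>y. ennreal (K * exp ((p - 1) * snd (snd y))) * F y) \<in> borel_measurable (borel \<Otimes>\<^sub>M lborel)"
      by blast
  qed
  moreover have "(\<integral>\<^sup>+w. ennreal (K * exp ((p - 1) * snd w)) * F (x, w) \<partial>(lborel :: (real \<times> real) measure))
      = (\<integral>\<^sup>+u. \<integral>\<^sup>+s. ennreal (K * exp ((p - 1) * s)) * F (x, u, s) \<partial>lborel \<partial>lborel)" for x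
    using 2[of x] unfolding lborel_prod[symmetric]
    by (subst lborel.nn_integral_fst[symmetric]) (auto simp: case_prod_beta' measurable_cong_sets[OF sets_pair_measure_cong[OF sets_lborel sets_lborel] refl])
  ultimately show "(\<lambda>x. \<integral>\<^sup>+u. \<integral>\<^sup>+s. ennreal (K * exp ((p - 1) * s)) * F (x, u, s) \<partial>lborel \<partial>lborel) \<in> borel_measurable borel"
    by simp
qed

lemma nn_integral_\<nu>:
  assumes F: "F \<in> borel_measurable (borel :: ('a \<times> real \<times> real) measure)"
  shows "(\<integral>\<^sup>+y. F y \<partial>\<nu>) = (\<integral>\<^sup>+x. \<integral>\<^sup>+u. \<integral>\<^sup>+s. ennreal (K * exp ((p - 1) * s)) * F (x, u, s) \<partial>lborel \<partial>lborel \<partial>M)"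
proof -
  have Fm: "F \<in> borel_measurable (M \<Otimes>\<^sub>M lborel)" using F by (simp add: measurable_cong_sets[OF sets_prod refl])
  have "(\<integral>\<^sup>+y. F y \<partial>\<nu>) = (\<integral>\<^sup>+y. ennreal (K * exp ((p - 1) * snd (snd y))) * F y \<partial>(M \<Otimes>\<^sub>M lborel))"
    unfolding \<nu>_def by (subst nn_integral_density[OF density_measurable Fm]) (simp add: case_prod_beta')
  also have "\<dots> = (\<integral>\<^sup>+x. \<integral>\<^sup>+w. ennreal (K * exp ((p - 1) * snd w)) * F (x, w) \<partial>lborel \<partial>M)"
    using slice_measurable(1)[OF F]
    by (subst lborel.nn_integral_fst[symmetric]) (auto simp: measurable_cong_sets[OF sets_prod refl])
  also have "\<dots> = (\<integral>\<^sup>+x. \<integral>\<^sup>+u. \<integral>\<^sup>+s. ennreal (K * exp ((p - 1) * s)) * F (x, u, s) \<partial>lborel \<partial>lborel \<partial>M)"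
  proof (intro nn_integral_cong)
    fix x
    show "(\<integral>\<^sup>+w. ennreal (K * exp ((p - 1) * snd w)) * F (x, w) \<partial>(lborel :: (real \<times> real) measure))
      = (\<integral>\<^sup>+u. \<integral>\<^sup>+s. ennreal (K * exp ((p - 1) * s)) * F (x, u, s) \<partial>lborel \<partial>lborel)"
      using slice_measurable(2)[OF F, of x] unfolding lborel_prod[symmetric]
      by (subst lborel.nn_integral_fst[symmetric]) (auto simp: case_prod_beta' measurable_cong_sets[OF sets_pair_measure_cong[OF sets_lborel sets_lborel] refl])
  qed
  finally show ?thesis .
qed

lemma nn_integral_\<tau>:
  assumes F: "F \<in> borel_measurable (borel :: ('a \<times> real \<times> real) measure)"
  shows "(\<integral>\<^sup>+y. F (\<tau> g y) \<partial>\<nu>) = (\<integral>\<^sup>+y. F y \<partial>\<nu>)"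
proof -
  note [measurable] = F
  let ?k = "\<lambda>s. ennreal (K * exp ((p - 1) * s))"
  let ?H = "\<lambda>x. \<integral>\<^sup>+u. \<integral>\<^sup>+s. ?k s * F (x, u, s) \<partial>lborel \<partial>lborel"
  have "(\<integral>\<^sup>+y. F (\<tau> g y) \<partial>\<nu>) = (\<integral>\<^sup>+x. \<integral>\<^sup>+u. \<integral>\<^sup>+s. ?k s * F (\<tau> g (x, u, s)) \<partial>lborel \<partial>lborel \<partial>M)"
    by (rule nn_integral_\<nu>) measurable
  also have "\<dots> = (\<integral>\<^sup>+x. ennreal (\<bar>c g x\<bar> powr p) * ?H (S g x) \<partial>M)"
  proof (intro nn_integral_cong)
    fix x
    have nz: "c g x \<noteq> 0" by (rule c_nonzero)
    have k: "?k (ln \<bar>c g x\<bar> + s) = ennreal (\<bar>c g x\<bar> powr (p - 1)) * ?k s" for s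
      using nz K_pos by (subst ennreal_mult[symmetric]) (auto simp: powr_def distrib_left exp_add)
    have [measurable]: "(\<lambda>s. F (x, u, s)) \<in> borel_measurable borel" for x u by measurable
    have "(\<integral>\<^sup>+u. \<integral>\<^sup>+s. ?k s * F (\<tau> g (x, u, s)) \<partial>lborel \<partial>lborel)
        = (\<integral>\<^sup>+u. ennreal (\<bar>c g x\<bar> powr (p - 1)) * (\<integral>\<^sup>+s. ?k s * F (S g x, (u - b g x) / c g x, s) \<partial>lborel) \<partial>lborel)"
    proof (intro nn_integral_cong)
      fix u :: real
      have "(\<integral>\<^sup>+s. ?k s * F (\<tau> g (x, u, s)) \<partial>lborel)
          = (\<integral>\<^sup>+s. ?k (ln \<bar>c g x\<bar> + s) * F (S g x, (u - b g x) / c g x, s) \<partial>lborel)"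
        \<comment> \<open>Shifting s cancels the logarithm in \<open>\<tau>\<close>. It is done
          before the substitution in u because its amount depends on x alone.\<close>
        by (subst nn_integral_real_affine[where c=1 and t="ln \<bar>c g x\<bar>"]) (auto simp: \<tau>_def)
      also have "\<dots> = ennreal (\<bar>c g x\<bar> powr (p - 1)) * (\<integral>\<^sup>+s. ?k s * F (S g x, (u - b g x) / c g x, s) \<partial>lborel)"
        unfolding k mult.assoc by (intro nn_integral_cmult) measurable
      finally show "(\<integral>\<^sup>+s. ?k s * F (\<tau> g (x, u, s)) \<partial>lborel)
          = ennreal (\<bar>c g x\<bar> powr (p - 1)) * (\<integral>\<^sup>+s. ?k s * F (S g x, (u - b g x) / c g x, s) \<partial>lborel)" .
    qed
    also have "\<dots> = ennreal \<bar>c g x\<bar> * (\<integral>\<^sup>+u. ennreal (\<bar>c g x\<bar> powr (p - 1)) * (\<integral>\<^sup>+s. ?k s * F (S g x, u, s) \<partial>lborel) \<partial>lborel)"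
    proof -
      have [measurable]: "(\<lambda>u. \<integral>\<^sup>+s. ?k s * F (S g x, u, s) \<partial>lborel) \<in> borel_measurable borel"
        using slice_measurable(2)[OF F, of "S g x"]
        by (intro lborel.borel_measurable_nn_integral) (simp add: measurable_cong_sets[OF sets_pair_measure_cong[OF refl sets_lborel] refl])
      have [measurable]: "(\<lambda>u. \<integral>\<^sup>+s. ?k s * F (S g x, (u - b g x) / c g x, s) \<partial>lborel) \<in> borel_measurable borel"
        by (rule measurable_compose[of "\<lambda>u. (u - b g x) / c g x" borel borel "\<lambda>u. \<integral>\<^sup>+s. ?k s * F (S g x, u, s) \<partial>lborel"]) auto
      show ?thesis
        by (subst nn_integral_real_affine[where c="c g x" and t="b g x"]) (use nz in auto)
    qed
    also have "\<dots> = ennreal (\<bar>c g x\<bar> powr p) * ?H (S g x)"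
    proof -
      have [measurable]: "(\<lambda>u. \<integral>\<^sup>+s. ?k s * F (S g x, u, s) \<partial>lborel) \<in> borel_measurable borel"
        using slice_measurable(2)[OF F, of "S g x"]
        by (intro lborel.borel_measurable_nn_integral) (simp add: measurable_cong_sets[OF sets_pair_measure_cong[OF refl sets_lborel] refl])
      show ?thesis
        using nz by (subst nn_integral_cmult) (auto simp: mult.assoc[symmetric] ennreal_mult[symmetric] powr_diff)
    qed
    finally show "(\<integral>\<^sup>+u. \<integral>\<^sup>+s. ?k s * F (\<tau> g (x, u, s)) \<partial>lborel \<partial>lborel) = ennreal (\<bar>c g x\<bar> powr p) * ?H (S g x)" .
  qed
  also have "\<dots> = (\<integral>\<^sup>+x. ?H x \<partial>M)"
    by (rule nn_integral_push[OF sets_M S_measurable c_measurable slice_measurable(3)[OF F] push])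
  also have "\<dots> = (\<integral>\<^sup>+y. F y \<partial>\<nu>)" by (rule nn_integral_\<nu>[OF F, symmetric])
  finally show ?thesis .
qed

lemma emeasure_\<tau>:
  assumes A: "A \<in> sets borel"
  shows "emeasure \<nu> (\<tau> g -` A) = emeasure \<nu> A"
proof -
  have "\<tau> g -` A \<in> sets \<nu>" using measurable_sets[OF \<tau>_measurable A] by (simp add: sets_\<nu>)
  then have "emeasure \<nu> (\<tau> g -` A) = (\<integral>\<^sup>+y. indicator (\<tau> g -` A) y \<partial>\<nu>)"
    by (rule nn_integral_indicator[symmetric])
  also have "\<dots> = (\<integral>\<^sup>+y. indicator A (\<tau> g y) \<partial>\<nu>)"
    by (intro nn_integral_cong) (simp add: indicator_def)
  also have "\<dots> = (\<integral>\<^sup>+y. indicator A y \<partial>\<nu>)" using A by (intro nn_integral_\<tau>) auto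
  also have "\<dots> = emeasure \<nu> A" using A by (simp add: sets_\<nu>)
  finally show ?thesis .
qed

lemma AE_\<nu>:
  assumes "AE x in M. P x"
  shows "AE y in \<nu>. P (fst y)"
proof -
  from assms obtain N where N: "{x \<in> space M. \<not> P x} \<subseteq> N" "emeasure M N = 0" "N \<in> sets M"
    by (auto elim: AE_E)
  have [measurable]: "N \<in> sets borel" using N sets_M by simp
  have "(\<integral>\<^sup>+y. indicator N (fst y) \<partial>\<nu>) = (\<integral>\<^sup>+x. \<integral>\<^sup>+u. \<integral>\<^sup>+s. ennreal (K * exp ((p - 1) * s)) * indicator N x \<partial>lborel \<partial>(lborel :: real measure) \<partial>M)"
    by (subst nn_integral_\<nu>) auto
  also have "\<dots> = (\<integral>\<^sup>+x. 0 \<partial>M)"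
  proof (rule nn_integral_cong_AE)
    have "AE x in M. x \<notin> N" using N by (intro AE_not_in) (auto simp: null_sets_def)
    then show "AE x in M. (\<integral>\<^sup>+u. \<integral>\<^sup>+s. ennreal (K * exp ((p - 1) * s)) * indicator N x \<partial>lborel \<partial>(lborel :: real measure)) = 0"
      by eventually_elim simp
  qed
  finally have "(\<integral>\<^sup>+y. indicator N (fst y) \<partial>\<nu>) = 0" by simp
  then have "AE y in \<nu>. indicator N (fst y) = (0::ennreal)"
    by (subst (asm) nn_integral_0_iff_AE) auto
  then show ?thesis
    by eventually_elim (use N(1) space_M in \<open>auto simp: indicator_def split: if_splits\<close>)
qed

lemma \<tau>_0: "AE y in \<nu>. \<tau> 0 y = y"
proof -
  \<comment> \<open>With \<open>S 0\<close> the identity and \<open>c 0\<close> equal to 1, the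
    cocycle identity at 0 + 0 reads b 0 = b 0 + b 0.\<close>
  have "AE x in M. b (0 + 0) x = c 0 x * b 0 (S 0 x) + b 0 x" by (rule b_add)
  then have "AE x in M. S 0 x = x \<and> c 0 x = 1 \<and> b 0 x = 0"
    using S_0 c_0 by eventually_elim simp
  from AE_\<nu>[OF this] show ?thesis by eventually_elim (simp add: \<tau>_def)
qed

lemma \<tau>_add: "AE y in \<nu>. \<tau> (g + g') y = \<tau> g' (\<tau> g y)"
proof -
  have "AE x in M. S (g + g') x = S g' (S g x) \<and> c (g + g') x = c g x * c g' (S g x) \<and>
      b (g + g') x = c g x * b g' (S g x) + b g x"
    using S_add c_add b_add by eventually_elim simp
  from AE_\<nu>[OF this] show ?thesis
  proof eventually_elim
    case (elim y)
    have "c g (fst y) \<noteq> 0" "c g' (S g (fst y)) \<noteq> 0" by (rule c_nonzero)+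
    with elim show ?case by (simp add: \<tau>_def abs_mult ln_mult field_simps)
  qed
qed

text \<open>An open exhaustion by sets of finite measure, for the limit lemma: bounded s keeps the
  weight bounded, and the base has finite measure.\<close>

definition box :: "nat \<Rightarrow> ('a \<times> real \<times> real) set" where
  "box m = UNIV \<times> ({- real m<..<real m} \<times> {- real m<..<real m})"

lemma box_open: "open (box m)"
  unfolding box_def by (intro open_Times) auto

lemma box_finite: "emeasure \<nu> (box m) < \<infinity>"
proof -
  have [measurable]: "box m \<in> sets borel" using box_open by simp
  let ?B = "{- real m<..<real m}"
  have "emeasure \<nu> (box m) = (\<integral>\<^sup>+y. indicator (box m) y \<partial>\<nu>)" by (simp add: sets_\<nu>)
  also have "\<dots> = (\<integral>\<^sup>+x. \<integral>\<^sup>+u. \<integral>\<^sup>+s. ennreal (K * exp ((p - 1) * s)) * indicator (box m) (x, u, s) \<partial>lborel \<partial>lborel \<partial>M)"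
    by (subst nn_integral_\<nu>) auto
  also have "\<dots> \<le> (\<integral>\<^sup>+x. \<integral>\<^sup>+u. \<integral>\<^sup>+s. ennreal (K * exp (\<bar>p - 1\<bar> * m)) * indicator ?B u * indicator ?B s \<partial>lborel \<partial>lborel \<partial>M)"
  proof (intro nn_integral_mono)
    fix x and u s :: real
    show "ennreal (K * exp ((p - 1) * s)) * indicator (box m) (x, u, s) \<le> ennreal (K * exp (\<bar>p - 1\<bar> * m)) * indicator ?B u * indicator ?B s"
    proof (cases "u \<in> ?B \<and> s \<in> ?B")
      case True
      have "(p - 1) * s \<le> \<bar>(p - 1) * s\<bar>" by simp
      also have "\<dots> \<le> \<bar>p - 1\<bar> * m" unfolding abs_mult using True by (intro mult_left_mono) auto
      finally have "K * exp ((p - 1) * s) \<le> K * exp (\<bar>p - 1\<bar> * m)" using K_pos by simp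
      then show ?thesis using True by (auto simp: box_def intro!: ennreal_leI)
    qed (auto simp: box_def)
  qed
  also have "\<dots> = ennreal (K * exp (\<bar>p - 1\<bar> * m)) * ennreal (2 * real m) * ennreal (2 * real m) * emeasure M (space M)"
    by (simp add: nn_integral_cmult nn_integral_multc mult_ac)
  also have "\<dots> < \<infinity>" by (auto simp: ennreal_mult_less_top emeasure_eq_measure)
  finally show ?thesis .
qed

text \<open>If continuity failed, every neighbourhood \<open>P n\<close> would contain a bad group
  element. Along such a sequence \<open>\<tau>\<close> converges almost everywhere, which the limit
  lemma contradicts.\<close>

lemma \<tau>_continuous:
  fixes e :: real
  assumes A: "A \<in> sets borel" "emeasure \<nu> A < \<infinity>" and e: "0 < e"
  shows "\<forall>\<^sub>F g in nhds g0. emeasure \<nu> {y. (\<tau> g y \<in> A) \<noteq> (\<tau> g0 y \<in> A)} < ennreal e"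
proof (rule ccontr)
  let ?D = "\<lambda>g. emeasure \<nu> {y. (\<tau> g y \<in> A) \<noteq> (\<tau> g0 y \<in> A)}"
  assume not: "\<not> (\<forall>\<^sub>F g in nhds g0. ?D g < ennreal e)"
  from cont[of g0] obtain P where P: "\<And>n::nat. \<forall>\<^sub>F g in nhds g0. P n g"
    and lim: "\<And>\<gamma>. (\<And>n. P n (\<gamma> n)) \<Longrightarrow> (AE x in M. (\<lambda>n. S (\<gamma> n) x) \<longlonglongrightarrow> S g0 x \<and>
            (\<lambda>n. c (\<gamma> n) x) \<longlonglongrightarrow> c g0 x \<and> (\<lambda>n. b (\<gamma> n) x) \<longlonglongrightarrow> b g0 x)" by blast
  have "\<exists>g. P n g \<and> \<not> ?D g < ennreal e" for n
  proof (rule ccontr)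
    assume "\<nexists>g. P n g \<and> \<not> ?D g < ennreal e"
    with P[of n] have "\<forall>\<^sub>F g in nhds g0. ?D g < ennreal e" by (auto elim!: eventually_mono)
    with not show False by contradiction
  qed
  then have "\<exists>\<gamma>. \<forall>n. P n (\<gamma> n) \<and> \<not> ?D (\<gamma> n) < ennreal e" by (intro choice allI)
  then obtain \<gamma> where \<gamma>: "\<And>n. P n (\<gamma> n)" "\<And>n. \<not> ?D (\<gamma> n) < ennreal e" by blast
  from AE_\<nu>[OF lim[OF \<gamma>(1)]] have ae: "AE y in \<nu>. (\<lambda>n. \<tau> (\<gamma> n) y) \<longlonglongrightarrow> \<tau> g0 y"
    unfolding \<tau>_def
    by eventually_elim (auto intro!: tendsto_intros simp: c_nonzero)
  have "(\<lambda>n. ?D (\<gamma> n)) \<longlonglongrightarrow> 0"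
  proof (rule measure_preserving_pointwise_limit[OF sets_\<nu> box_open _ _ box_finite _ _ _ _ ae A])
    show "incseq box" by (auto simp: incseq_def box_def)
    show "(\<Union>m. box m) = UNIV"
    proof -
      have "y \<in> (\<Union>m. box m)" for y
      proof -
        obtain m :: nat where "max \<bar>fst (snd y)\<bar> \<bar>snd (snd y)\<bar> < m" using reals_Archimedean2 by blast
        then show ?thesis by (intro UN_I[of m]) (auto simp: box_def mem_Times_iff)
      qed
      then show ?thesis by auto
    qed
  qed (auto simp: emeasure_\<tau>)
  then have "\<forall>\<^sub>F n in sequentially. ?D (\<gamma> n) < ennreal e" using e by (intro order_tendstoD) auto
  with \<gamma>(2) show False by simp
qed

definition h :: "'a \<times> real \<times> real \<Rightarrow> real" where
  "h y = tent (fst (snd y) * exp (- snd (snd y)))"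

lemma h_measurable [measurable]: "h \<in> borel_measurable borel"
  unfolding h_def by measurable

lemma h_bounded: "\<bar>h y\<bar> \<le> 1"
  using tent_bounds by (simp add: h_def)

text \<open>Position is divided by \<open>c\<close> and scale by its absolute value; evenness of the
  tent absorbs the remaining sign.\<close>

lemma h_\<tau>: "h (\<tau> g y) = tent ((fst (snd y) - b g (fst y)) * exp (- snd (snd y)))"
proof -
  let ?c = "c g (fst y)"
  have nz: "?c \<noteq> 0" by (rule c_nonzero)
  have "exp (- (snd (snd y) - ln \<bar>?c\<bar>)) = exp (- snd (snd y)) * \<bar>?c\<bar>"
    using nz by (simp add: exp_diff exp_minus field_simps)
  then have "\<bar>(fst (snd y) - b g (fst y)) / ?c * exp (- (snd (snd y) - ln \<bar>?c\<bar>))\<bar>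
      = \<bar>(fst (snd y) - b g (fst y)) * exp (- snd (snd y))\<bar>"
    using nz by (simp add: abs_mult)
  then show ?thesis unfolding h_def \<tau>_def by (metis tent_abs fst_conv snd_conv)
qed

lemma h_energy:
  assumes "ennreal K * tent_energy p q 1 = 1"
  shows "(\<integral>\<^sup>+y. ennreal (\<bar>h (\<tau> g y) - h y\<bar> powr q) \<partial>\<nu>) = Lp_int M p (b g)"
proof -
  let ?G = "\<lambda>\<beta> u s. ennreal (exp ((p - 1) * s)) * ennreal (\<bar>tent ((u - \<beta>) * exp (- s)) - tent (u * exp (- s))\<bar> powr q)"
  have "(\<integral>\<^sup>+y. ennreal (\<bar>h (\<tau> g y) - h y\<bar> powr q) \<partial>\<nu>)
     = (\<integral>\<^sup>+x. \<integral>\<^sup>+u. \<integral>\<^sup>+s. ennreal K * ?G (b g x) u s \<partial>lborel \<partial>lborel \<partial>M)"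
  proof (subst nn_integral_\<nu>)
    have "h (\<tau> g (x, u, s)) = tent ((u - b g x) * exp (- s))" "h (x, u, s) = tent (u * exp (- s))" for x u s
      by (simp_all add: h_\<tau>) (simp add: h_def)
    then show "(\<integral>\<^sup>+x. \<integral>\<^sup>+u. \<integral>\<^sup>+s. ennreal (K * exp ((p - 1) * s)) * ennreal (\<bar>h (\<tau> g (x, u, s)) - h (x, u, s)\<bar> powr q) \<partial>lborel \<partial>lborel \<partial>M)
        = (\<integral>\<^sup>+x. \<integral>\<^sup>+u. \<integral>\<^sup>+s. ennreal K * ?G (b g x) u s \<partial>lborel \<partial>lborel \<partial>M)"
      using K_pos by (simp add: ennreal_mult mult.assoc)
  qed measurable
  also have "\<dots> = (\<integral>\<^sup>+x. ennreal K * tent_energy p q (b g x) \<partial>M)"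
    unfolding tent_energy_def by (intro nn_integral_cong) (subst nn_integral_cmult, measurable)+
  also have "\<dots> = (\<integral>\<^sup>+x. ennreal (\<bar>b g x\<bar> powr p) \<partial>M)"
  proof (intro nn_integral_cong)
    fix x
    have "ennreal K * tent_energy p q (b g x) = ennreal (\<bar>b g x\<bar> powr p) * (ennreal K * tent_energy p q 1)"
      by (subst tent_energy_scale) (simp add: mult_ac)
    then show "ennreal K * tent_energy p q (b g x) = ennreal (\<bar>b g x\<bar> powr p)" by (simp add: assms)
  qed
  finally show ?thesis by (simp add: Lp_int_def)
qed

end

section \<open>Koopman representations\<close>

lemma Lp_int_distr:
  assumes [measurable]: "T \<in> measurable N N" "f \<in> borel_measurable N" and T: "distr N N T = N"
  shows "Lp_int N r (\<lambda>y. f (T y)) = Lp_int N r f"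
proof -
  have "Lp_int N r f = Lp_int (distr N N T) r f" by (simp add: T)
  also have "\<dots> = Lp_int N r (\<lambda>y. f (T y))" unfolding Lp_int_def by (subst nn_integral_distr) auto
  finally show ?thesis by simp
qed

text \<open>Composition with measure preserving maps is isometric, so continuity need only be tested
  on indicators of sets of finite measure. There the integral is the measure of the set where the
  two memberships differ, whatever the exponent.\<close>

lemma Lp_comp_continuous:
  fixes f :: "'y \<Rightarrow> real" and e :: real
  assumes T[measurable]: "\<And>i. T i \<in> measurable N N" "T' \<in> measurable N N"
    and mp: "\<And>i. distr N N (T i) = N" "distr N N T' = N"
    and sets: "\<And>A e. A \<in> sets N \<Longrightarrow> emeasure N A < \<infinity> \<Longrightarrow> 0 < e \<Longrightarrow>
      \<forall>\<^sub>F i in F. emeasure N {y \<in> space N. (T i y \<in> A) \<noteq> (T' y \<in> A)} < ennreal e"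
    and f: "f \<in> Lp N r" and r: "0 < r" and e: "0 < e"
  shows "\<forall>\<^sub>F i in F. Lp_int N r (\<lambda>y. f (T i y) - f (T' y)) < ennreal e"
  using f r e
proof (induction arbitrary: e rule: Lp_induct)
  case (indicator A)
  note [measurable] = indicator(1)
  have "Lp_int N r (\<lambda>y. indicator A (T i y) - indicator A (T' y)) = emeasure N {y \<in> space N. (T i y \<in> A) \<noteq> (T' y \<in> A)}" for i
  proof -
    have "Lp_int N r (\<lambda>y. indicator A (T i y) - indicator A (T' y)) = Lp_int N r (indicator {y \<in> space N. (T i y \<in> A) \<noteq> (T' y \<in> A)})"
      unfolding Lp_int_def by (intro nn_integral_cong) (auto simp: indicator_def)
    also have "\<dots> = (\<integral>\<^sup>+y. indicator {y \<in> space N. (T i y \<in> A) \<noteq> (T' y \<in> A)} y \<partial>N)"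
      unfolding Lp_int_def by (intro nn_integral_cong) (auto simp: indicator_def)
    also have "\<dots> = emeasure N {y \<in> space N. (T i y \<in> A) \<noteq> (T' y \<in> A)}" by simp
    finally show ?thesis .
  qed
  with sets[OF indicator] show ?case by simp
next
  case (lin s f f')
  note [measurable] = Lp_measurable[OF lin(1)] Lp_measurable[OF lin(2)]
  \<comment> \<open>Compensates the quasi-triangle constant and the scalar; the extra factor 2 makes
    the final inequality strict.\<close>
  define d where "d = e / (2 * 2 powr r * (\<bar>s\<bar> powr r + 1))"
  have pos: "0 < 2 * 2 powr r * (\<bar>s\<bar> powr r + 1)" by (simp add: add_nonneg_pos)
  have d: "0 < d" using lin(5) pos by (simp add: d_def)
  from lin(3)[OF d] lin(4)[OF d] show ?case
  proof eventually_elim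
    case (elim i)
    have "Lp_int N r (\<lambda>y. s * f (T i y) + f' (T i y) - (s * f (T' y) + f' (T' y)))
        = Lp_int N r (\<lambda>y. s * (f (T i y) - f (T' y)) + (f' (T i y) - f' (T' y)))"
      by (simp add: algebra_simps)
    also have "\<dots> \<le> ennreal (2 powr r) * (Lp_int N r (\<lambda>y. s * (f (T i y) - f (T' y))) + Lp_int N r (\<lambda>y. f' (T i y) - f' (T' y)))"
      by (intro Lp_int_add_le r) auto
    also have "\<dots> = ennreal (2 powr r) * (ennreal (\<bar>s\<bar> powr r) * Lp_int N r (\<lambda>y. f (T i y) - f (T' y)) + Lp_int N r (\<lambda>y. f' (T i y) - f' (T' y)))"
      by (subst Lp_int_scale) auto
    also have "\<dots> \<le> ennreal (2 powr r) * (ennreal (\<bar>s\<bar> powr r) * ennreal d + ennreal d)"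
      using elim by (intro mult_left_mono add_mono) auto
    also have "\<dots> = ennreal (2 powr r * (\<bar>s\<bar> powr r + 1) * d)"
      using d by (simp flip: ennreal_mult ennreal_plus add: algebra_simps)
    also have "2 powr r * (\<bar>s\<bar> powr r + 1) * d = e / 2" using pos by (simp add: d_def field_simps)
    also have "ennreal (e / 2) < ennreal e" using lin(5) by (intro ennreal_lessI) auto
    finally show ?case .
  qed
next
  case (dense f)
  note [measurable] = Lp_measurable[OF dense(1)]
  define K where "K = 2 powr r"
  have K: "0 < K" by (simp add: K_def)
  \<comment> \<open>The quasi-triangle inequality is used twice and costs (K + 2 K^2) d, which is
    below 4 (K + 1)^2 d.\<close>
  define d where "d = e / (4 * (K + 1) * (K + 1))"
  have d: "0 < d" using dense(3) K by (simp add: d_def)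
  from dense(2)[of "ennreal d"] d obtain g where g: "g \<in> Lp N r"
    and IH: "\<And>e. 0 < e \<Longrightarrow> \<forall>\<^sub>F i in F. Lp_int N r (\<lambda>y. g (T i y) - g (T' y)) < ennreal e"
    and le: "Lp_int N r (\<lambda>x. f x - g x) < ennreal d" by auto
  note [measurable] = Lp_measurable[OF g]
  from IH[OF d] show ?case
  proof eventually_elim
    case (elim i)
    have m1: "Lp_int N r (\<lambda>y. f (T i y) - g (T i y)) = Lp_int N r (\<lambda>x. f x - g x)"
      using Lp_int_distr[OF T(1) _ mp(1), of "\<lambda>x. f x - g x"] by simp
    have m2: "Lp_int N r (\<lambda>y. g (T' y) - f (T' y)) = Lp_int N r (\<lambda>x. f x - g x)"
      using Lp_int_distr[OF T(2) _ mp(2), of "\<lambda>x. g x - f x"] Lp_int_minus_commute[of N r g f] by simp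
    have "Lp_int N r (\<lambda>y. f (T i y) - f (T' y))
      \<le> ennreal K * (Lp_int N r (\<lambda>y. f (T i y) - g (T i y)) + Lp_int N r (\<lambda>y. g (T i y) - f (T' y)))"
      unfolding K_def by (intro Lp_int_triangle r) auto
    also have "\<dots> \<le> ennreal K * (Lp_int N r (\<lambda>y. f (T i y) - g (T i y)) +
        ennreal K * (Lp_int N r (\<lambda>y. g (T i y) - g (T' y)) + Lp_int N r (\<lambda>y. g (T' y) - f (T' y))))"
      unfolding K_def by (intro mult_left_mono add_left_mono Lp_int_triangle r) auto
    also have "\<dots> \<le> ennreal K * (ennreal d + ennreal K * (ennreal d + ennreal d))"
      unfolding m1 m2 using le elim by (intro mult_left_mono add_mono) auto
    also have "\<dots> = ennreal (K * (d + K * (d + d)))"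
      using d K by (simp flip: ennreal_mult ennreal_plus)
    also have "\<dots> < ennreal e"
    proof (rule ennreal_lessI)
      have "K * (d + K * (d + d)) < (4 * (K + 1) * (K + 1)) * d"
        using d K by (simp add: algebra_simps add_pos_pos)
      also have "\<dots> = e" using K by (simp add: d_def)
      finally show "K * (d + K * (d + d)) < e" .
    qed (use dense(3) in auto)
    finally show ?case .
  qed
qed

section \<open>Continuous measure preserving actions and their affine Koopman actions\<close>

locale continuous_mp = sigma_finite_measure N for N :: "'y measure" +
  fixes \<sigma> :: "'g::topological_group_add \<Rightarrow> 'y \<Rightarrow> 'y"
  assumes act: "mp_action N \<sigma>"
    and set_cont: "\<And>A e g0. A \<in> sets N \<Longrightarrow> emeasure N A < \<infinity> \<Longrightarrow> 0 < e \<Longrightarrow>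
      \<forall>\<^sub>F g in nhds g0. emeasure N {y \<in> space N. (\<sigma> (- g) y \<in> A) \<noteq> (\<sigma> (- g0) y \<in> A)} < ennreal e"
begin

lemma \<sigma>_measurable [measurable]: "\<sigma> g \<in> measurable N N"
  and \<sigma>_distr: "distr N N (\<sigma> g) = N"
  and \<sigma>_0: "AE y in N. \<sigma> 0 y = y"
  and \<sigma>_add: "AE y in N. \<sigma> (g + g') y = \<sigma> g (\<sigma> g' y)"
  using act by (auto simp: mp_action_def)

lemma \<sigma>_inverse: "AE y in N. \<sigma> (- g) (\<sigma> g y) = y" "AE y in N. \<sigma> g (\<sigma> (- g) y) = y"
  using \<sigma>_add[of "- g" g] \<sigma>_add[of g "- g"] \<sigma>_0 by (auto elim: eventually_elim2)

lemma Lp_\<sigma>: "f \<in> borel_measurable N \<Longrightarrow> Lp_int N r (\<lambda>y. f (\<sigma> g y)) = Lp_int N r f"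
  by (rule Lp_int_distr[OF \<sigma>_measurable _ \<sigma>_distr])

lemma koopman_continuous:
  assumes "f \<in> Lp N r" "0 < r" "0 < e"
  shows "\<forall>\<^sub>F g in nhds g0. Lp_int N r (\<lambda>y. f (\<sigma> (- g) y) - f (\<sigma> (- g0) y)) < ennreal e"
  by (rule Lp_comp_continuous[OF _ _ _ _ set_cont assms]) (auto simp: \<sigma>_distr)

text \<open>If \<open>\<mu>\<close> has density f, its image under \<open>\<sigma> g\<close> has
  density f o \<open>\<sigma> (- g)\<close>. The total variation distance is at most the L_1
  distance of these densities, so strong continuity with exponent 1 applies.\<close>

lemma continuous_mp_action: "continuous_mp_action N \<sigma>"
  unfolding continuous_mp_action_def
proof (intro conjI act allI impI)
  fix \<mu> and g0 :: 'g and \<epsilon> :: real assume \<mu>: "equiv_prob N \<mu>" and \<epsilon>: "0 < \<epsilon>"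
  interpret \<mu>: prob_space \<mu> using \<mu> by (simp add: equiv_prob_def)
  have sets_\<mu>: "sets \<mu> = sets N" using \<mu> by (simp add: equiv_prob_def)
  have "absolutely_continuous N \<mu>"
    using \<mu> by (auto simp: absolutely_continuous_def null_sets_def equiv_prob_def)
  then have dens: "density N (RN_deriv N \<mu>) = \<mu>" using sets_\<mu> by (intro density_RN_deriv)
  have "AE y in N. RN_deriv N \<mu> y \<noteq> \<infinity>"
    using \<open>absolutely_continuous N \<mu>\<close> sets_\<mu> by (intro RN_deriv_finite \<mu>.sigma_finite_measure_axioms)
  define f where "f y = enn2real (RN_deriv N \<mu> y)" for y
  have [measurable]: "f \<in> borel_measurable N" unfolding f_def by measurable
  have "density N (\<lambda>y. ennreal (f y)) = density N (RN_deriv N \<mu>)"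
    using \<open>AE y in N. RN_deriv N \<mu> y \<noteq> \<infinity>\<close> by (intro density_cong) (auto elim!: eventually_mono simp: f_def less_top)
  with dens have \<mu>_eq: "\<mu> = density N (\<lambda>y. ennreal (f y))" by simp
  have f0: "0 \<le> f y" for y by (simp add: f_def)
  have "(\<integral>\<^sup>+y. ennreal (f y) \<partial>N) = emeasure \<mu> (space \<mu>)"
    unfolding \<mu>_eq by (simp add: emeasure_density cong: nn_integral_cong)
  then have f1: "(\<integral>\<^sup>+y. ennreal (f y) \<partial>N) = 1" using \<mu>.emeasure_space_1 by simp
  then have f_int: "integrable N f" using f0 by (intro integrableI_nonneg) auto
  have "f \<in> Lp N 1" using f1 f0 by (auto simp: Lp_def Lp_int_def)
  have f\<sigma>_int: "integrable N (\<lambda>y. f (\<sigma> g y))" for g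
    using f_int by (intro integrable_distr[OF \<sigma>_measurable]) (simp add: \<sigma>_distr)
  have meas: "measure (distr \<mu> N (\<sigma> g)) A = (\<integral>y. f (\<sigma> (- g) y) * indicator A y \<partial>N)" if [measurable]: "A \<in> sets N" for g A
  proof -
    have [measurable]: "\<sigma> g \<in> measurable \<mu> N" unfolding measurable_cong_sets[OF sets_\<mu> refl] by measurable
    have "measure (distr \<mu> N (\<sigma> g)) A = (\<integral>y. indicator A (\<sigma> g y) \<partial>\<mu>)"
    proof -
      have "measure (distr \<mu> N (\<sigma> g)) A = (\<integral>y. indicator A y \<partial>distr \<mu> N (\<sigma> g))" by simp
      also have "\<dots> = (\<integral>y. indicator A (\<sigma> g y) \<partial>\<mu>)" by (rule integral_distr) auto
      finally show ?thesis .
    qed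
    also have "\<dots> = (\<integral>y. f y * indicator A (\<sigma> g y) \<partial>N)"
      unfolding \<mu>_eq using f0 by (subst integral_real_density) auto
    also have "\<dots> = (\<integral>y. f (\<sigma> (- g) (\<sigma> g y)) * indicator A (\<sigma> g y) \<partial>N)"
      by (intro integral_cong_AE) (use \<sigma>_inverse(1)[of g] in \<open>auto elim!: eventually_mono\<close>)
    also have "\<dots> = (\<integral>y. f (\<sigma> (- g) y) * indicator A y \<partial>distr N N (\<sigma> g))"
      by (subst integral_distr) auto
    finally show ?thesis by (simp add: \<sigma>_distr)
  qed
  \<comment> \<open>One half of the target, because the supremum over all sets turns the strict
    inequality into a weak one.\<close>
  have "\<forall>\<^sub>F g in nhds g0. Lp_int N 1 (\<lambda>y. f (\<sigma> (- g) y) - f (\<sigma> (- g0) y)) < ennreal (\<epsilon> / 2)"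
    using \<open>f \<in> Lp N 1\<close> \<epsilon> by (intro koopman_continuous) auto
  then show "\<forall>\<^sub>F g in nhds g0. tv_dist (distr \<mu> N (\<sigma> g)) (distr \<mu> N (\<sigma> g0)) < \<epsilon>"
  proof eventually_elim
    case (elim g)
    let ?d = "\<lambda>y. f (\<sigma> (- g) y) - f (\<sigma> (- g0) y)"
    have d_int: "integrable N ?d" by (intro Bochner_Integration.integrable_diff f\<sigma>_int)
    have "ennreal (\<integral>y. \<bar>?d y\<bar> \<partial>N) = (\<integral>\<^sup>+y. ennreal \<bar>?d y\<bar> \<partial>N)"
      using d_int by (intro nn_integral_eq_integral[symmetric]) auto
    also have "\<dots> = Lp_int N 1 ?d" by (simp add: Lp_int_def)
    finally have "ennreal (\<integral>y. \<bar>?d y\<bar> \<partial>N) < ennreal (\<epsilon> / 2)" using elim by simp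
    then have lt: "(\<integral>y. \<bar>?d y\<bar> \<partial>N) < \<epsilon> / 2"
      by (subst (asm) ennreal_less_iff) (auto intro: integral_nonneg_AE)
    have bd: "\<bar>measure (distr \<mu> N (\<sigma> g)) A - measure (distr \<mu> N (\<sigma> g0)) A\<bar> \<le> (\<integral>y. \<bar>?d y\<bar> \<partial>N)"
      if A[measurable]: "A \<in> sets N" for A
    proof -
      have i: "integrable N (\<lambda>y. f (\<sigma> g y) * indicator A y)" for g
        using f\<sigma>_int by (intro integrable_real_mult_indicator A) 
      have "measure (distr \<mu> N (\<sigma> g)) A - measure (distr \<mu> N (\<sigma> g0)) A = (\<integral>y. ?d y * indicator A y \<partial>N)"
        unfolding meas[OF A] left_diff_distrib by (intro Bochner_Integration.integral_diff[symmetric] i)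
      also have "\<bar>\<dots>\<bar> \<le> (\<integral>y. \<bar>?d y * indicator A y\<bar> \<partial>N)"
        by (rule integral_abs_bound)
      also have "\<dots> \<le> (\<integral>y. \<bar>?d y\<bar> \<partial>N)"
      proof (rule integral_mono)
        show "integrable N (\<lambda>y. \<bar>?d y * indicator A y\<bar>)"
          using d_int by (intro integrable_abs integrable_real_mult_indicator A)
      qed (use d_int in \<open>auto simp: abs_mult indicator_def\<close>)
      finally show ?thesis .
    qed
    have "tv_dist (distr \<mu> N (\<sigma> g)) (distr \<mu> N (\<sigma> g0)) \<le> \<epsilon> / 2"
      unfolding tv_dist_def
    proof (rule cSUP_least)
      fix A assume "A \<in> sets (distr \<mu> N (\<sigma> g))"
      then show "\<bar>measure (distr \<mu> N (\<sigma> g)) A - measure (distr \<mu> N (\<sigma> g0)) A\<bar> \<le> \<epsilon> / 2"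
        using bd[of A] lt by simp
    qed auto
    with \<epsilon> show ?case by simp
  qed
qed

text \<open>The translation part is a formal coboundary of \<open>h\<close>, so the cocycle identity
  holds almost everywhere for free. Its continuity is read off from \<open>\<psi>\<close>: the
  difference of the translations at g and g0 is the translation at -g0 + g composed with
  \<open>\<sigma> (- g0)\<close>, so its integral is \<open>\<psi> (- g0 + g)\<close>, which tends
  to \<open>\<psi> 0\<close> = 0.\<close>

lemma koopman_cocycle_Kp:
  assumes std: "standard_measure_space N" and q: "0 < q"
    and h[measurable]: "h \<in> borel_measurable N"
    and b_Lp: "\<And>g. (\<lambda>y. h (\<sigma> (- g) y) - h y) \<in> Lp N q"
    and \<psi>: "\<And>g. \<psi> g = enn2real (Lp_int N q (\<lambda>y. h (\<sigma> (- g) y) - h y))"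
    and cont: "continuous_on UNIV \<psi>"
  shows "\<psi> \<in> Kp TYPE('y) q"
proof -
  define b where "b g y = h (\<sigma> (- g) y) - h y" for g y
  define \<alpha> where "\<alpha> g f y = f (\<sigma> (- g) y) + b g y" for g and f :: "'y \<Rightarrow> real" and y
  have bL: "b g \<in> Lp N q" for g using b_Lp[of g] by (simp add: b_def[abs_def])
  have f\<sigma>: "(\<lambda>y. f (\<sigma> g y)) \<in> Lp N q" if f: "f \<in> Lp N q" for f g
  proof -
    note [measurable] = Lp_measurable[OF f]
    show ?thesis using f Lp_\<sigma>[of f q g] by (simp add: Lp_def)
  qed
  have \<alpha>L: "\<alpha> g f \<in> Lp N q" if "f \<in> Lp N q" for g f
    unfolding \<alpha>_def by (intro Lp_add q f\<sigma> bL that)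
  have \<psi>b: "Lp_int N q (b g) = ennreal (\<psi> g)" for g
    using bL[of g] \<psi>[of g] by (simp add: Lp_def b_def[abs_def] less_top)
  have aff: "affine_isometric_action q N \<alpha>"
    unfolding affine_isometric_action_def
  proof (intro conjI allI impI)
    fix g g' :: 'g and f f' :: "'y \<Rightarrow> real" and t :: real
    show "AE x in N. \<alpha> g (\<lambda>y. t * f y + (1 - t) * f' y) x = t * \<alpha> g f x + (1 - t) * \<alpha> g f' x"
      by (simp add: \<alpha>_def algebra_simps)
    assume f: "f \<in> Lp N q"
    note [measurable] = Lp_measurable[OF f]
    show "\<alpha> g f \<in> Lp N q" by (rule \<alpha>L[OF f])
    show "\<exists>f'\<in>Lp N q. AE x in N. \<alpha> g f' x = f x"
    proof (rule bexI)
      show "(\<lambda>y. f (\<sigma> g y) - b g (\<sigma> g y)) \<in> Lp N q" by (intro Lp_diff q f\<sigma> f bL)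
      show "AE x in N. \<alpha> g (\<lambda>y. f (\<sigma> g y) - b g (\<sigma> g y)) x = f x"
        using \<sigma>_inverse(2)[of g] by eventually_elim (simp add: \<alpha>_def)
    qed
    show "AE x in N. \<alpha> 0 f x = f x"
      using \<sigma>_0 by eventually_elim (simp add: \<alpha>_def b_def)
    show "AE x in N. \<alpha> (g + g') f x = \<alpha> g (\<alpha> g' f) x"
      using \<sigma>_add[of "- g'" "- g"] by eventually_elim (simp add: \<alpha>_def b_def minus_add)
    assume f': "f' \<in> Lp N q"
    note [measurable] = Lp_measurable[OF f']
    have "Lp_int N q (\<lambda>x. \<alpha> g f x - \<alpha> g f' x) = Lp_int N q (\<lambda>x. f x - f' x)"
      using Lp_\<sigma>[of "\<lambda>x. f x - f' x" q "- g"] by (simp add: \<alpha>_def)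
    then show "Lp_dist N q (\<alpha> g f) (\<alpha> g f') = Lp_dist N q f f'"
      by (simp add: Lp_dist_def Lp_norm_def)
  qed
  have "\<forall>\<^sub>F g in nhds g0. Lp_dist N q (\<alpha> g f) (\<alpha> g0 f) < \<epsilon>" if f: "f \<in> Lp N q" and \<epsilon>: "0 < \<epsilon>" for f g0 \<epsilon>
  proof -
    note [measurable] = Lp_measurable[OF f]
    \<comment> \<open>The threshold on \<open>Lp_int\<close> that corresponds to \<epsilon> for
      \<open>Lp_dist\<close>, which is a q-th root unless q < 1.\<close>
    define e where "e = (if q < 1 then \<epsilon> else \<epsilon> powr q)"
    have e: "0 < e" using \<epsilon> by (simp add: e_def)
    define d where "d = e / (2 * 2 powr q)"
    have d: "0 < d" using e by (simp add: d_def)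
    have \<psi>0: "\<psi> 0 = 0"
    proof -
      have "AE y in N. b 0 y = 0" using \<sigma>_0 by eventually_elim (simp add: b_def)
      then have "Lp_int N q (b 0) = 0" using Lp_measurable[OF bL] by (simp add: Lp_int_eq_0_iff)
      then show ?thesis using \<psi>[of 0] by (simp add: b_def[abs_def])
    qed
    have "((\<lambda>g. - g0 + g) \<longlongrightarrow> - g0 + g0) (nhds g0)"
      by (intro tendsto_add tendsto_const filterlim_ident)
    then have "((\<lambda>g. \<psi> (- g0 + g)) \<longlongrightarrow> \<psi> (- g0 + g0)) (nhds g0)"
      by (rule continuous_on_tendsto_compose[OF cont]) auto
    then have "\<forall>\<^sub>F g in nhds g0. \<psi> (- g0 + g) < d"
      using d \<psi>0 by (intro order_tendstoD(2)[of _ "\<psi> (- g0 + g0)"]) auto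
    moreover have "\<forall>\<^sub>F g in nhds g0. Lp_int N q (\<lambda>y. f (\<sigma> (- g) y) - f (\<sigma> (- g0) y)) < ennreal d"
      by (rule koopman_continuous[OF f q d])
    ultimately show ?thesis
    proof eventually_elim
      case (elim g)
      have "- (- g0 + g) + - g0 = - g" by (simp add: minus_add add.assoc)
      with \<sigma>_add[of "- (- g0 + g)" "- g0"]
      have "AE y in N. \<sigma> (- g) y = \<sigma> (- (- g0 + g)) (\<sigma> (- g0) y)" by simp
      then have "AE y in N. b g y - b g0 y = b (- g0 + g) (\<sigma> (- g0) y)"
        by eventually_elim (simp add: b_def)
      then have "Lp_int N q (\<lambda>y. b g y - b g0 y) = Lp_int N q (\<lambda>y. b (- g0 + g) (\<sigma> (- g0) y))"
        by (rule Lp_int_cong_AE)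
      also have "\<dots> = ennreal (\<psi> (- g0 + g))" using Lp_\<sigma>[OF Lp_measurable[OF bL]] by (simp add: \<psi>b)
      also have "\<dots> < ennreal d" using elim(1) d by (intro ennreal_lessI)
      finally have b: "Lp_int N q (\<lambda>y. b g y - b g0 y) < ennreal d" .
      have "Lp_int N q (\<lambda>y. \<alpha> g f y - \<alpha> g0 f y)
          = Lp_int N q (\<lambda>y. (f (\<sigma> (- g) y) - f (\<sigma> (- g0) y)) + (b g y - b g0 y))"
        by (simp add: \<alpha>_def algebra_simps)
      also have "\<dots> \<le> ennreal (2 powr q) * (Lp_int N q (\<lambda>y. f (\<sigma> (- g) y) - f (\<sigma> (- g0) y)) + Lp_int N q (\<lambda>y. b g y - b g0 y))"
        by (intro Lp_int_add_le q borel_measurable_diff Lp_measurable[OF f\<sigma>] Lp_measurable[OF bL] f)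
      also have "\<dots> < ennreal (2 powr q) * (ennreal d + ennreal d)"
        using elim(2) b by (intro ennreal_mult_strict_left_mono add_strict_mono) auto
      also have "\<dots> = ennreal e"
        using d by (simp flip: ennreal_mult ennreal_plus add: d_def)
      finally have I: "enn2real (Lp_int N q (\<lambda>y. \<alpha> g f y - \<alpha> g0 f y)) < e"
        using e by (metis enn2real_less_iff enn2real_nonneg ennreal_less_top less_trans ennreal_enn2real enn2real_leI not_le ennreal_less_iff)
      show ?case
      proof (cases "q < 1")
        case False
        have "enn2real (Lp_int N q (\<lambda>y. \<alpha> g f y - \<alpha> g0 f y)) powr (1 / q) < e powr (1 / q)"
          using I q by (intro powr_less_mono2) auto
        also have "\<dots> = \<epsilon>" using False \<epsilon> q by (simp add: e_def powr_powr)
        finally show ?thesis using False by (simp add: Lp_dist_def Lp_norm_def)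
      qed (use I in \<open>simp add: Lp_dist_def e_def\<close>)
    qed
  qed
  with aff have "continuous_affine_isometric_action q N \<alpha>"
    by (auto simp: continuous_affine_isometric_action_def)
  moreover have "\<psi> g = Lp_norm N q (\<alpha> g (\<lambda>_. 0)) powr q" for g
    using \<psi>[of g] q by (simp add: \<alpha>_def[abs_def] b_def[abs_def] Lp_norm_def powr_powr)
  moreover have "sigma_finite_standard N"
    using std by (simp add: sigma_finite_standard_def sigma_finite_measure_axioms)
  moreover have "0 \<le> \<psi> g" for g by (simp add: \<psi>)
  ultimately show ?thesis using cont unfolding Kp_def by blast
qed

end

section \<open>Transport to the real line and realization of a skew system\<close>

lemma standard_measure_space_borel_real:
  assumes "sets N = sets (borel :: real measure)"
  shows "standard_measure_space N"
proof -
  have "Polish_space (euclidean :: real topology)"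
  proof -
    have "separable_space (euclidean :: real topology)"
      unfolding separable_space_def using countable_rat Rats_closure_real by (intro exI[of _ "\<rat>"]) auto
    then show ?thesis by (simp add: Polish_space_def completely_metrizable_space_euclidean)
  qed
  moreover have "sets (borel_of (euclidean :: real topology)) = sets borel"
    by (simp add: borel_of_def borel_def)
  ultimately show ?thesis
    using assms sets_eq_imp_space_eq[OF assms]
    unfolding standard_measure_space_def by (intro exI[of _ euclidean]) simp
qed

theorem transport_to_real:
  fixes \<nu> :: "'y::{second_countable_topology, complete_space} measure"
    and \<tau> :: "'g::topological_group_add \<Rightarrow> 'y \<Rightarrow> 'y"
  assumes q: "0 < q"
    and sets_\<nu>[measurable_cong]: "sets \<nu> = sets borel" and sf: "sigma_finite_measure \<nu>"
    and \<tau>[measurable]: "\<And>g. \<tau> g \<in> borel_measurable borel"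
    and mp: "\<And>g A. A \<in> sets borel \<Longrightarrow> emeasure \<nu> (\<tau> g -` A) = emeasure \<nu> A"
    and \<tau>_0: "AE y in \<nu>. \<tau> 0 y = y"
    and \<tau>_add: "\<And>g g'. AE y in \<nu>. \<tau> (g + g') y = \<tau> g' (\<tau> g y)"
    and \<tau>_cont: "\<And>A e g0. A \<in> sets borel \<Longrightarrow> emeasure \<nu> A < \<infinity> \<Longrightarrow> 0 < e \<Longrightarrow>
        \<forall>\<^sub>F g in nhds g0. emeasure \<nu> {y. (\<tau> g y \<in> A) \<noteq> (\<tau> g0 y \<in> A)} < ennreal e"
    and h[measurable]: "h \<in> borel_measurable borel" and h_bounded: "\<And>y. \<bar>h y\<bar> \<le> 1"
    and \<psi>: "\<And>g. (\<integral>\<^sup>+y. ennreal (\<bar>h (\<tau> g y) - h y\<bar> powr q) \<partial>\<nu>) = ennreal (\<psi> g)"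
    and \<psi>_nonneg: "\<And>g. 0 \<le> \<psi> g" and \<psi>_cont: "continuous_on UNIV \<psi>"
  shows "\<exists>(N::real measure) \<sigma> h.
           sigma_finite_standard N \<and> continuous_mp_action N \<sigma> \<and> h \<in> Linf N \<and>
           (\<forall>g. (\<lambda>y. koopman \<sigma> g h y - h y) \<in> Lp N q \<and>
                \<psi> g = Lp_norm N q (\<lambda>y. koopman \<sigma> g h y - h y) powr q)
         \<and> \<psi> \<in> Kp TYPE(real) q"
proof -
  obtain j :: "'y \<Rightarrow> real" and k where j[measurable]: "j \<in> borel_measurable borel"
    and k[measurable]: "k \<in> borel_measurable borel" and kj[simp]: "\<And>y. k (j y) = y"
    by (rule borel_code) blast
  define N where "N = distr \<nu> borel j"
  \<comment> \<open>Since \<open>\<tau>\<close> acts on the right, passing to \<open>- g\<close>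
    turns it into an action on the left; the Koopman operator of \<open>\<sigma>\<close> at g is
    then composition with the conjugate of \<open>\<tau> g\<close>.\<close>
  define \<sigma> where "\<sigma> g z = j (\<tau> (- g) (k z))" for g z
  define H where "H z = h (k z)" for z
  have sp\<nu>: "space \<nu> = UNIV" using sets_eq_imp_space_eq[OF sets_\<nu>] by simp
  have sets_N[measurable_cong]: "sets N = sets borel" by (simp add: N_def)
  have spN: "space N = UNIV" by (simp add: N_def)
  have jm: "j \<in> measurable \<nu> borel" by (simp add: measurable_cong_sets[OF sets_\<nu> refl])
  have vim: "T -` A \<in> sets borel" if "T \<in> borel_measurable borel" "A \<in> sets borel" for T :: "'y \<Rightarrow> 'c::topological_space" and A
    using measurable_sets[OF that] by simp
  have emeasure_N: "emeasure N A = emeasure \<nu> (j -` A)" if "A \<in> sets borel" for A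
    using that by (simp add: N_def emeasure_distr[OF jm] sp\<nu>)
  have \<sigma>m[measurable]: "\<sigma> g \<in> measurable N N" for g
    unfolding \<sigma>_def by measurable
  have AE_N: "(AE z in N. f z = f' z) \<longleftrightarrow> (AE y in \<nu>. f (j y) = f' (j y))"
    if [measurable]: "f \<in> borel_measurable borel" "f' \<in> borel_measurable borel" for f f' :: "real \<Rightarrow> real"
    unfolding N_def by (subst AE_distr_iff[OF jm]) auto
  interpret sigma_finite_measure \<nu> by (rule sf)
  have sfN: "sigma_finite_measure N"
  proof
    \<comment> \<open>An image measure can lose sigma-finiteness. Here the preimages of the covering
      sets under the left inverse \<open>k\<close> form a cover, and pulling them back along
      \<open>j\<close> returns the original sets.\<close>
    obtain A :: "'y set set" where A: "countable A" "A \<subseteq> sets \<nu>" "\<Union>A = space \<nu>" "\<forall>a\<in>A. emeasure \<nu> a \<noteq> \<infinity>"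
      using sigma_finite_countable by blast
    have kA: "k -` a \<in> sets borel" if "a \<in> A" for a
      using measurable_sets[OF k, of a] that A(2) sets_\<nu> by auto
    show "\<exists>A. countable A \<and> A \<subseteq> sets N \<and> \<Union>A = space N \<and> (\<forall>a\<in>A. emeasure N a \<noteq> \<infinity>)"
    proof (intro exI[of _ "(\<lambda>a. k -` a) ` A"] conjI)
      show "countable ((\<lambda>a. k -` a) ` A)" using A by simp
      show "(\<lambda>a. k -` a) ` A \<subseteq> sets N" using kA sets_N by auto
      show "\<Union> ((\<lambda>a. k -` a) ` A) = space N" using A(3) by (auto simp: spN sp\<nu>)
      show "\<forall>a\<in>(\<lambda>a. k -` a) ` A. emeasure N a \<noteq> \<infinity>"
      proof safe
        fix a assume a: "a \<in> A" "emeasure N (k -` a) = \<infinity>"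
        have "j -` k -` a = a" by auto
        with a A(4) show False by (auto simp: emeasure_N[OF kA])
      qed
    qed
  qed
  have "mp_action N \<sigma>"
    unfolding mp_action_def
  proof (intro conjI allI)
    fix g g' :: 'g
    show "\<sigma> g \<in> measurable N N" by measurable
    show "distr N N (\<sigma> g) = N"
    proof (rule measure_eqI)
      fix A assume "A \<in> sets (distr N N (\<sigma> g))"
      then have A: "A \<in> sets borel" by (simp add: sets_N)
      have \<sigma>A: "\<sigma> g -` A \<in> sets borel" using measurable_sets[OF \<sigma>m, of A g] A by (simp add: sets_N spN)
      have "emeasure (distr N N (\<sigma> g)) A = emeasure N (\<sigma> g -` A)"
        using A by (subst emeasure_distr) (auto simp: sets_N spN)
      also have "\<dots> = emeasure \<nu> (\<tau> (- g) -` (j -` A))"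
        unfolding emeasure_N[OF \<sigma>A] by (intro arg_cong[where f="emeasure \<nu>"]) (auto simp: \<sigma>_def)
      also have "\<dots> = emeasure N A" using mp[OF vim[OF j A]] emeasure_N[OF A] by simp
      finally show "emeasure (distr N N (\<sigma> g)) A = emeasure N A" .
    qed simp
    have [measurable]: "\<sigma> g \<in> borel_measurable borel" for g unfolding \<sigma>_def by measurable
    show "AE z in N. \<sigma> 0 z = z"
      using \<tau>_0 by (subst AE_N) (auto simp: \<sigma>_def elim!: eventually_mono)
    show "AE z in N. \<sigma> (g + g') z = \<sigma> g (\<sigma> g' z)"
      using \<tau>_add[of "- g'" "- g"] by (subst AE_N) (auto simp: \<sigma>_def minus_add elim!: eventually_mono)
  qed
  moreover have "\<forall>\<^sub>F g in nhds g0. emeasure N {z \<in> space N. (\<sigma> (- g) z \<in> A) \<noteq> (\<sigma> (- g0) z \<in> A)} < ennreal e"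
    if A: "A \<in> sets N" and fin: "emeasure N A < \<infinity>" and e: "0 < e" for A e g0
  proof -
    have Ab: "A \<in> sets borel" using A by (simp add: sets_N)
    have "emeasure N {z \<in> space N. (\<sigma> (- g) z \<in> A) \<noteq> (\<sigma> (- g0) z \<in> A)}
        = emeasure \<nu> {y. (\<tau> g y \<in> j -` A) \<noteq> (\<tau> g0 y \<in> j -` A)}" for g
    proof -
      have "{z \<in> space N. (\<sigma> (- g) z \<in> A) \<noteq> (\<sigma> (- g0) z \<in> A)} \<in> sets N" using A by measurable
      then show ?thesis
        by (subst emeasure_N) (auto simp: sets_N spN \<sigma>_def intro!: arg_cong[where f="emeasure \<nu>"])
    qed
    with \<tau>_cont[OF vim[OF j Ab] _ e] fin emeasure_N[OF Ab] show ?thesis by simp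
  qed
  ultimately interpret N: continuous_mp N \<sigma>
    by (intro continuous_mp.intro continuous_mp_axioms.intro sfN) auto
  have std: "standard_measure_space N" by (rule standard_measure_space_borel_real[OF sets_N])
  have [measurable]: "H \<in> borel_measurable borel" unfolding H_def by measurable
  have HN[measurable]: "H \<in> borel_measurable N" by measurable
  have int: "Lp_int N q (\<lambda>z. H (\<sigma> (- g) z) - H z) = ennreal (\<psi> g)" for g
  proof -
    have "Lp_int N q (\<lambda>z. H (\<sigma> (- g) z) - H z) = (\<integral>\<^sup>+y. ennreal (\<bar>H (\<sigma> (- g) (j y)) - H (j y)\<bar> powr q) \<partial>\<nu>)"
      unfolding Lp_int_def N_def \<sigma>_def by (subst nn_integral_distr[OF jm]) auto
    then show ?thesis by (simp add: \<sigma>_def H_def \<psi>)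
  qed
  have bL: "(\<lambda>z. H (\<sigma> (- g) z) - H z) \<in> Lp N q" for g
    unfolding Lp_def using int[of g] by auto
  have \<psi>_eq: "\<psi> g = enn2real (Lp_int N q (\<lambda>z. H (\<sigma> (- g) z) - H z))" for g
    using int[of g] \<psi>_nonneg[of g] by simp
  have "\<psi> \<in> Kp TYPE(real) q"
    by (rule N.koopman_cocycle_Kp[OF std q HN bL \<psi>_eq \<psi>_cont])
  moreover have "H \<in> Linf N" unfolding Linf_def using h_bounded by (auto simp: H_def intro!: exI[of _ 1])
  moreover have "sigma_finite_standard N" using std sfN by (simp add: sigma_finite_standard_def)
  moreover have "\<psi> g = Lp_norm N q (\<lambda>z. koopman \<sigma> g H z - H z) powr q" for g
    using \<psi>_eq[of g] q by (simp add: Lp_norm_def powr_powr koopman_def)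
  moreover have "(\<lambda>z. koopman \<sigma> g H z - H z) \<in> Lp N q" for g
    using bL by (simp add: koopman_def)
  ultimately show ?thesis using N.continuous_mp_action by blast
qed

theorem skew_system_realization:
  fixes M :: "'a::{second_countable_topology, complete_space} measure"
    and b :: "'g::topological_group_add \<Rightarrow> 'a \<Rightarrow> real"
  assumes "skew_system M p S c b" and q: "p < q"
    and \<psi>: "\<And>g. Lp_int M p (b g) = ennreal (\<psi> g)"
    and \<psi>_nonneg: "\<And>g. 0 \<le> \<psi> g" and \<psi>_cont: "continuous_on UNIV \<psi>"
  shows "\<exists>(N::real measure) \<sigma> h.
           sigma_finite_standard N \<and> continuous_mp_action N \<sigma> \<and> h \<in> Linf N \<and>
           (\<forall>g. (\<lambda>y. koopman \<sigma> g h y - h y) \<in> Lp N q \<and>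
                \<psi> g = Lp_norm N q (\<lambda>y. koopman \<sigma> g h y - h y) powr q)
         \<and> \<psi> \<in> Kp TYPE(real) q"
proof -
  interpret skew_system M p S c b by fact
  \<comment> \<open>The normalisation turns the energy of a fibre with cocycle value \<beta> into
    exactly |\<beta>|^p; the energy is finite and positive.\<close>
  define K where "K = 1 / enn2real (tent_energy p q 1)"
  have fin: "tent_energy p q 1 < \<infinity>" using p_pos q by (rule tent_energy_finite)
  have pos: "0 < enn2real (tent_energy p q 1)"
    using fin tent_energy_pos[of p q] by (simp add: enn2real_positive_iff)
  then have K: "0 < K" by (simp add: K_def)
  have "ennreal K * tent_energy p q 1 = ennreal K * ennreal (enn2real (tent_energy p q 1))"
    using fin by simp
  also have "\<dots> = 1" using pos by (simp add: K_def ennreal_mult[symmetric])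
  finally have norm: "ennreal K * tent_energy p q 1 = 1" .
  interpret P: skew_product M p S c b K by standard (rule K)
  show ?thesis
    using p_pos q
    by (intro transport_to_real[where \<nu>=P.\<nu> and \<tau>=P.\<tau> and h=P.h] P.sets_\<nu> P.sigma_finite_\<nu> P.\<tau>_measurable
        P.emeasure_\<tau> P.\<tau>_0 P.\<tau>_add P.\<tau>_continuous P.h_measurable P.h_bounded \<psi>_nonneg \<psi>_cont)
       (auto simp: P.h_energy[OF norm] \<psi>)
qed

section \<open>Characteristic functions determine product laws\<close>

lemma integral_indicator_complex:
  assumes "A \<in> sets M"
  shows "(\<integral>x. indicator A x \<partial>M) = complex_of_real (measure M A)"
proof -
  have "(\<integral>x. indicator A x \<partial>M) = (\<integral>x. complex_of_real (indicator A x) \<partial>M)"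
    by (intro Bochner_Integration.integral_cong refl) (simp add: indicator_def)
  also have "\<dots> = complex_of_real (\<integral>x. indicator A x \<partial>M)" by (rule integral_complex_of_real)
  also have "\<dots> = complex_of_real (measure M A)"
    using sets.sets_into_space[OF assms] by (simp add: Int_absorb2)
  finally show ?thesis .
qed

lemma (in prob_space) iexp_integrable:
  assumes [measurable]: "X \<in> borel_measurable M" "W \<in> borel_measurable M" and "\<And>x. norm (W x) \<le> B"
  shows "integrable M (\<lambda>x. (W x :: complex) * iexp (X x))"
  using assms(3) by (intro integrable_const_bound[where B=B]) (auto simp: norm_mult)

lemma (in prob_space) char_distr_eq:
  assumes [measurable]: "X \<in> borel_measurable M"
  shows "char (distr M borel X) t = expectation (\<lambda>x. iexp (t * X x))"
  unfolding char_def by (subst integral_distr) auto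

text \<open>Shifting the bounded weight by 2 makes it positive, so (2 + V) / (2 + a) is a
  probability density. Under the tilted measure X has the characteristic function of
  \<open>\<mu>\<close>, hence the law \<open>\<mu>\<close>. Subtracting the share of the constant 2,
  known from \<open>law\<close>, isolates V.\<close>

lemma (in prob_space) weighted_char_unique_real:
  assumes X[measurable]: "X \<in> borel_measurable M" and V[measurable]: "V \<in> borel_measurable M"
    and V_le: "\<And>x. \<bar>V x\<bar> \<le> 1" and \<mu>: "real_distribution \<mu>" and law: "distr M borel X = \<mu>"
    and eq: "\<And>s. expectation (\<lambda>x. complex_of_real (V x) * iexp (s * X x)) = complex_of_real a * char \<mu> s"
    and A[measurable]: "A \<in> sets borel"
  shows "expectation (\<lambda>x. V x * indicator A (X x)) = a * measure \<mu> A"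
proof -
  interpret \<mu>: real_distribution \<mu> by fact
  have V_int: "integrable M V" using V_le by (intro integrable_const_bound[where B=1]) auto
  have "complex_of_real (expectation V) = complex_of_real a"
    using eq[of 0] by (simp add: \<mu>.char_zero)
  then have a: "expectation V = a" by simp
  have "\<bar>a\<bar> \<le> expectation (\<lambda>x. \<bar>V x\<bar>)" unfolding a[symmetric] by (rule integral_abs_bound)
  also have "\<dots> \<le> expectation (\<lambda>x. 1)" using V_int V_le by (intro integral_mono) auto
  finally have a_le: "\<bar>a\<bar> \<le> 1" by (simp add: prob_space)
  define w where "w x = (2 + V x) / (2 + a)" for x
  have [measurable]: "w \<in> borel_measurable M" unfolding w_def by measurable
  have Vge: "- 1 \<le> V x" for x using V_le[of x] by auto
  have w0: "0 \<le> w x" for x using Vge[of x] a_le by (auto simp: w_def intro!: divide_nonneg_nonneg)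
  have w_int: "integrable M w" unfolding w_def using V_int by auto
  have w1: "expectation w = 1" unfolding w_def using V_int a a_le by (simp add: prob_space)
  define Q where "Q = density M (\<lambda>x. ennreal (w x))"
  have [measurable_cong]: "sets Q = sets M" by (simp add: Q_def)
  have "emeasure Q (space Q) = (\<integral>\<^sup>+x. ennreal (w x) \<partial>M)"
    by (simp add: Q_def emeasure_density cong: nn_integral_cong)
  also have "\<dots> = ennreal (expectation w)" using w_int w0 by (intro nn_integral_eq_integral) auto
  finally interpret Q: prob_space Q by (intro prob_spaceI) (simp add: w1)
  have XQ[measurable]: "X \<in> borel_measurable Q" by measurable
  have "char (distr Q borel X) s = char \<mu> s" for s
  proof -
    have e: "integrable M (\<lambda>x. iexp (s * X x))" using iexp_integrable[of "\<lambda>x. s * X x" "\<lambda>_. 1" 1] by simp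
    have Ve: "integrable M (\<lambda>x. complex_of_real (V x) * iexp (s * X x))"
      using V_le by (intro iexp_integrable[where B=1]) auto
    have "char (distr Q borel X) s = (\<integral>x. iexp (s * X x) \<partial>Q)" by (rule Q.char_distr_eq) measurable
    also have "\<dots> = expectation (\<lambda>x. w x *\<^sub>R iexp (s * X x))"
      unfolding Q_def using w0 by (subst integral_density) auto
    also have "\<dots> = expectation (\<lambda>x. (1 / complex_of_real (2 + a)) * (2 * iexp (s * X x) + complex_of_real (V x) * iexp (s * X x)))"
      by (intro Bochner_Integration.integral_cong) (auto simp: w_def scaleR_conv_of_real algebra_simps add_divide_distrib)
    also have "\<dots> = (1 / complex_of_real (2 + a)) * (2 * expectation (\<lambda>x. iexp (s * X x)) + complex_of_real a * char \<mu> s)"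
      using e Ve by (simp add: eq[simplified])
    also have "expectation (\<lambda>x. iexp (s * X x)) = char \<mu> s" using char_distr_eq[OF X, of s] law by simp
    also have "(1 / complex_of_real (2 + a)) * (2 * char \<mu> s + complex_of_real a * char \<mu> s) = char \<mu> s"
    proof -
      have "complex_of_real (2 + a) \<noteq> 0" using a_le by (subst of_real_eq_0_iff) auto
      moreover have "2 * char \<mu> s + complex_of_real a * char \<mu> s = complex_of_real (2 + a) * char \<mu> s"
        by (simp add: algebra_simps)
      ultimately show ?thesis by simp
    qed
    finally show ?thesis .
  qed
  then have "distr Q borel X = \<mu>"
    by (intro Levy_uniqueness \<mu> Q.real_distribution_distr XQ ext)
  then have "measure \<mu> A = (\<integral>x. indicator A x \<partial>distr Q borel X)" by simp
  also have "\<dots> = (\<integral>x. indicator A (X x) \<partial>Q)" by (subst integral_distr) auto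
  also have "\<dots> = expectation (\<lambda>x. w x * indicator A (X x))"
    unfolding Q_def using w0 by (subst integral_real_density) auto
  also have "\<dots> = expectation (\<lambda>x. 1 / (2 + a) * (2 * indicator A (X x) + V x * indicator A (X x)))"
    by (intro Bochner_Integration.integral_cong) (auto simp: w_def algebra_simps add_divide_distrib)
  also have "\<dots> = 1 / (2 + a) * (2 * expectation (\<lambda>x. indicator A (X x)) + expectation (\<lambda>x. V x * indicator A (X x)))"
  proof -
    have "integrable M (\<lambda>x. indicator A (X x) :: real)"
      by (intro integrable_const_bound[where B=1]) auto
    moreover have "integrable M (\<lambda>x. V x * indicator A (X x))"
      using V_le by (intro integrable_const_bound[where B=1]) (auto simp: indicator_def)
    ultimately show ?thesis by simp
  qed
  also have "expectation (\<lambda>x. indicator A (X x)) = measure \<mu> A"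
  proof -
    have "expectation (\<lambda>x. indicator A (X x)) = (\<integral>x. (indicator A x :: real) \<partial>distr M borel X)"
      by (rule integral_distr[OF X, symmetric]) simp
    then show ?thesis by (simp add: law)
  qed
  finally show ?thesis using a_le by (auto simp: field_simps abs_le_iff)
qed

text \<open>The real case is applied to the real part of D W, for D = 1 and D = -i. The transform of
  this real part combines the hypothesis at s with its conjugate at -s.\<close>

lemma (in prob_space) weighted_char_unique:
  assumes X[measurable]: "X \<in> borel_measurable M" and W[measurable]: "W \<in> borel_measurable M"
    and W_le: "\<And>x. norm (W x) \<le> 1" and \<mu>: "real_distribution \<mu>" and law: "distr M borel X = \<mu>"
    and eq: "\<And>s. expectation (\<lambda>x. W x * iexp (s * X x)) = C * char \<mu> s"
    and A[measurable]: "A \<in> sets borel"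
  shows "expectation (\<lambda>x. W x * indicator A (X x)) = C * measure \<mu> A"
proof -
  have cnj_char: "cnj (char \<mu> (- s)) = char \<mu> s" for s
    unfolding char_def by (simp flip: Bochner_Integration.integral_cnj add: exp_cnj)
  have cr: "complex_of_real (Re z) = (z + cnj z) / 2" for z by (simp add: complex_eq_iff)
  have Re_case: "expectation (\<lambda>x. Re (D * W x) * indicator A (X x)) = Re (D * C) * measure \<mu> A"
    if D: "norm D = 1" for D
  proof (rule weighted_char_unique_real[OF X _ _ \<mu> law _ A])
    show "(\<lambda>x. Re (D * W x)) \<in> borel_measurable M" by measurable
    show "\<bar>Re (D * W x)\<bar> \<le> 1" for x
      using W_le[of x] D abs_Re_le_cmod[of "D * W x"] by (simp add: norm_mult)
    fix s
    have i: "integrable M (\<lambda>x. W x * iexp (s * X x))" for s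
      using W_le by (intro iexp_integrable[where B=1]) auto
    have i2: "integrable M (\<lambda>x. cnj (W x * iexp (- s * X x)))"
      by (rule integrable_cnj[OF i])
    have 2: "expectation (\<lambda>x. cnj (W x * iexp (- s * X x))) = cnj C * char \<mu> s"
    proof -
      have "expectation (\<lambda>x. cnj (W x * iexp (- s * X x))) = cnj (expectation (\<lambda>x. W x * iexp (- s * X x)))"
        by (rule Bochner_Integration.integral_cnj)
      also have "\<dots> = cnj C * char \<mu> s" by (simp only: eq complex_cnj_mult cnj_char)
      finally show ?thesis .
    qed
    have "complex_of_real (Re (D * W x)) * iexp (s * X x)
        = D / 2 * (W x * iexp (s * X x)) + cnj D / 2 * cnj (W x * iexp (- s * X x))" for x
    proof -
      have "cnj (iexp (- s * X x)) = iexp (s * X x)" by (simp add: exp_cnj)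
      then show ?thesis unfolding cr by (simp add: algebra_simps add_divide_distrib)
    qed
    then have "expectation (\<lambda>x. complex_of_real (Re (D * W x)) * iexp (s * X x))
        = D / 2 * (C * char \<mu> s) + cnj D / 2 * (cnj C * char \<mu> s)"
      using i[of s] i2 eq[of s] 2 by (simp del: complex_cnj_mult)
    also have "\<dots> = (D * C + cnj (D * C)) / 2 * char \<mu> s" by (simp add: algebra_simps add_divide_distrib)
    also have "(D * C + cnj (D * C)) / 2 = complex_of_real (Re (D * C))" by (rule cr[symmetric])
    finally show "expectation (\<lambda>x. complex_of_real (Re (D * W x)) * iexp (s * X x)) = complex_of_real (Re (D * C)) * char \<mu> s" .
  qed
  have int: "integrable M (\<lambda>x. W x * indicator A (X x))"
    using W_le by (intro integrable_const_bound[where B=1]) (auto simp: norm_mult indicator_def)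
  show ?thesis
  proof (rule complex_eqI)
    show "Re (expectation (\<lambda>x. W x * indicator A (X x))) = Re (C * measure \<mu> A)"
    proof -
      have "Re (expectation (\<lambda>x. W x * indicator A (X x))) = expectation (\<lambda>x. Re (W x * indicator A (X x)))"
        by (rule integral_Re[OF int, symmetric])
      also have "\<dots> = expectation (\<lambda>x. Re (1 * W x) * indicator A (X x))"
        by (intro Bochner_Integration.integral_cong refl) (simp add: indicator_def)
      finally show ?thesis using Re_case[of 1] by simp
    qed
    show "Im (expectation (\<lambda>x. W x * indicator A (X x))) = Im (C * measure \<mu> A)"
    proof -
      have "Im (expectation (\<lambda>x. W x * indicator A (X x))) = expectation (\<lambda>x. Im (W x * indicator A (X x)))"
        by (rule integral_Im[OF int, symmetric])
      also have "\<dots> = expectation (\<lambda>x. Re (- \<i> * W x) * indicator A (X x))"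
        by (intro Bochner_Integration.integral_cong refl) (simp add: indicator_def)
      finally show ?thesis using Re_case[of "- \<i>"] by simp
    qed
  qed
qed

text \<open>The factors are exchanged one at a time: indicators below \<open>m\<close>, exponentials from \<open>m\<close> on.\<close>
lemma (in prob_space) char_determines_cylinders:
  fixes T :: "nat \<Rightarrow> 'a \<Rightarrow> real" and \<mu> :: "nat \<Rightarrow> real measure"
  assumes T[measurable]: "\<And>k. T k \<in> borel_measurable M" and \<mu>: "\<And>k. real_distribution (\<mu> k)"
    and H: "\<And>n t. expectation (\<lambda>x. \<Prod>k<n. iexp (t k * T k x)) = (\<Prod>k<n. char (\<mu> k) (t k))"
    and F: "\<And>k. k < m \<Longrightarrow> \<exists>A\<in>sets borel. F k = indicator A" "\<And>k. m \<le> k \<Longrightarrow> \<exists>t. F k = (\<lambda>x. iexp (t * x))"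
  shows "expectation (\<lambda>x. \<Prod>k<n. F k (T k x)) = (\<Prod>k<n. \<integral>x. F k x \<partial>\<mu> k)"
  using F
proof (induction m arbitrary: F n)
  case 0
  then have "\<forall>k. \<exists>t. F k = (\<lambda>x. iexp (t * x))" by simp
  then obtain t where "\<And>k. F k = (\<lambda>x. iexp (t k * x))" by metis
  then show ?case using H[of t n] by (simp add: char_def)
next
  case (Suc m)
  obtain A where A[measurable]: "A \<in> sets borel" and FA: "F m = indicator A" using Suc.prems(1)[of m] by auto
  have IH: "expectation (\<lambda>x. \<Prod>k<n. (F(m := \<lambda>x. iexp (s * x))) k (T k x)) = (\<Prod>k<n. \<integral>x. (F(m := \<lambda>x. iexp (s * x))) k x \<partial>\<mu> k)" for s n
    using Suc.prems by (intro Suc.IH) auto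
  show ?case
  proof (cases "m < n")
    case False
    then have "(\<Prod>k<n. (F(m := \<lambda>x. iexp (0 * x))) k (T k x)) = (\<Prod>k<n. F k (T k x))"
      "(\<Prod>k<n. \<integral>x. (F(m := \<lambda>x. iexp (0 * x))) k x \<partial>\<mu> k) = (\<Prod>k<n. \<integral>x. F k x \<partial>\<mu> k)" for x
      by (auto intro!: prod.cong)
    with IH[of 0 n] show ?thesis by simp
  next
    case True
    \<comment> \<open>All other factors together form a complex weight bounded by 1; weighted
      uniqueness then exchanges the exponential in place m for an indicator.\<close>
    define W where "W x = (\<Prod>k\<in>{..<n} - {m}. F k (T k x))" for x
    define C where "C = (\<Prod>k\<in>{..<n} - {m}. \<integral>x. F k x \<partial>\<mu> k)"
    have Fm: "F k \<in> borel_measurable borel \<and> (\<forall>x. norm (F k x) \<le> 1)" for k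
    proof (cases "k < Suc m")
      case True
      from Suc.prems(1)[OF this] show ?thesis by (auto simp: indicator_def)
    next
      case False
      then show ?thesis using Suc.prems(2)[of k] by auto
    qed
    have [measurable]: "F k \<in> borel_measurable borel" for k using Fm by simp
    have Wm: "W \<in> borel_measurable M" unfolding W_def by measurable
    have W_le: "norm (W x) \<le> 1" for x
      unfolding W_def prod_norm[symmetric] using Fm by (intro prod_le_1) auto
    have split: "(\<Prod>k<n. f k) = f m * (\<Prod>k\<in>{..<n} - {m}. f k)" for f :: "nat \<Rightarrow> complex"
      using True by (intro prod.remove) auto
    have eq: "expectation (\<lambda>x. W x * iexp (s * T m x)) = C * char (\<mu> m) s" for s
    proof -
      have "expectation (\<lambda>x. W x * iexp (s * T m x)) = expectation (\<lambda>x. \<Prod>k<n. (F(m := \<lambda>x. iexp (s * x))) k (T k x))"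
        unfolding split W_def by (intro Bochner_Integration.integral_cong refl) (auto simp: mult.commute)
      also have "\<dots> = (\<Prod>k<n. \<integral>x. (F(m := \<lambda>x. iexp (s * x))) k x \<partial>\<mu> k)" by (rule IH)
      also have "\<dots> = C * char (\<mu> m) s"
        unfolding split C_def char_def by (simp add: mult.commute)
      finally show ?thesis .
    qed
    \<comment> \<open>The law of a single coordinate comes from the joint hypothesis with all other
      frequencies equal to 0.\<close>
    have law: "distr M borel (T m) = \<mu> m"
    proof (intro Levy_uniqueness real_distribution_distr T \<mu> ext)
      fix s
      have "char (distr M borel (T m)) s = expectation (\<lambda>x. \<Prod>k<Suc m. iexp ((if k = m then s else 0) * T k x))"
        by (simp add: char_distr_eq lessThan_Suc)
      also have "\<dots> = (\<Prod>k<Suc m. char (\<mu> k) (if k = m then s else 0))" by (rule H)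
      also have "\<dots> = char (\<mu> m) s" by (simp add: lessThan_Suc real_distribution.char_zero[OF \<mu>])
      finally show "char (distr M borel (T m)) s = char (\<mu> m) s" .
    qed
    have "expectation (\<lambda>x. \<Prod>k<n. F k (T k x)) = expectation (\<lambda>x. W x * indicator A (T m x))"
      unfolding split W_def by (simp add: FA mult.commute)
    also have "\<dots> = C * measure (\<mu> m) A"
      by (rule weighted_char_unique[OF T Wm W_le \<mu> law eq A])
    also have "complex_of_real (measure (\<mu> m) A) = (\<integral>x. F m x \<partial>\<mu> m)"
    proof -
      interpret D: real_distribution "\<mu> m" by (rule \<mu>)
      show ?thesis unfolding FA by (simp add: integral_indicator_complex)
    qed
    also have "C * (\<integral>x. F m x \<partial>\<mu> m) = (\<Prod>k<n. \<integral>x. F k x \<partial>\<mu> k)"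
      unfolding split C_def by (simp add: mult.commute)
    finally show ?thesis .
  qed
qed

lemma (in prob_space) char_determines_product_law:
  fixes T :: "nat \<Rightarrow> 'a \<Rightarrow> real" and \<mu> :: "nat \<Rightarrow> real measure"
  assumes T[measurable]: "\<And>k. T k \<in> borel_measurable M" and \<mu>: "\<And>k. real_distribution (\<mu> k)"
    and H: "\<And>n t. expectation (\<lambda>x. \<Prod>k<n. iexp (t k * T k x)) = (\<Prod>k<n. char (\<mu> k) (t k))"
  shows "distr M (PiM UNIV \<mu>) (\<lambda>x k. T k x) = PiM UNIV \<mu>"
proof -
  have sets_\<mu>: "sets (\<mu> k) = sets borel" for k using \<mu> real_distribution.events_eq_borel by blast
  have pr: "prob_space (\<mu> k)" for k using \<mu>[of k] by (simp add: real_distribution_def)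
  have sp: "space (\<mu> k) = UNIV" for k using sets_eq_imp_space_eq[OF sets_\<mu>] by simp
  have Tm: "(\<lambda>x k. T k x) \<in> measurable M (PiM UNIV \<mu>)"
    using T by (intro measurable_PiM_single') (auto simp: measurable_cong_sets[OF refl sets_\<mu>] sp)
  show ?thesis
  proof (rule measure_eqI_PiM_infinite)
    show "finite_measure (distr M (PiM UNIV \<mu>) (\<lambda>x k. T k x))"
      using prob_space.finite_measure[OF prob_space_distr[OF Tm]] .
    fix A :: "nat \<Rightarrow> real set" and J :: "nat set"
    assume J: "finite J" "J \<subseteq> UNIV" and A: "\<And>i. i \<in> J \<Longrightarrow> A i \<in> sets (\<mu> i)"
    \<comment> \<open>Filling in the whole line outside J makes the cylinder depend on an initial
      segment of indices, the form in which the factors were exchanged.\<close>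
    define A' where "A' k = (if k \<in> J then A k else UNIV)" for k
    obtain n where n: "J \<subseteq> {..<n}" using J finite_nat_iff_bounded by blast
    have A'[measurable]: "A' k \<in> sets borel" for k using A[of k] by (auto simp: A'_def sets_\<mu>)
    have emb: "(\<lambda>x k. T k x) -` prod_emb UNIV \<mu> J (Pi\<^sub>E J A) \<inter> space M = {x \<in> space M. \<forall>k<n. T k x \<in> A' k}"
      using subsetD[OF n] by (auto simp: prod_emb_def A'_def PiE_iff sp space_PiM)
    have B[measurable]: "{x \<in> space M. \<forall>k<n. T k x \<in> A' k} \<in> sets M" by measurable
    have "complex_of_real (prob {x \<in> space M. \<forall>k<n. T k x \<in> A' k})
        = expectation (\<lambda>x. \<Prod>k<n. indicator (A' k) (T k x))"
    proof -
      have "complex_of_real (prob {x \<in> space M. \<forall>k<n. T k x \<in> A' k})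
          = complex_of_real (expectation (indicator {x \<in> space M. \<forall>k<n. T k x \<in> A' k}))" by simp
      also have "\<dots> = expectation (\<lambda>x. complex_of_real (indicator {x \<in> space M. \<forall>k<n. T k x \<in> A' k} x))"
        by (rule integral_complex_of_real[symmetric])
      also have "\<dots> = expectation (\<lambda>x. \<Prod>k<n. indicator (A' k) (T k x))"
      proof (intro Bochner_Integration.integral_cong refl)
        fix x assume x: "x \<in> space M"
        show "complex_of_real (indicator {x \<in> space M. \<forall>k<n. T k x \<in> A' k} x) = (\<Prod>k<n. indicator (A' k) (T k x))"
        proof (cases "\<forall>k<n. T k x \<in> A' k")
          case False
          then obtain k where "k < n" "T k x \<notin> A' k" by auto
          then show ?thesis using False by (auto simp: indicator_def intro!: prod_zero[symmetric] bexI[of _ k])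
        qed (use x in auto)
      qed
      finally show ?thesis .
    qed
    also have "\<dots> = expectation (\<lambda>x. \<Prod>k<n. (if k < n then indicator (A' k) else (\<lambda>x. iexp (0 * x))) (T k x))"
      by (intro Bochner_Integration.integral_cong prod.cong refl) simp
    also have "\<dots> = (\<Prod>k<n. \<integral>x. (if k < n then indicator (A' k) else (\<lambda>x. iexp (0 * x))) x \<partial>\<mu> k)"
    proof (rule char_determines_cylinders[OF T \<mu> H, where m=n])
      show "\<exists>A\<in>sets borel. (if k < n then indicator (A' k) else (\<lambda>x. iexp (0 * x))) = indicator A" if "k < n" for k
        using that A'[of k] by auto
      show "\<exists>t. (if k < n then indicator (A' k) else (\<lambda>x. iexp (0 * x))) = (\<lambda>x. iexp (t * x))" if "n \<le> k" for k
        using that by (intro exI[of _ 0]) simp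
    qed
    also have "\<dots> = (\<Prod>k<n. complex_of_real (measure (\<mu> k) (A' k)))"
    proof (intro prod.cong refl)
      fix k assume k: "k \<in> {..<n}"
      interpret D: real_distribution "\<mu> k" by (rule \<mu>)
      show "(\<integral>x. (if k < n then indicator (A' k) else (\<lambda>x. iexp (0 * x))) x \<partial>\<mu> k) = complex_of_real (measure (\<mu> k) (A' k))"
        using k by (simp add: integral_indicator_complex)
    qed
    also have "\<dots> = complex_of_real (\<Prod>k<n. measure (\<mu> k) (A' k))" by simp
    finally have pr_eq: "prob {x \<in> space M. \<forall>k<n. T k x \<in> A' k} = (\<Prod>k<n. measure (\<mu> k) (A' k))"
      by (simp only: of_real_eq_iff)
    have "emeasure (distr M (PiM UNIV \<mu>) (\<lambda>x k. T k x)) (prod_emb UNIV \<mu> J (Pi\<^sub>E J A)) = emeasure M {x \<in> space M. \<forall>k<n. T k x \<in> A' k}"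
      using J A by (subst emeasure_distr[OF Tm]) (auto simp: emb intro!: sets_PiM_I)
    also have "\<dots> = ennreal (\<Prod>k<n. measure (\<mu> k) (A' k))" by (simp add: emeasure_eq_measure pr_eq)
    also have "\<dots> = (\<Prod>k<n. emeasure (\<mu> k) (A' k))"
      using finite_measure.emeasure_eq_measure[OF prob_space.finite_measure[OF pr]]
      by (simp add: prod_ennreal[symmetric] measure_nonneg)
    also have "\<dots> = (\<Prod>k\<in>J. emeasure (\<mu> k) (A' k))"
      using n prob_space.emeasure_space_1[OF pr] sp by (intro prod.mono_neutral_right) (auto simp: A'_def)
    also have "\<dots> = (\<Prod>k\<in>J. emeasure (\<mu> k) (A k))" by (intro prod.cong) (auto simp: A'_def)
    also have "\<dots> = emeasure (PiM UNIV \<mu>) (prod_emb UNIV \<mu> J (Pi\<^sub>E J A))"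
      using J A pr by (intro emeasure_PiM_emb[symmetric]) auto
    finally show "emeasure (distr M (PiM UNIV \<mu>) (\<lambda>x k. T k x)) (prod_emb UNIV \<mu> J (Pi\<^sub>E J A)) = emeasure (PiM UNIV \<mu>) (prod_emb UNIV \<mu> J (Pi\<^sub>E J A))" .
  qed simp_all
qed

text \<open>The law is that of sqrt v times a standard normal variable; this also covers the
  degenerate case v = 0.\<close>

lemma (in prob_space) gaussian_second_moment:
  assumes X[measurable]: "X \<in> borel_measurable M" and v: "0 \<le> v"
    and ch: "\<And>t. char (distr M borel X) t = exp (- (v * t\<^sup>2) / 2)"
  shows "Lp_int M 2 X = ennreal v"
proof -
  interpret Z: real_distribution std_normal_distribution by (rule real_dist_normal_dist)
  let ?Y = "\<lambda>x::real. sqrt v * x"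
  have "distr M borel X = distr std_normal_distribution borel ?Y"
  proof (intro Levy_uniqueness real_distribution_distr X Z.real_distribution_distr ext)
    fix t
    have "char (distr std_normal_distribution borel ?Y) t = char std_normal_distribution (t * sqrt v)"
      by (subst Z.char_distr_eq) (auto simp: char_def mult.assoc)
    also have "\<dots> = exp (- (v * t\<^sup>2) / 2)"
      using v by (simp add: char_std_normal_distribution power_mult_distrib mult.commute)
    finally show "char (distr M borel X) t = char (distr std_normal_distribution borel ?Y) t" by (simp add: ch)
  qed simp
  then have "Lp_int M 2 X = (\<integral>\<^sup>+x. ennreal (\<bar>x\<bar> powr 2) \<partial>distr std_normal_distribution borel ?Y)"
    unfolding Lp_int_def by (subst nn_integral_distr[OF X, symmetric]) auto
  also have "\<dots> = (\<integral>\<^sup>+x. ennreal (v * x\<^sup>2) \<partial>std_normal_distribution)"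
    using v by (subst nn_integral_distr) (auto simp: abs_mult powr_mult power_mult_distrib intro!: nn_integral_cong)
  also have "\<dots> = ennreal v * (\<integral>\<^sup>+x. ennreal (x\<^sup>2) \<partial>std_normal_distribution)"
    using v by (simp add: ennreal_mult nn_integral_cmult)
  also have "(\<integral>\<^sup>+x. ennreal (x\<^sup>2) \<partial>std_normal_distribution) = (\<integral>\<^sup>+x. ennreal (std_normal_density x * x ^ (2 * 1)) \<partial>lborel)"
    by (subst nn_integral_density) (auto simp: ennreal_mult)
  also have "\<dots> = 1"
    using std_normal_moment_even[of 1]
    by (subst nn_integral_eq_integral) (auto simp: has_bochner_integral_iff fact_numeral)
  finally show ?thesis by simp
qed

section \<open>Orthonormal systems\<close>

definition ip :: "'a measure \<Rightarrow> ('a \<Rightarrow> real) \<Rightarrow> ('a \<Rightarrow> real) \<Rightarrow> real" where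
  "ip N f g = (\<integral>x. f x * g x \<partial>N)"

lemma L2_square_integrable: "f \<in> Lp N 2 \<Longrightarrow> integrable N (\<lambda>x. (f x)\<^sup>2)"
  by (intro integrableI_nonneg) (auto simp: Lp_def Lp_int_def)

lemma L2_mult_integrable:
  assumes "f \<in> Lp N 2" "g \<in> Lp N 2"
  shows "integrable N (\<lambda>x. f x * g x)"
proof (rule Bochner_Integration.integrable_bound)
  show "integrable N (\<lambda>x. (f x)\<^sup>2 + (g x)\<^sup>2)"
    using assms by (intro Bochner_Integration.integrable_add L2_square_integrable)
  show "(\<lambda>x. f x * g x) \<in> borel_measurable N"
    using assms by (intro borel_measurable_times) (auto simp: Lp_def)
  have "\<bar>a * b\<bar> \<le> a\<^sup>2 + b\<^sup>2" for a b :: real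
  proof -
    have "2 * (\<bar>a\<bar> * \<bar>b\<bar>) \<le> a\<^sup>2 + b\<^sup>2" using sum_squares_bound[of "\<bar>a\<bar>" "\<bar>b\<bar>"] by simp
    moreover have "0 \<le> \<bar>a\<bar> * \<bar>b\<bar>" by simp
    ultimately show ?thesis unfolding abs_mult by linarith
  qed
  then show "AE x in N. norm (f x * g x) \<le> norm ((f x)\<^sup>2 + (g x)\<^sup>2)" by simp
qed

lemma L2_int: "f \<in> Lp N 2 \<Longrightarrow> Lp_int N 2 f = ennreal (ip N f f)"
  using nn_integral_eq_integral[OF L2_square_integrable, of f N]
  by (simp add: Lp_int_def ip_def power2_eq_square)

lemma ip_nonneg: "0 \<le> ip N f f"
  by (simp add: ip_def)

lemma ip_commute: "ip N f g = ip N g f"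
  by (simp add: ip_def mult.commute)

lemma ip_lin:
  assumes "f \<in> Lp N 2" "g \<in> Lp N 2" "h \<in> Lp N 2"
  shows "ip N (\<lambda>x. s * f x + g x) h = s * ip N f h + ip N g h"
  using L2_mult_integrable[OF assms(1,3)] L2_mult_integrable[OF assms(2,3)]
  by (simp add: ip_def distrib_right mult.assoc)

lemma ip_diff:
  assumes "f \<in> Lp N 2" "g \<in> Lp N 2" "h \<in> Lp N 2"
  shows "ip N (\<lambda>x. f x - g x) h = ip N f h - ip N g h"
  using ip_lin[OF assms(2,1,3), of "-1"] by simp

lemma L2_sum: "(\<And>k. e k \<in> Lp N 2) \<Longrightarrow> (\<lambda>x. \<Sum>k<n. d k * e k x) \<in> Lp N 2" for n :: nat
  by (induction n) (auto intro!: Lp_zero Lp_add Lp_scale)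

lemma ip_sum:
  fixes n :: nat
  assumes "\<And>k. e k \<in> Lp N 2" "h \<in> Lp N 2"
  shows "ip N (\<lambda>x. \<Sum>k<n. d k * e k x) h = (\<Sum>k<n. d k * ip N (e k) h)"
proof (induction n)
  case (Suc n)
  then show ?case
    using ip_lin[OF assms(1)[of n] L2_sum[OF assms(1), where n=n and d=d] assms(2), of "d n"] by (simp add: add.commute)
qed (simp add: ip_def)

lemma ip_eq_0_AE:
  assumes "f \<in> Lp N 2" "ip N f f = 0"
  shows "AE x in N. f x = 0"
  using L2_int[OF assms(1)] assms Lp_int_eq_0_iff[of f N 2] by (simp add: Lp_def)

text \<open>The recursive calls below stand under a sum over j < k; this congruence makes the bound
  visible, and the recursion descends.\<close>

lemmas [fundef_cong] = sum.cong

text \<open>Since \<open>x / 0 = 0\<close>, a linearly dependent \<open>f k\<close> contributes the zero function.\<close>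
fun gram_schmidt :: "'a measure \<Rightarrow> (nat \<Rightarrow> 'a \<Rightarrow> real) \<Rightarrow> nat \<Rightarrow> 'a \<Rightarrow> real" where
  "gram_schmidt N f k = (let r = (\<lambda>x. f k x - (\<Sum>j<k. ip N (f k) (gram_schmidt N f j) * gram_schmidt N f j x))
     in (\<lambda>x. r x / sqrt (ip N r r)))"

declare gram_schmidt.simps [simp del]

definition gs_residual :: "'a measure \<Rightarrow> (nat \<Rightarrow> 'a \<Rightarrow> real) \<Rightarrow> nat \<Rightarrow> 'a \<Rightarrow> real" where
  "gs_residual N f k x = f k x - (\<Sum>j<k. ip N (f k) (gram_schmidt N f j) * gram_schmidt N f j x)"

lemma gram_schmidt_eq:
  "gram_schmidt N f k = (\<lambda>x. (1 / sqrt (ip N (gs_residual N f k) (gs_residual N f k))) * gs_residual N f k x)"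
  by (subst gram_schmidt.simps) (simp add: Let_def gs_residual_def[abs_def])

lemma gram_schmidt_L2:
  assumes f: "\<And>k. f k \<in> Lp N 2"
  shows "gram_schmidt N f k \<in> Lp N 2"
proof (induction k rule: less_induct)
  case (less k)
  have "(\<lambda>x. \<Sum>j<m. ip N (f k) (gram_schmidt N f j) * gram_schmidt N f j x) \<in> Lp N 2" if "m \<le> k" for m
    using that by (induction m) (auto intro!: Lp_zero Lp_add Lp_scale less)
  then have "gs_residual N f k \<in> Lp N 2"
    unfolding gs_residual_def by (intro Lp_diff f) auto
  then show ?case unfolding gram_schmidt_eq by (rule Lp_scale)
qed

lemma gs_residual_L2:
  assumes f: "\<And>k. f k \<in> Lp N 2"
  shows "gs_residual N f k \<in> Lp N 2"
  unfolding gs_residual_def by (intro Lp_diff f L2_sum gram_schmidt_L2) auto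

lemma gram_schmidt_orthonormal:
  assumes f: "\<And>k. f k \<in> Lp N 2"
  shows "ip N (gram_schmidt N f k) (gram_schmidt N f k) = 1 \<or> gram_schmidt N f k = (\<lambda>_. 0)"
    and "i < k \<Longrightarrow> ip N (gram_schmidt N f k) (gram_schmidt N f i) = 0"
proof -
  note L = gram_schmidt_L2[of f, OF f] and R = gs_residual_L2[of f, OF f]
  show n: "ip N (gram_schmidt N f k) (gram_schmidt N f k) = 1 \<or> gram_schmidt N f k = (\<lambda>_. 0)" for k
  proof (cases "ip N (gs_residual N f k) (gs_residual N f k) = 0")
    case True
    then show ?thesis by (simp add: gram_schmidt_eq)
  next
    case False
    define r where "r = gs_residual N f k"
    define w where "w = ip N r r"
    have w: "0 < w" using False ip_nonneg[of N r] by (simp add: w_def r_def)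
    have "ip N (gram_schmidt N f k) (gram_schmidt N f k) = (1 / sqrt w) * (1 / sqrt w) * ip N r r"
      unfolding gram_schmidt_eq r_def[symmetric] w_def[symmetric]
      by (simp add: ip_def mult_ac) (simp add: w_def ip_def)
    also have "\<dots> = 1" using w by (simp add: w_def[symmetric])
    finally show ?thesis by simp
  qed
  show "ip N (gram_schmidt N f k) (gram_schmidt N f i) = 0" if "i < k"
    using that
  proof (induction k arbitrary: i rule: less_induct)
    case (less k)
    let ?e = "gram_schmidt N f"
    have orth: "ip N (?e j) (?e i) = 0" if "j < k" "j \<noteq> i" for j
      using less that by (metis ip_commute linorder_neqE_nat)
    have "ip N (gs_residual N f k) (?e i) = ip N (f k) (?e i) - (\<Sum>j<k. ip N (f k) (?e j) * ip N (?e j) (?e i))"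
      unfolding gs_residual_def by (subst ip_diff[OF f L2_sum[OF L] L]) (simp add: ip_sum[OF L L])
    also have "(\<Sum>j<k. ip N (f k) (?e j) * ip N (?e j) (?e i)) = (\<Sum>j<k. if j = i then ip N (f k) (?e i) * ip N (?e i) (?e i) else 0)"
      by (intro sum.cong) (auto simp: orth)
    also have "\<dots> = ip N (f k) (?e i) * ip N (?e i) (?e i)" using less.prems by simp
    \<comment> \<open>Either \<open>?e i\<close> has norm 1 or it is the zero function; the
      difference vanishes in both cases.\<close>
    also have "ip N (f k) (?e i) - ip N (f k) (?e i) * ip N (?e i) (?e i) = 0"
      using n[of i] by (auto simp: ip_def)
    finally have "ip N (gs_residual N f k) (?e i) = 0" .
    then show ?case by (subst gram_schmidt_eq) (simp add: ip_def mult.assoc)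
  qed
qed

lemma gram_schmidt_span:
  assumes f: "\<And>k. f k \<in> Lp N 2"
  shows "\<exists>d. AE x in N. f k x = (\<Sum>j<Suc k. d j * gram_schmidt N f j x)"
proof -
  define r where "r = gs_residual N f k"
  define w where "w = ip N r r"
  have rL: "r \<in> Lp N 2" unfolding r_def by (rule gs_residual_L2[OF f])
  have "AE x in N. r x = sqrt w * gram_schmidt N f k x"
  proof (cases "w = 0")
    case True
    then show ?thesis using ip_eq_0_AE[OF rL] by (simp add: w_def)
  next
    case False
    then have "0 < w" using ip_nonneg[of N r] by (simp add: w_def)
    then show ?thesis by (simp add: gram_schmidt_eq r_def[symmetric] w_def[symmetric])
  qed
  then have "AE x in N. f k x = (\<Sum>j<Suc k. (if j = k then sqrt w else ip N (f k) (gram_schmidt N f j)) * gram_schmidt N f j x)"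
    by eventually_elim (simp add: r_def gs_residual_def)
  then show ?thesis by (intro exI)
qed

locale orthosystem =
  fixes N :: "'a measure" and e :: "nat \<Rightarrow> 'a \<Rightarrow> real"
  assumes e_L2: "\<And>k. e k \<in> Lp N 2"
    and e_orth: "\<And>j k. j \<noteq> k \<Longrightarrow> ip N (e j) (e k) = 0"
    and e_norm: "\<And>k. ip N (e k) (e k) = 1 \<or> e k = (\<lambda>_. 0)"
    and total: "\<And>f \<epsilon>. f \<in> Lp N 2 \<Longrightarrow> (0::ennreal) < \<epsilon> \<Longrightarrow>
      \<exists>n d. Lp_int N 2 (\<lambda>x. f x - (\<Sum>k<n::nat. d k * e k x)) < \<epsilon>"
begin

text \<open>It takes only the values 0 and 1 and becomes the variance of the k-th Gaussian
  coordinate.\<close>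

definition v :: "nat \<Rightarrow> real" where "v k = ip N (e k) (e k)"

lemma v_cases: "v k = 1 \<or> (v k = 0 \<and> e k = (\<lambda>_. 0))"
  using e_norm[of k] by (auto simp: v_def ip_def)

lemma v_nonneg: "0 \<le> v k"
  using v_cases[of k] by auto

lemma coeff_v: "ip N f (e k) * v k = ip N f (e k)"
  using v_cases[of k] by (auto simp: ip_def)

lemma ip_comb:
  fixes n :: nat
  shows "ip N (\<lambda>x. \<Sum>k<n. d k * e k x) (\<lambda>x. \<Sum>k<n. d k * e k x) = (\<Sum>k<n. (d k)\<^sup>2 * v k)"
proof -
  let ?g = "\<lambda>x. \<Sum>k<n. d k * e k x"
  have "ip N ?g (e k) = d k * v k" if "k < n" for k
  proof -
    have "ip N ?g (e k) = (\<Sum>j<n. if j = k then d k * v k else 0)"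
      unfolding ip_sum[OF e_L2 e_L2] by (intro sum.cong) (auto simp: e_orth v_def)
    then show ?thesis using that by simp
  qed
  then have "(\<Sum>k<n. d k * ip N (e k) ?g) = (\<Sum>k<n. (d k)\<^sup>2 * v k)"
    by (intro sum.cong) (auto simp: ip_commute[of N "e _"] power2_eq_square)
  then show ?thesis using ip_sum[OF e_L2 L2_sum[OF e_L2, where n=n and d=d], where n=n and d=d] by simp
qed

lemma distance_comb:
  fixes n :: nat
  assumes f: "f \<in> Lp N 2"
  shows "ip N (\<lambda>x. f x - (\<Sum>k<n. d k * e k x)) (\<lambda>x. f x - (\<Sum>k<n. d k * e k x))
    = ip N f f - 2 * (\<Sum>k<n. d k * ip N f (e k)) + (\<Sum>k<n. (d k)\<^sup>2 * v k)"
proof -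
  let ?g = "\<lambda>x. \<Sum>k<n. d k * e k x"
  have g: "?g \<in> Lp N 2" by (rule L2_sum[OF e_L2])
  have d: "(\<lambda>x. f x - ?g x) \<in> Lp N 2" by (intro Lp_diff f g) auto
  have gf: "ip N ?g f = (\<Sum>k<n. d k * ip N f (e k))"
    by (simp add: ip_sum[OF e_L2 f] ip_commute[of N _ f])
  have "ip N (\<lambda>x. f x - ?g x) (\<lambda>x. f x - ?g x) = ip N f (\<lambda>x. f x - ?g x) - ip N ?g (\<lambda>x. f x - ?g x)"
    by (rule ip_diff[OF f g d])
  also have "ip N f (\<lambda>x. f x - ?g x) = ip N f f - ip N ?g f"
    using ip_diff[OF f g f] by (simp add: ip_commute)
  also have "ip N ?g (\<lambda>x. f x - ?g x) = ip N ?g f - ip N ?g ?g"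
    using ip_diff[OF f g g] by (simp add: ip_commute)
  finally show ?thesis by (simp add: gf ip_comb)
qed

lemma distance_projection:
  assumes f: "f \<in> Lp N 2"
  shows "ip N (\<lambda>x. f x - (\<Sum>k<n. ip N f (e k) * e k x)) (\<lambda>x. f x - (\<Sum>k<n. ip N f (e k) * e k x))
    = ip N f f - (\<Sum>k<n. (ip N f (e k))\<^sup>2)"
proof -
  have "(ip N f (e k))\<^sup>2 * v k = (ip N f (e k))\<^sup>2" for k
    using coeff_v[of f k] by (simp add: power2_eq_square mult.assoc)
  then have "(\<Sum>k<n. (ip N f (e k))\<^sup>2 * v k) = (\<Sum>k<n. (ip N f (e k))\<^sup>2)" by (intro sum.cong refl)
  then show ?thesis unfolding distance_comb[OF f] by (simp only: power2_eq_square)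
qed

lemma bessel: "f \<in> Lp N 2 \<Longrightarrow> (\<Sum>k<n. (ip N f (e k))\<^sup>2) \<le> ip N f f"
  using distance_projection[of f n] ip_nonneg[of N "\<lambda>x. f x - (\<Sum>k<n. ip N f (e k) * e k x)"] by simp

lemma best_approximation:
  fixes n :: nat
  assumes f: "f \<in> Lp N 2"
  shows "ip N f f - (\<Sum>k<n. (ip N f (e k))\<^sup>2) \<le> ip N (\<lambda>x. f x - (\<Sum>k<n. d k * e k x)) (\<lambda>x. f x - (\<Sum>k<n. d k * e k x))"
proof -
  have "2 * (d k * ip N f (e k)) - (d k)\<^sup>2 * v k \<le> (ip N f (e k))\<^sup>2" for k
  proof (cases "v k = 1")
    case True
    have "0 \<le> (d k - ip N f (e k))\<^sup>2" by simp
    then show ?thesis using True by (simp add: power2_eq_square algebra_simps)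
  next
    case False
    then have "v k = 0" using v_cases[of k] by auto
    then show ?thesis using coeff_v[of f k] by simp
  qed
  then have "(\<Sum>k<n. 2 * (d k * ip N f (e k)) - (d k)\<^sup>2 * v k) \<le> (\<Sum>k<n. (ip N f (e k))\<^sup>2)"
    by (intro sum_mono)
  then show ?thesis unfolding distance_comb[OF f] by (simp add: sum_subtractf sum_distrib_left)
qed

text \<open>Bessel's inequality bounds the partial sums from above; totality yields a close
  combination, and the projection is at least as close.\<close>

lemma parseval:
  assumes f: "f \<in> Lp N 2"
  shows "(\<lambda>k. (ip N f (e k))\<^sup>2) sums ip N f f"
  unfolding sums_def
proof (rule LIMSEQ_I)
  fix r :: real assume r: "0 < r"
  then obtain n d where nd: "Lp_int N 2 (\<lambda>x. f x - (\<Sum>k<n::nat. d k * e k x)) < ennreal r"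
    using total[OF f, of "ennreal r"] by auto
  have g: "(\<lambda>x. f x - (\<Sum>k<n. d k * e k x)) \<in> Lp N 2" by (intro Lp_diff f L2_sum e_L2) auto
  have "ip N (\<lambda>x. f x - (\<Sum>k<n. d k * e k x)) (\<lambda>x. f x - (\<Sum>k<n. d k * e k x)) < r"
    using nd unfolding L2_int[OF g] ennreal_less_iff[OF ip_nonneg] .
  with best_approximation[OF f, of n d] have gap: "ip N f f - (\<Sum>k<n. (ip N f (e k))\<^sup>2) < r" by simp
  show "\<exists>no. \<forall>m\<ge>no. norm ((\<Sum>k<m. (ip N f (e k))\<^sup>2) - ip N f f) < r"
  proof (intro exI[of _ n] allI impI)
    fix m assume "n \<le> m"
    then have "(\<Sum>k<n. (ip N f (e k))\<^sup>2) \<le> (\<Sum>k<m. (ip N f (e k))\<^sup>2)" by (intro sum_mono2) auto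
    with gap bessel[OF f, of m] show "norm ((\<Sum>k<m. (ip N f (e k))\<^sup>2) - ip N f f) < r" by simp
  qed
qed

lemma projection_tendsto:
  assumes f: "f \<in> Lp N 2"
  shows "(\<lambda>n. Lp_int N 2 (\<lambda>x. f x - (\<Sum>k<n. ip N f (e k) * e k x))) \<longlonglongrightarrow> 0"
proof -
  have "Lp_int N 2 (\<lambda>x. f x - (\<Sum>k<n. ip N f (e k) * e k x)) = ennreal (ip N f f - (\<Sum>k<n. (ip N f (e k))\<^sup>2))" for n
    by (subst L2_int) (auto intro!: Lp_diff f L2_sum e_L2 simp: distance_projection[OF f])
  moreover have "(\<lambda>n. ip N f f - (\<Sum>k<n. (ip N f (e k))\<^sup>2)) \<longlonglongrightarrow> ip N f f - ip N f f"
    using parseval[OF f] unfolding sums_def by (intro tendsto_diff tendsto_const)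
  then have "(\<lambda>n. ennreal (ip N f f - (\<Sum>k<n. (ip N f (e k))\<^sup>2))) \<longlonglongrightarrow> ennreal 0"
    by (intro tendsto_ennrealI) simp
  ultimately show ?thesis by simp
qed

end

section \<open>Existence of an orthosystem for a finite Borel measure on the line\<close>

definition approximable :: "'a measure \<Rightarrow> (nat \<Rightarrow> 'a \<Rightarrow> real) \<Rightarrow> ('a \<Rightarrow> real) \<Rightarrow> bool" where
  "approximable N e f \<longleftrightarrow> (\<forall>\<epsilon>>(0::real). \<exists>n d. Lp_int N 2 (\<lambda>x. f x - (\<Sum>k<n::nat. d k * e k x)) < ennreal \<epsilon>)"

lemma approximable_lin:
  assumes e: "\<And>k. e k \<in> Lp N 2" and f: "f \<in> Lp N 2" "approximable N e f" and g: "g \<in> Lp N 2" "approximable N e g"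
  shows "approximable N e (\<lambda>x. s * f x + g x)"
  unfolding approximable_def
proof (intro allI impI)
  fix \<epsilon> :: real assume \<epsilon>: "0 < \<epsilon>"
  define \<delta> where "\<delta> = \<epsilon> / (8 * (s\<^sup>2 + 1))"
  have s1: "0 < s\<^sup>2 + 1" by (simp add: add_nonneg_pos)
  have \<delta>: "0 < \<delta>" using \<epsilon> s1 by (simp add: \<delta>_def)
  from f(2) \<delta> obtain n d where nd: "Lp_int N 2 (\<lambda>x. f x - (\<Sum>k<n::nat. d k * e k x)) < ennreal \<delta>"
    unfolding approximable_def by blast
  from g(2) \<delta> obtain m c where mc: "Lp_int N 2 (\<lambda>x. g x - (\<Sum>k<m::nat. c k * e k x)) < ennreal \<delta>"
    unfolding approximable_def by blast
  define D where "D k = s * (if k < n then d k else 0) + (if k < m then c k else 0)" for k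
  have sum1: "(\<Sum>k<max n m. D k * e k x) = s * (\<Sum>k<n. d k * e k x) + (\<Sum>k<m. c k * e k x)" for x
  proof -
    have "(\<Sum>k<max n m. (if k < n then d k else 0) * e k x) = (\<Sum>k<n. d k * e k x)"
      by (intro sum.mono_neutral_cong_right) auto
    moreover have "(\<Sum>k<max n m. (if k < m then c k else 0) * e k x) = (\<Sum>k<m. c k * e k x)"
      by (intro sum.mono_neutral_cong_right) auto
    ultimately show ?thesis
      by (simp add: D_def distrib_right sum.distrib mult.assoc flip: sum_distrib_left)
  qed
  have [measurable]: "(\<lambda>x. f x - (\<Sum>k<n. d k * e k x)) \<in> borel_measurable N" "(\<lambda>x. g x - (\<Sum>k<m. c k * e k x)) \<in> borel_measurable N"
    by (intro borel_measurable_diff Lp_measurable[OF f(1)] Lp_measurable[OF g(1)] Lp_measurable[OF L2_sum[OF e]])+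
  have "Lp_int N 2 (\<lambda>x. s * f x + g x - (\<Sum>k<max n m. D k * e k x))
    = Lp_int N 2 (\<lambda>x. s * (f x - (\<Sum>k<n. d k * e k x)) + (g x - (\<Sum>k<m. c k * e k x)))"
    unfolding sum1 by (simp add: algebra_simps)
  also have "\<dots> \<le> ennreal (2 powr 2) * (Lp_int N 2 (\<lambda>x. s * (f x - (\<Sum>k<n. d k * e k x))) + Lp_int N 2 (\<lambda>x. g x - (\<Sum>k<m. c k * e k x)))"
    by (intro Lp_int_add_le) auto
  also have "\<dots> = ennreal (2 powr 2) * (ennreal (\<bar>s\<bar> powr 2) * Lp_int N 2 (\<lambda>x. f x - (\<Sum>k<n. d k * e k x)) + Lp_int N 2 (\<lambda>x. g x - (\<Sum>k<m. c k * e k x)))"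
    by (subst Lp_int_scale) auto
  also have "\<dots> \<le> ennreal (2 powr 2) * (ennreal (\<bar>s\<bar> powr 2) * ennreal \<delta> + ennreal \<delta>)"
    using nd mc by (intro mult_left_mono add_mono) auto
  also have "\<dots> = ennreal (4 * (s\<^sup>2 + 1) * \<delta>)"
    using \<delta> by (simp flip: ennreal_mult ennreal_plus ennreal_numeral add: algebra_simps)
  also have "4 * (s\<^sup>2 + 1) * \<delta> = \<epsilon> / 2" using s1 by (simp add: \<delta>_def field_simps)
  also have "ennreal (\<epsilon> / 2) < ennreal \<epsilon>" using \<epsilon> by (intro ennreal_lessI) auto
  finally show "\<exists>n d. Lp_int N 2 (\<lambda>x. s * f x + g x - (\<Sum>k<n::nat. d k * e k x)) < ennreal \<epsilon>" by blast
qed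

lemma approximable_limit:
  assumes e: "\<And>k. e k \<in> Lp N 2" and f: "f \<in> Lp N 2"
    and lim: "\<And>\<epsilon>::real. 0 < \<epsilon> \<Longrightarrow> \<exists>g\<in>Lp N 2. approximable N e g \<and> Lp_int N 2 (\<lambda>x. f x - g x) < ennreal \<epsilon>"
  shows "approximable N e f"
  unfolding approximable_def
proof (intro allI impI)
  fix \<epsilon> :: real assume \<epsilon>: "0 < \<epsilon>"
  then obtain g where g: "g \<in> Lp N 2" "approximable N e g" "Lp_int N 2 (\<lambda>x. f x - g x) < ennreal (\<epsilon> / 8)"
    using lim[of "\<epsilon> / 8"] by auto
  have "0 < \<epsilon> / 8" using \<epsilon> by simp
  with g(2) obtain n d where nd: "Lp_int N 2 (\<lambda>x. g x - (\<Sum>k<n::nat. d k * e k x)) < ennreal (\<epsilon> / 8)"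
    unfolding approximable_def by blast
  have "Lp_int N 2 (\<lambda>x. f x - (\<Sum>k<n. d k * e k x))
      \<le> ennreal (2 powr 2) * (Lp_int N 2 (\<lambda>x. f x - g x) + Lp_int N 2 (\<lambda>x. g x - (\<Sum>k<n. d k * e k x)))"
    by (intro Lp_int_triangle Lp_measurable[OF f] Lp_measurable[OF g(1)] Lp_measurable[OF L2_sum[OF e]]) auto
  also have "\<dots> < ennreal (2 powr 2) * (ennreal (\<epsilon> / 8) + ennreal (\<epsilon> / 8))"
    using g(3) nd by (intro ennreal_mult_strict_left_mono add_strict_mono) auto
  also have "\<dots> = ennreal \<epsilon>" using \<epsilon> by (simp flip: ennreal_mult ennreal_plus ennreal_numeral)
  finally show "\<exists>n d. Lp_int N 2 (\<lambda>x. f x - (\<Sum>k<n::nat. d k * e k x)) < ennreal \<epsilon>" by blast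
qed

text \<open>Gram-Schmidt is applied to the indicators of the whole line and of the rational
  half-lines. These sets are stable under intersection and generate the Borel sets, so the closed
  span contains all indicators and then all of L_2.\<close>

lemma orthosystem_exists:
  fixes M :: "real measure"
  assumes fin: "finite_measure M" and sets_M: "sets M = sets borel"
  obtains e where "orthosystem M e"
proof -
  interpret finite_measure M by (rule fin)
  \<comment> \<open>Index 0 holds the whole line, which the complement step needs; hence the shift
    by one in the enumeration of the rationals.\<close>
  define r :: "nat \<Rightarrow> real set" where "r k = (if k = 0 then UNIV else {..<real_of_rat (from_nat_into UNIV (k - 1))})" for k
  define f :: "nat \<Rightarrow> real \<Rightarrow> real" where "f k = indicator (r k)" for k
  define e where "e = gram_schmidt M f"
  have ind: "(indicator A :: real \<Rightarrow> real) \<in> Lp M 2" "Lp_int M 2 (indicator A) = emeasure M A" if "A \<in> sets borel" for A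
    using indicator_Lp[of A M 2] that by (auto simp: sets_M emeasure_eq_measure)
  have r: "r k \<in> sets borel" for k by (auto simp: r_def)
  have f: "f k \<in> Lp M 2" for k unfolding f_def by (intro ind r)
  have eL: "e k \<in> Lp M 2" for k unfolding e_def by (rule gram_schmidt_L2[where f=f, OF f])
  have range_r: "range r = insert UNIV (lessThan ` \<rat>)"
  proof -
    have 1: "{..<q} \<in> range r" if q: "q \<in> \<rat>" for q
    proof -
      obtain t where t: "q = real_of_rat t" using q by (auto simp: Rats_def)
      obtain n where "from_nat_into UNIV n = t" using from_nat_into_surj[of "UNIV :: rat set" t] by auto
      then show ?thesis using t by (intro image_eqI[of _ _ "Suc n"]) (simp_all add: r_def)
    qed
    have 2: "UNIV \<in> range r" by (intro image_eqI[of _ _ 0]) (simp_all add: r_def)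
    have 3: "r k \<in> insert UNIV (lessThan ` \<rat>)" for k
      by (cases "k = 0") (simp_all add: r_def)
    show ?thesis
    proof
      show "range r \<subseteq> insert UNIV (lessThan ` \<rat>)" using 3 by (intro image_subsetI)
      show "insert UNIV (lessThan ` \<rat>) \<subseteq> range r" using 1 2 by (intro insert_subsetI image_subsetI)
    qed
  qed
  have ap_r: "approximable M e (indicator (r k))" for k
  proof -
    obtain d where "AE x in M. f k x = (\<Sum>j<Suc k. d j * e j x)"
      using gram_schmidt_span[where f=f and N=M and k=k, OF f] unfolding e_def by blast
    then have "AE x in M. f k x - (\<Sum>j<Suc k. d j * e j x) = 0" by eventually_elim simp
    then have "Lp_int M 2 (\<lambda>x. f k x - (\<Sum>j<Suc k. d j * e j x)) = Lp_int M 2 (\<lambda>_. 0)" by (rule Lp_int_cong_AE)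
    then have "Lp_int M 2 (\<lambda>x. indicator (r k) x - (\<Sum>j<Suc k. d j * e j x)) < ennreal \<epsilon>" if "0 < \<epsilon>" for \<epsilon>
      using that unfolding f_def Lp_int_zero by simp
    then show ?thesis unfolding approximable_def by blast
  qed
  have borel_r: "sigma_sets UNIV (range r) = sets borel"
  proof
    show "sigma_sets UNIV (range r) \<subseteq> sets borel"
      using r sets.sigma_sets_subset[of "range r" "borel :: real measure"] by auto
    have "{..<a} \<in> sigma_sets UNIV (range r)" for a
    proof -
      have "{..<a} = (\<Union>q\<in>{q\<in>\<rat>. q < a}. {..<q})"
      proof (intro equalityI subsetI)
        fix x assume "x \<in> {..<a}"
        then obtain q where "q \<in> \<rat>" "x < q" "q < a" using Rats_dense_in_real[of x a] by auto
        then show "x \<in> (\<Union>q\<in>{q\<in>\<rat>. q < a}. {..<q})" by auto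
      qed auto
      also have "\<dots> \<in> sigma_sets UNIV (range r)"
      proof (intro sigma_sets_UNION)
        show "countable (lessThan ` {q\<in>\<rat>. q < a})"
          by (intro countable_image countable_subset[OF _ countable_rat]) auto
      qed (auto simp: range_r)
      finally show ?thesis .
    qed
    then have "sigma_sets UNIV (range lessThan) \<subseteq> sigma_sets UNIV (range r)" by (intro sigma_sets_mono) auto
    moreover have "sets borel = sigma_sets UNIV (range (lessThan :: real \<Rightarrow> real set))" unfolding borel_Iio by simp
    ultimately show "sets borel \<subseteq> sigma_sets UNIV (range r)" by simp
  qed
  have ap_ind: "approximable M e (indicator A)" if A: "A \<in> sets borel" for A
  proof -
    have "Int_stable (range r)"
    proof -
      have "{..<a} \<inter> {..<b} = {..<min a b}" for a b :: real by auto
      then show ?thesis unfolding range_r Int_stable_def by (auto simp: min_def)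
    qed
    moreover have "range r \<subseteq> Pow UNIV" by simp
    moreover have "A \<in> sigma_sets UNIV (range r)" using A borel_r by simp
    ultimately show ?thesis
    proof (induction rule: sigma_sets_induct_disjoint)
      case (basic A)
      then show ?case using ap_r by auto
    next
      case empty
      show ?case unfolding approximable_def by (auto intro!: exI[of _ 0] simp: Lp_int_zero)
    next
      case (compl A)
      have "indicator (UNIV - A) = (\<lambda>x. (-1) * indicator A x + indicator (r 0) x :: real)"
        by (auto simp: indicator_def r_def fun_eq_iff)
      moreover have "approximable M e (\<lambda>x. (-1) * indicator A x + indicator (r 0) x)"
        using compl borel_r by (intro approximable_lin eL ind ap_r r) auto
      ultimately show ?case by simp
    next
      case (union A)
      have Ab: "A i \<in> sets borel" for i using union(2) borel_r by auto
      define B where "B n = (\<Union>i<n. A i)" for n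
      have Bb: "B n \<in> sets borel" for n unfolding B_def using Ab by auto
      have apB: "approximable M e (indicator (B n))" for n
      proof (induction n)
        case 0
        show ?case unfolding approximable_def B_def by (auto intro!: exI[of _ 0] simp: Lp_int_zero)
      next
        case (Suc n)
        have "A n \<inter> A i = {}" if "i < n" for i
          using disjoint_family_onD[OF union(1), of n i] that by simp
        then have "A n \<inter> B n = {}" unfolding B_def by blast
        moreover have "B (Suc n) = A n \<union> B n" unfolding B_def lessThan_Suc by blast
        ultimately have "indicator (B (Suc n)) = (\<lambda>x. 1 * indicator (A n) x + indicator (B n) x :: real)"
          by (auto simp: fun_eq_iff split: split_indicator)
        moreover have "approximable M e (\<lambda>x. 1 * indicator (A n) x + indicator (B n) x)"
          by (intro approximable_lin eL ind Ab Bb union(3) Suc)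
        ultimately show ?case by simp
      qed
      have U: "(\<Union>i. A i) \<in> sets borel" using Ab by auto
      show ?case
      proof (rule approximable_limit[OF eL])
        fix \<epsilon> :: real assume \<epsilon>: "0 < \<epsilon>"
        have "(\<lambda>n. emeasure M ((\<Union>i. A i) - B n)) \<longlonglongrightarrow> emeasure M (\<Inter>n. (\<Union>i. A i) - B n)"
          using Bb U by (intro Lim_emeasure_decseq) (auto simp: sets_M decseq_def B_def)
        moreover have "(\<Inter>n. (\<Union>i. A i) - B n) = {}" unfolding B_def by blast
        ultimately have "(\<lambda>n. emeasure M ((\<Union>i. A i) - B n)) \<longlonglongrightarrow> 0" by (simp only: emeasure_empty)
        then have "\<forall>\<^sub>F n in sequentially. emeasure M ((\<Union>i. A i) - B n) < ennreal \<epsilon>"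
          using \<epsilon> by (intro order_tendstoD) auto
        then obtain n where n: "emeasure M ((\<Union>i. A i) - B n) < ennreal \<epsilon>" by (auto simp: eventually_sequentially)
        have "(\<lambda>x. indicator (\<Union>i. A i) x - indicator (B n) x :: real) = indicator ((\<Union>i. A i) - B n)"
          unfolding B_def by (auto simp: fun_eq_iff split: split_indicator)
        with n have "Lp_int M 2 (\<lambda>x. indicator (\<Union>i. A i) x - indicator (B n) x) < ennreal \<epsilon>"
          using U Bb by (simp add: ind)
        with apB[of n] ind(1)[OF Bb]
        show "\<exists>g\<in>Lp M 2. approximable M e g \<and> Lp_int M 2 (\<lambda>x. indicator (\<Union>i. A i) x - g x) < ennreal \<epsilon>" by blast
      qed (rule ind(1)[OF U])
    qed
  qed
  have ap: "approximable M e g" if "g \<in> Lp M 2" for g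
    using that zero_less_numeral
  proof (induction rule: Lp_induct)
    case (indicator A)
    then show ?case by (intro ap_ind) (simp add: sets_M)
  next
    case (lin s f g)
    then show ?case by (intro approximable_lin eL)
  next
    case (dense f)
    show ?case using dense(2) by (intro approximable_limit[OF eL dense(1)]) force
  qed
  show thesis
  proof (rule that, unfold_locales)
    show "e k \<in> Lp M 2" for k by (rule eL)
    show "ip M (e k) (e k) = 1 \<or> e k = (\<lambda>_. 0)" for k
      unfolding e_def by (rule gram_schmidt_orthonormal(1)[where f=f, OF f])
    show "ip M (e j) (e k) = 0" if "j \<noteq> k" for j k
      using gram_schmidt_orthonormal(2)[where f=f and N=M and k=k and i=j, OF f]
        gram_schmidt_orthonormal(2)[where f=f and N=M and k=j and i=k, OF f] that
      unfolding e_def by (cases "j < k") (auto simp: ip_commute)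
    fix g and \<epsilon> :: ennreal assume g: "g \<in> Lp M 2" and \<epsilon>: "0 < \<epsilon>"
    obtain \<epsilon>' where \<epsilon>': "0 < \<epsilon>'" "ennreal \<epsilon>' \<le> \<epsilon>"
      using \<epsilon> by (cases \<epsilon>) (auto intro: that[of 1] simp: top_unique)
    with ap[OF g] show "\<exists>n d. Lp_int M 2 (\<lambda>x. g x - (\<Sum>k<n::nat. d k * e k x)) < \<epsilon>"
      unfolding approximable_def by (meson less_le_trans)
  qed
qed

section \<open>The Gaussian space over \<open>L\<^sub>2\<close>\<close>

text \<open>Riesz-Fischer: a fast subsequence converges almost everywhere because its increments
  have summable L_1 norms, and Fatou's lemma carries the Cauchy bounds over to the limit.\<close>

lemma (in finite_measure) L2_complete:
  assumes X: "\<And>n. X n \<in> Lp M 2"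
    and cauchy: "\<And>\<epsilon>::real. 0 < \<epsilon> \<Longrightarrow> \<exists>n0. \<forall>m\<ge>n0. \<forall>n\<ge>n0. Lp_int M 2 (\<lambda>x. X m x - X n x) \<le> ennreal \<epsilon>"
  shows "\<exists>F\<in>Lp M 2. (\<lambda>n. Lp_int M 2 (\<lambda>x. X n x - F x)) \<longlonglongrightarrow> 0"
proof -
  note [measurable] = Lp_measurable[OF X]
  \<comment> \<open>Second moments of order 4^(-i) give L_1 norms of order 2^(-i) through |D| <=
    2^(-i) + 2^i D^2; the constant term is integrable because the measure is finite.\<close>
  have "\<forall>i. \<exists>n0. \<forall>m\<ge>n0. \<forall>n\<ge>n0. Lp_int M 2 (\<lambda>x. X m x - X n x) \<le> ennreal ((1/4) ^ i)"
    by (intro allI cauchy) simp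
  then obtain r0 where r0: "\<And>i m n. r0 i \<le> m \<Longrightarrow> r0 i \<le> n \<Longrightarrow> Lp_int M 2 (\<lambda>x. X m x - X n x) \<le> ennreal ((1/4) ^ i)"
    by metis
  \<comment> \<open>Partial sums of \<open>r0\<close> are monotone and still dominate
    \<open>r0\<close>.\<close>
  define r where "r i = (\<Sum>j\<le>i. r0 j)" for i :: nat
  have r_ge: "r0 i \<le> r i" for i unfolding r_def by (rule member_le_sum) auto
  have r_mono: "r i \<le> r j" if "i \<le> j" for i j unfolding r_def using that by (intro sum_mono2) auto
  define D where "D i x = X (r (Suc i)) x - X (r i) x" for i x
  have Dm[measurable]: "D i \<in> borel_measurable M" for i unfolding D_def by measurable
  have D: "(\<integral>\<^sup>+x. ennreal \<bar>D i x\<bar> \<partial>M) \<le> ennreal ((1/2) ^ i * (measure M (space M) + 1))" for i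
  proof -
    have "Lp_int M 2 (D i) \<le> ennreal ((1/4) ^ i)"
      unfolding D_def using r_ge[of i] r_mono[of i "Suc i"] by (intro r0) auto
    then have L: "(\<integral>\<^sup>+x. ennreal ((D i x)\<^sup>2) \<partial>M) \<le> ennreal ((1/4) ^ i)" by (simp add: Lp_int_def)
    have "(\<integral>\<^sup>+x. ennreal \<bar>D i x\<bar> \<partial>M) \<le> (\<integral>\<^sup>+x. ennreal ((1/2) ^ i) + ennreal (2 ^ i) * ennreal ((D i x)\<^sup>2) \<partial>M)"
    proof (intro nn_integral_mono)
      fix x
      have "\<bar>D i x\<bar> \<le> (1/2) ^ i + 2 ^ i * (D i x)\<^sup>2"
      proof -
        have "0 \<le> (2 ^ i * \<bar>D i x\<bar> - 1/2)\<^sup>2" by simp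
        then have "2 ^ i * \<bar>D i x\<bar> \<le> 1 + 2 ^ i * (2 ^ i * (D i x)\<^sup>2)"
          by (simp add: power2_eq_square algebra_simps)
        also have "\<dots> = 2 ^ i * ((1/2) ^ i + 2 ^ i * (D i x)\<^sup>2)" by (simp add: algebra_simps power_divide)
        finally show ?thesis by simp
      qed
      then show "ennreal \<bar>D i x\<bar> \<le> ennreal ((1/2) ^ i) + ennreal (2 ^ i) * ennreal ((D i x)\<^sup>2)"
        by (subst ennreal_mult[symmetric]) (auto simp flip: ennreal_plus intro!: ennreal_leI)
    qed
    also have "\<dots> = ennreal ((1/2) ^ i) * emeasure M (space M) + ennreal (2 ^ i) * (\<integral>\<^sup>+x. ennreal ((D i x)\<^sup>2) \<partial>M)"
      by (simp add: nn_integral_add nn_integral_cmult)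
    also have "\<dots> \<le> ennreal ((1/2) ^ i) * emeasure M (space M) + ennreal (2 ^ i) * ennreal ((1/4) ^ i)"
      by (intro add_left_mono mult_left_mono L) auto
    also have "\<dots> = ennreal ((1/2) ^ i * measure M (space M) + 2 ^ i * (1/4) ^ i)"
      by (simp add: emeasure_eq_measure ennreal_mult)
    also have "(2::real) ^ i * (1/4) ^ i = (1/2) ^ i" by (simp flip: power_mult_distrib)
    finally show ?thesis by (simp add: distrib_left)
  qed
  have "(\<integral>\<^sup>+x. (\<Sum>i. ennreal \<bar>D i x\<bar>) \<partial>M) = (\<Sum>i. \<integral>\<^sup>+x. ennreal \<bar>D i x\<bar> \<partial>M)"
    by (intro nn_integral_suminf) auto
  also have "\<dots> \<le> (\<Sum>i. ennreal ((1/2) ^ i * (measure M (space M) + 1)))" by (intro suminf_le D) auto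
  also have "\<dots> = ennreal (\<Sum>i. (1/2) ^ i * (measure M (space M) + 1))"
    by (intro suminf_ennreal2) (auto intro!: summable_mult2 mult_nonneg_nonneg)
  also have "\<dots> < \<infinity>" by simp
  finally have "AE x in M. (\<Sum>i. ennreal \<bar>D i x\<bar>) \<noteq> \<infinity>" by (intro nn_integral_PInf_AE) auto
  define F where "F x = lim (\<lambda>i. X (r i) x)" for x
  have Fm[measurable]: "F \<in> borel_measurable M" unfolding F_def by measurable
  have lim: "AE x in M. (\<lambda>i. X (r i) x) \<longlonglongrightarrow> F x"
    using \<open>AE x in M. (\<Sum>i. ennreal \<bar>D i x\<bar>) \<noteq> \<infinity>\<close>
  proof eventually_elim
    case (elim x)
    then have "summable (\<lambda>i. \<bar>D i x\<bar>)" by (intro summable_suminf_not_top) auto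
    then have "summable (\<lambda>i. D i x)" by (rule summable_rabs_cancel)
    then have "convergent (\<lambda>i. \<Sum>j<i. D j x)" by (simp add: summable_iff_convergent)
    then have "convergent (\<lambda>i. X (r 0) x + (\<Sum>j<i. D j x))" by (intro convergent_add convergent_const)
    moreover have "X (r 0) x + (\<Sum>j<i. D j x) = X (r i) x" for i
      using sum_lessThan_telescope[of "\<lambda>j. X (r j) x" i] by (simp add: D_def)
    ultimately show ?case by (simp add: F_def convergent_LIMSEQ_iff)
  qed
  have bound: "Lp_int M 2 (\<lambda>x. X n x - F x) \<le> ennreal ((1/4) ^ i)" if "r0 i \<le> n" for i n
  proof -
    have "Lp_int M 2 (\<lambda>x. X n x - F x) = (\<integral>\<^sup>+x. liminf (\<lambda>k. ennreal (\<bar>X n x - X (r k) x\<bar> powr 2)) \<partial>M)"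
      unfolding Lp_int_def
    proof (rule nn_integral_cong_AE, use lim in eventually_elim)
      case (elim x)
      have "(\<lambda>k. \<bar>X n x - X (r k) x\<bar> powr 2) \<longlonglongrightarrow> \<bar>X n x - F x\<bar> powr 2"
        by (rule tendsto_powr2) (auto intro!: tendsto_intros elim)
      then have "(\<lambda>k. ennreal (\<bar>X n x - X (r k) x\<bar> powr 2)) \<longlonglongrightarrow> ennreal (\<bar>X n x - F x\<bar> powr 2)"
        by (rule tendsto_ennrealI)
      then show ?case by (intro lim_imp_Liminf[symmetric]) auto
    qed
    also have "\<dots> \<le> liminf (\<lambda>k. \<integral>\<^sup>+x. ennreal (\<bar>X n x - X (r k) x\<bar> powr 2) \<partial>M)"
      by (rule nn_integral_liminf) measurable
    also have "\<dots> \<le> limsup (\<lambda>k. \<integral>\<^sup>+x. ennreal (\<bar>X n x - X (r k) x\<bar> powr 2) \<partial>M)"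
      by (rule Liminf_le_Limsup) simp
    also have "\<dots> \<le> ennreal ((1/4) ^ i)"
    proof (rule Limsup_bounded)
      have "(\<integral>\<^sup>+x. ennreal (\<bar>X n x - X (r k) x\<bar> powr 2) \<partial>M) \<le> ennreal ((1/4) ^ i)" if "i \<le> k" for k
        using r0[OF \<open>r0 i \<le> n\<close>, of "r k"] r_ge[of i] r_mono[OF that] by (simp add: Lp_int_def)
      then show "\<forall>\<^sub>F k in sequentially. (\<integral>\<^sup>+x. ennreal (\<bar>X n x - X (r k) x\<bar> powr 2) \<partial>M) \<le> ennreal ((1/4) ^ i)"
        by (auto simp: eventually_sequentially)
    qed
    finally show ?thesis .
  qed
  have "(\<lambda>x. X (r0 0) x - F x) \<in> Lp M 2"
    using bound[of 0 "r0 0"] by (auto simp: Lp_def intro: le_less_trans)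
  then have "F \<in> Lp M 2" using Lp_diff[OF _ X[of "r0 0"], of "\<lambda>x. X (r0 0) x - F x"] by simp
  moreover have "(\<lambda>n. Lp_int M 2 (\<lambda>x. X n x - F x)) \<longlonglongrightarrow> 0"
  proof (rule order_tendstoI)
    fix a :: ennreal assume a: "0 < a"
    have "(\<lambda>i. ennreal ((1/4) ^ i)) \<longlonglongrightarrow> ennreal 0"
      by (intro tendsto_ennrealI LIMSEQ_realpow_zero) auto
    then have "\<forall>\<^sub>F i in sequentially. ennreal ((1/4) ^ i) < a" using a by (intro order_tendstoD(2)) auto
    then obtain i where "ennreal ((1/4) ^ i) < a" by (auto simp: eventually_sequentially)
    with bound[of i] show "\<forall>\<^sub>F n in sequentially. Lp_int M 2 (\<lambda>x. X n x - F x) < a"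
      unfolding eventually_sequentially by (intro exI[of _ "r0 i"]) (auto intro: le_less_trans)
  qed simp
  ultimately show ?thesis by blast
qed

lemma tendsto_fun_componentwise:
  fixes f :: "'i \<Rightarrow> nat \<Rightarrow> real"
  assumes "\<And>k. ((\<lambda>i. f i k) \<longlongrightarrow> l k) F"
  shows "(f \<longlongrightarrow> l) F"
proof -
  have "limitin (product_topology (\<lambda>_. euclidean) UNIV) f l F"
    using assms by (simp add: limitin_componentwise)
  then show ?thesis by (simp add: euclidean_product_topology)
qed

locale gauss_space = orthosystem N e for N :: "'a measure" and e
begin

text \<open>The centred Gaussian law of variance \<open>v k\<close>. A zero vector of the system
  receives the point mass at 0, so its coordinate vanishes with it.\<close>

definition \<gamma> :: "nat \<Rightarrow> real measure" where
  "\<gamma> k = (if v k = 0 then return borel 0 else std_normal_distribution)"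

definition \<Gamma> :: "(nat \<Rightarrow> real) measure" where
  "\<Gamma> = PiM UNIV \<gamma>"

lemma \<gamma>_real_distribution: "real_distribution (\<gamma> k)"
proof (cases "v k = 0")
  case True
  then show ?thesis
    by (auto simp: \<gamma>_def real_distribution_def real_distribution_axioms_def intro: prob_space_return)
qed (simp add: \<gamma>_def real_dist_normal_dist)

lemma sets_\<gamma>: "sets (\<gamma> k) = sets borel"
  using real_distribution.events_eq_borel[OF \<gamma>_real_distribution] .

lemma prob_space_\<gamma>: "prob_space (\<gamma> k)"
  using \<gamma>_real_distribution[of k] by (simp add: real_distribution_def)

lemma char_\<gamma>: "char (\<gamma> k) t = exp (- (v k * t\<^sup>2) / 2)"
proof (cases "v k = 0")
  case True
  then show ?thesis by (simp add: \<gamma>_def char_def integral_return)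
next
  case False
  then have "v k = 1" using v_cases[of k] by auto
  then show ?thesis by (simp add: \<gamma>_def char_std_normal_distribution)
qed

sublocale G: prob_space \<Gamma>
  unfolding \<Gamma>_def by (intro prob_space_PiM prob_space_\<gamma>)

lemma sets_\<Gamma> [measurable_cong]: "sets \<Gamma> = sets borel"
proof -
  have "sets \<Gamma> = sets (PiM UNIV (\<lambda>_. borel :: real measure))"
    unfolding \<Gamma>_def by (intro sets_PiM_cong sets_\<gamma> refl)
  then show ?thesis by (simp only: sets_PiM_equal_borel)
qed

lemma coordinate_law: "distr \<Gamma> borel (\<lambda>\<omega>. \<omega> k) = \<gamma> k"
proof -
  interpret product_prob_space \<gamma> UNIV
    by (intro product_prob_spaceI prob_space_\<gamma>)
  have "distr \<Gamma> borel (\<lambda>\<omega>. \<omega> k) = distr \<Gamma> (\<gamma> k) (\<lambda>\<omega>. \<omega> k)"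
    by (intro distr_cong refl) (simp add: sets_\<gamma>)
  then show ?thesis using PiM_component[of k] by (simp add: \<Gamma>_def)
qed

lemma coordinates_indep: "G.indep_vars (\<lambda>_. borel) (\<lambda>k \<omega>. d k * \<omega> k) UNIV"
proof -
  interpret product_prob_space \<gamma> UNIV
    by (intro product_prob_spaceI prob_space_\<gamma>)
  have "G.indep_vars \<gamma> (\<lambda>k \<omega>. \<omega> k) UNIV"
  proof (subst G.indep_vars_iff_distr_eq_PiM')
    show "(\<lambda>\<omega>. \<omega> k) \<in> measurable \<Gamma> (\<gamma> k)" for k unfolding \<Gamma>_def by measurable
    have "distr \<Gamma> (PiM UNIV \<gamma>) (\<lambda>x. \<lambda>i\<in>UNIV. x i) = \<Gamma>"
      unfolding \<Gamma>_def restrict_UNIV by (rule distr_id)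
    also have "\<dots> = PiM UNIV (\<lambda>k. distr \<Gamma> (\<gamma> k) (\<lambda>\<omega>. \<omega> k))"
      unfolding \<Gamma>_def by (intro PiM_cong refl) (simp add: PiM_component)
    finally show "distr \<Gamma> (PiM UNIV \<gamma>) (\<lambda>x. \<lambda>i\<in>UNIV. x i) = PiM UNIV (\<lambda>k. distr \<Gamma> (\<gamma> k) (\<lambda>\<omega>. \<omega> k))" .
  qed auto
  then show ?thesis
    by (rule G.indep_vars_compose2) (auto simp: measurable_cong_sets[OF sets_\<gamma> refl])
qed

lemma char_comb:
  "char (distr \<Gamma> borel (\<lambda>\<omega>. \<Sum>k<n. d k * \<omega> k)) t = exp (- ((\<Sum>k<n. (d k)\<^sup>2 * v k) * t\<^sup>2) / 2)"
proof -
  have "char (distr \<Gamma> borel (\<lambda>\<omega>. \<Sum>k<n. d k * \<omega> k)) t = (\<Prod>k<n. char (distr \<Gamma> borel (\<lambda>\<omega>. d k * \<omega> k)) t)"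
    by (rule G.char_distr_sum[OF G.indep_vars_subset[OF coordinates_indep]]) auto
  also have "\<dots> = (\<Prod>k<n. char (\<gamma> k) (t * d k))"
  proof (intro prod.cong refl)
    fix k
    have "char (distr \<Gamma> borel (\<lambda>\<omega>. d k * \<omega> k)) t = G.expectation (\<lambda>\<omega>. iexp (t * (d k * \<omega> k)))"
      by (rule G.char_distr_eq) measurable
    also have "\<dots> = (\<integral>x. iexp (t * (d k * x)) \<partial>distr \<Gamma> borel (\<lambda>\<omega>. \<omega> k))"
      by (rule integral_distr[symmetric]) measurable
    also have "\<dots> = char (\<gamma> k) (t * d k)" by (simp add: coordinate_law char_def mult.assoc)
    finally show "char (distr \<Gamma> borel (\<lambda>\<omega>. d k * \<omega> k)) t = char (\<gamma> k) (t * d k)" .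
  qed
  also have "\<dots> = exp (\<Sum>k<n. complex_of_real (- (v k * (t * d k)\<^sup>2) / 2))"
    by (simp add: char_\<gamma> exp_sum flip: exp_of_real)
  also have "(\<Sum>k<n. complex_of_real (- (v k * (t * d k)\<^sup>2) / 2)) = complex_of_real (- ((\<Sum>k<n. (d k)\<^sup>2 * v k) * t\<^sup>2) / 2)"
    unfolding of_real_sum[symmetric] sum_distrib_right sum_negf[symmetric] sum_divide_distrib
    by (simp add: power_mult_distrib mult_ac)
  finally show ?thesis by (simp flip: exp_of_real)
qed

lemma Lp_int_comb:
  fixes n :: nat
  shows "Lp_int \<Gamma> 2 (\<lambda>\<omega>. \<Sum>k<n. d k * \<omega> k) = ennreal (\<Sum>k<n. (d k)\<^sup>2 * v k)"
  by (rule G.gaussian_second_moment) (auto simp: char_comb[simplified] intro!: sum_nonneg mult_nonneg_nonneg v_nonneg)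

text \<open>Partial sums of the Gaussian series attached to the expansion of f.\<close>

definition X :: "('a \<Rightarrow> real) \<Rightarrow> nat \<Rightarrow> (nat \<Rightarrow> real) \<Rightarrow> real" where
  "X f n \<omega> = (\<Sum>k<n. ip N f (e k) * \<omega> k)"

lemma X_measurable [measurable]: "X f n \<in> borel_measurable borel"
  unfolding X_def by measurable

lemma X_L2: "X f n \<in> Lp \<Gamma> 2"
  using Lp_int_comb[where n=n and d="\<lambda>k. ip N f (e k)"] by (auto simp: Lp_def X_def[abs_def])

text \<open>The second moment of a difference of partial sums is the matching block of the Parseval
  series, so the sequence is Cauchy.\<close>

lemma L2_limit_exists:
  assumes f: "f \<in> Lp N 2"
  shows "\<exists>F\<in>Lp \<Gamma> 2. (\<lambda>n. Lp_int \<Gamma> 2 (\<lambda>\<omega>. X f n \<omega> - F \<omega>)) \<longlonglongrightarrow> 0"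
proof (rule G.L2_complete[OF X_L2])
  fix \<epsilon> :: real assume \<epsilon>: "0 < \<epsilon>"
  define a where "a k = (ip N f (e k))\<^sup>2" for k
  have "summable a" using parseval[OF f] by (simp add: a_def[abs_def] sums_iff)
  then have "Cauchy (\<lambda>n. \<Sum>k<n. a k)" by (simp add: summable_iff_convergent convergent_Cauchy)
  then obtain n0 where n0: "\<And>m n. n0 \<le> m \<Longrightarrow> n0 \<le> n \<Longrightarrow> norm ((\<Sum>k<m. a k) - (\<Sum>k<n. a k)) < \<epsilon>"
    using CauchyD[of "\<lambda>n. \<Sum>k<n. a k" \<epsilon>] \<epsilon> by blast
  have le: "Lp_int \<Gamma> 2 (\<lambda>\<omega>. X f n \<omega> - X f m \<omega>) \<le> ennreal \<epsilon>" if "n0 \<le> m" "m \<le> n" for m n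
  proof -
    have split: "{..<n} = {..<m} \<union> {m..<n}" using that by auto
    have "X f n \<omega> - X f m \<omega> = (\<Sum>k<n. (if k < m then 0 else ip N f (e k)) * \<omega> k)" for \<omega>
      unfolding X_def split by (subst (1 2) sum.union_disjoint) auto
    then have "Lp_int \<Gamma> 2 (\<lambda>\<omega>. X f n \<omega> - X f m \<omega>) = ennreal (\<Sum>k<n. (if k < m then 0 else ip N f (e k))\<^sup>2 * v k)"
      using Lp_int_comb[where n=n and d="\<lambda>k. if k < m then 0 else ip N f (e k)"] by simp
    also have "(\<Sum>k<n. (if k < m then 0 else ip N f (e k))\<^sup>2 * v k) = (\<Sum>k<n. a k) - (\<Sum>k<m. a k)"
    proof -
      have "(ip N f (e k))\<^sup>2 * v k = a k" for k
        using coeff_v[of f k] by (simp only: a_def power2_eq_square mult.assoc)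
      then show ?thesis unfolding split by (subst (1 2) sum.union_disjoint) auto
    qed
    also have "\<dots> \<le> \<epsilon>" using n0[of n m] that by simp
    finally show ?thesis by (simp add: ennreal_leI)
  qed
  show "\<exists>n0. \<forall>m\<ge>n0. \<forall>n\<ge>n0. Lp_int \<Gamma> 2 (\<lambda>\<omega>. X f m \<omega> - X f n \<omega>) \<le> ennreal \<epsilon>"
  proof (intro exI[of _ n0] allI impI)
    fix m n assume "n0 \<le> m" "n0 \<le> n"
    then show "Lp_int \<Gamma> 2 (\<lambda>\<omega>. X f m \<omega> - X f n \<omega>) \<le> ennreal \<epsilon>"
      using le[of m n] le[of n m] Lp_int_minus_commute[of \<Gamma> 2 "X f m" "X f n"] by (cases "m \<le> n") auto
  qed
qed

text \<open>The isonormal Gaussian process indexed by \<open>L\<^sub>2\<close>.\<close>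
definition \<iota> :: "('a \<Rightarrow> real) \<Rightarrow> (nat \<Rightarrow> real) \<Rightarrow> real" where
  "\<iota> f = (SOME F. F \<in> Lp \<Gamma> 2 \<and> (\<lambda>n. Lp_int \<Gamma> 2 (\<lambda>\<omega>. X f n \<omega> - F \<omega>)) \<longlonglongrightarrow> 0)"

lemma \<iota>_L2: "f \<in> Lp N 2 \<Longrightarrow> \<iota> f \<in> Lp \<Gamma> 2"
  and \<iota>_lim: "f \<in> Lp N 2 \<Longrightarrow> (\<lambda>n. Lp_int \<Gamma> 2 (\<lambda>\<omega>. X f n \<omega> - \<iota> f \<omega>)) \<longlonglongrightarrow> 0"
  using someI_ex[of "\<lambda>F. F \<in> Lp \<Gamma> 2 \<and> (\<lambda>n. Lp_int \<Gamma> 2 (\<lambda>\<omega>. X f n \<omega> - F \<omega>)) \<longlonglongrightarrow> 0"] L2_limit_exists[of f]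
  unfolding \<iota>_def by blast+

lemma \<iota>_measurable: "f \<in> Lp N 2 \<Longrightarrow> \<iota> f \<in> borel_measurable borel"
  using Lp_measurable[OF \<iota>_L2] by (simp add: measurable_cong_sets[OF sets_\<Gamma> refl])

text \<open>Along a fast subsequence the partial sums converge almost everywhere, so their
  characteristic functions converge by domination, while their variances converge by Parseval's
  identity.\<close>

lemma \<iota>_char:
  assumes f: "f \<in> Lp N 2"
  shows "char (distr \<Gamma> borel (\<iota> f)) t = exp (- (ip N f f * t\<^sup>2) / 2)"
proof -
  note [measurable] = \<iota>_measurable[OF f]
  have "\<exists>r. \<forall>n. n \<le> r n \<and> Lp_int \<Gamma> 2 (\<lambda>\<omega>. X f (r n) \<omega> - \<iota> f \<omega>) \<le> ennreal ((1/2) ^ n)"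
  proof (intro choice allI)
    fix n
    have "\<forall>\<^sub>F m in sequentially. Lp_int \<Gamma> 2 (\<lambda>\<omega>. X f m \<omega> - \<iota> f \<omega>) < ennreal ((1/2) ^ n)"
      using \<iota>_lim[OF f] by (rule order_tendstoD) simp
    then obtain m where m: "\<And>k. m \<le> k \<Longrightarrow> Lp_int \<Gamma> 2 (\<lambda>\<omega>. X f k \<omega> - \<iota> f \<omega>) < ennreal ((1/2) ^ n)"
      by (auto simp: eventually_sequentially)
    then show "\<exists>k. n \<le> k \<and> Lp_int \<Gamma> 2 (\<lambda>\<omega>. X f k \<omega> - \<iota> f \<omega>) \<le> ennreal ((1/2) ^ n)"
      by (intro exI[of _ "max m n"]) (auto intro: less_imp_le)
  qed
  then obtain r where r: "\<And>n. n \<le> r n" "\<And>n. Lp_int \<Gamma> 2 (\<lambda>\<omega>. X f (r n) \<omega> - \<iota> f \<omega>) \<le> ennreal ((1/2) ^ n)" by blast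
  have r_top: "filterlim r at_top sequentially"
    using r(1) by (intro filterlim_at_top_mono[OF filterlim_ident]) auto
  have "AE \<omega> in \<Gamma>. (\<lambda>n. X f (r n) \<omega> - \<iota> f \<omega>) \<longlonglongrightarrow> 0"
    using r(2) by (intro Lp_int_fast_AE_tendsto[where p=2]) auto
  then have "(\<lambda>n. G.expectation (\<lambda>\<omega>. iexp (t * X f (r n) \<omega>))) \<longlonglongrightarrow> G.expectation (\<lambda>\<omega>. iexp (t * \<iota> f \<omega>))"
    by (intro integral_dominated_convergence[where w="\<lambda>_. 1"])
       (auto elim!: eventually_mono simp: LIM_zero_iff intro!: tendsto_intros)
  then have "(\<lambda>n. char (distr \<Gamma> borel (X f (r n))) t) \<longlonglongrightarrow> char (distr \<Gamma> borel (\<iota> f)) t"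
    by (subst (1 2) G.char_distr_eq) auto
  moreover have "(\<lambda>n. char (distr \<Gamma> borel (X f (r n))) t) \<longlonglongrightarrow> exp (- (ip N f f * t\<^sup>2) / 2)"
  proof -
    have "(ip N f (e k))\<^sup>2 * v k = (ip N f (e k))\<^sup>2" for k
      using coeff_v[of f k] by (simp only: power2_eq_square mult.assoc)
    then have "char (distr \<Gamma> borel (X f n)) t = exp (- ((\<Sum>k<n. (ip N f (e k))\<^sup>2) * t\<^sup>2) / 2)" for n
      using char_comb[where n=n and d="\<lambda>k. ip N f (e k)" and t=t] by (simp only: X_def[abs_def])
    moreover have "(\<lambda>n. exp (- ((\<Sum>k<n. (ip N f (e k))\<^sup>2) * t\<^sup>2) / 2)) \<longlonglongrightarrow> exp (- (ip N f f * t\<^sup>2) / 2)"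
      using parseval[OF f] unfolding sums_def by (intro tendsto_intros) auto
    ultimately have "(\<lambda>n. char (distr \<Gamma> borel (X f n)) t) \<longlonglongrightarrow> complex_of_real (exp (- (ip N f f * t\<^sup>2) / 2))"
      by (simp only: tendsto_of_real_iff)
    from filterlim_compose[OF this r_top] show ?thesis .
  qed
  ultimately show ?thesis by (rule LIMSEQ_unique)
qed

lemma \<iota>_norm:
  assumes f: "f \<in> Lp N 2"
  shows "Lp_int \<Gamma> 2 (\<iota> f) = Lp_int N 2 f"
  unfolding L2_int[OF f]
  by (rule G.gaussian_second_moment[OF Lp_measurable[OF \<iota>_L2[OF f]] ip_nonneg \<iota>_char[OF f]])

text \<open>Identities for \<open>\<iota>\<close> are checked on partial sums and pass to the limit
  through this statement.\<close>

lemma L2_limit_unique: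
  assumes F: "F \<in> Lp \<Gamma> 2" and F': "F' \<in> Lp \<Gamma> 2" and Y: "\<And>n. Y n \<in> Lp \<Gamma> 2" and Z: "\<And>n. Z n \<in> Lp \<Gamma> 2"
    and YZ: "\<And>n. AE \<omega> in \<Gamma>. Y n \<omega> = Z n \<omega>"
    and lim: "(\<lambda>n. Lp_int \<Gamma> 2 (\<lambda>\<omega>. Y n \<omega> - F \<omega>)) \<longlonglongrightarrow> 0" "(\<lambda>n. Lp_int \<Gamma> 2 (\<lambda>\<omega>. Z n \<omega> - F' \<omega>)) \<longlonglongrightarrow> 0"
  shows "AE \<omega> in \<Gamma>. F \<omega> = F' \<omega>"
proof (rule Lp_AE_eqI)
  fix \<epsilon> :: ennreal assume "0 < \<epsilon>"
  then have "\<forall>\<^sub>F n in sequentially. Lp_int \<Gamma> 2 (\<lambda>\<omega>. Y n \<omega> - F \<omega>) < \<epsilon>" "\<forall>\<^sub>F n in sequentially. Lp_int \<Gamma> 2 (\<lambda>\<omega>. Z n \<omega> - F' \<omega>) < \<epsilon>"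
    using lim by (auto intro: order_tendstoD)
  then have "\<forall>\<^sub>F n in sequentially. Lp_int \<Gamma> 2 (\<lambda>\<omega>. Y n \<omega> - F \<omega>) < \<epsilon> \<and> Lp_int \<Gamma> 2 (\<lambda>\<omega>. Z n \<omega> - F' \<omega>) < \<epsilon>"
    by eventually_elim simp
  then obtain n where n: "Lp_int \<Gamma> 2 (\<lambda>\<omega>. Y n \<omega> - F \<omega>) < \<epsilon>" "Lp_int \<Gamma> 2 (\<lambda>\<omega>. Z n \<omega> - F' \<omega>) < \<epsilon>"
    by (auto simp: eventually_sequentially)
  have "Lp_int \<Gamma> 2 (\<lambda>\<omega>. F \<omega> - F' \<omega>) \<le> ennreal (2 powr 2) * (Lp_int \<Gamma> 2 (\<lambda>\<omega>. F \<omega> - Y n \<omega>) + Lp_int \<Gamma> 2 (\<lambda>\<omega>. Y n \<omega> - F' \<omega>))"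
    by (intro Lp_int_triangle Lp_measurable[OF F] Lp_measurable[OF F'] Lp_measurable[OF Y]) simp
  also have "Lp_int \<Gamma> 2 (\<lambda>\<omega>. Y n \<omega> - F' \<omega>) = Lp_int \<Gamma> 2 (\<lambda>\<omega>. Z n \<omega> - F' \<omega>)"
    by (rule Lp_int_cong_AE, use YZ[of n] in eventually_elim) simp
  also have "Lp_int \<Gamma> 2 (\<lambda>\<omega>. F \<omega> - Y n \<omega>) = Lp_int \<Gamma> 2 (\<lambda>\<omega>. Y n \<omega> - F \<omega>)" by (rule Lp_int_minus_commute)
  also have "ennreal (2 powr 2) * (Lp_int \<Gamma> 2 (\<lambda>\<omega>. Y n \<omega> - F \<omega>) + Lp_int \<Gamma> 2 (\<lambda>\<omega>. Z n \<omega> - F' \<omega>)) \<le> ennreal (2 powr 2) * (\<epsilon> + \<epsilon>)"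
    using n by (intro mult_left_mono add_mono) auto
  also have "\<dots> = ennreal (2 powr 2 * 2) * \<epsilon>"
    unfolding ennreal_mult[of "2 powr 2" 2, simplified] by (simp add: mult_2[symmetric] mult.assoc)
  finally show "Lp_int \<Gamma> 2 (\<lambda>\<omega>. F \<omega> - F' \<omega>) \<le> ennreal (2 powr 2 * 2) * \<epsilon>" .
qed (rule Lp_measurable[OF F] Lp_measurable[OF F'])+

lemma \<iota>_lin:
  assumes f: "f \<in> Lp N 2" and g: "g \<in> Lp N 2"
  shows "AE \<omega> in \<Gamma>. \<iota> (\<lambda>x. s * f x + g x) \<omega> = s * \<iota> f \<omega> + \<iota> g \<omega>"
proof (rule L2_limit_unique)
  have fg: "(\<lambda>x. s * f x + g x) \<in> Lp N 2" by (intro Lp_add Lp_scale f g) simp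
  show "\<iota> (\<lambda>x. s * f x + g x) \<in> Lp \<Gamma> 2" by (rule \<iota>_L2[OF fg])
  show "(\<lambda>\<omega>. s * \<iota> f \<omega> + \<iota> g \<omega>) \<in> Lp \<Gamma> 2" by (intro Lp_add Lp_scale \<iota>_L2 f g) simp
  show "X (\<lambda>x. s * f x + g x) n \<in> Lp \<Gamma> 2" for n by (rule X_L2)
  show "(\<lambda>\<omega>. s * X f n \<omega> + X g n \<omega>) \<in> Lp \<Gamma> 2" for n
    by (intro Lp_add Lp_scale X_L2) simp
  show "AE \<omega> in \<Gamma>. X (\<lambda>x. s * f x + g x) n \<omega> = s * X f n \<omega> + X g n \<omega>" for n
    by (simp add: X_def ip_lin[OF f g e_L2] distrib_right sum.distrib sum_distrib_left mult.assoc)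
  show "(\<lambda>n. Lp_int \<Gamma> 2 (\<lambda>\<omega>. X (\<lambda>x. s * f x + g x) n \<omega> - \<iota> (\<lambda>x. s * f x + g x) \<omega>)) \<longlonglongrightarrow> 0" by (rule \<iota>_lim[OF fg])
  have [measurable]: "\<iota> f \<in> borel_measurable \<Gamma>" "\<iota> g \<in> borel_measurable \<Gamma>" by (intro Lp_measurable[OF \<iota>_L2] f g)+
  let ?C = "\<lambda>n. ennreal (2 powr 2) * (ennreal (\<bar>s\<bar> powr 2) * Lp_int \<Gamma> 2 (\<lambda>\<omega>. X f n \<omega> - \<iota> f \<omega>) + Lp_int \<Gamma> 2 (\<lambda>\<omega>. X g n \<omega> - \<iota> g \<omega>))"
  have le: "Lp_int \<Gamma> 2 (\<lambda>\<omega>. s * X f n \<omega> + X g n \<omega> - (s * \<iota> f \<omega> + \<iota> g \<omega>)) \<le> ?C n" for n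
  proof -
    have "Lp_int \<Gamma> 2 (\<lambda>\<omega>. s * X f n \<omega> + X g n \<omega> - (s * \<iota> f \<omega> + \<iota> g \<omega>))
      = Lp_int \<Gamma> 2 (\<lambda>\<omega>. s * (X f n \<omega> - \<iota> f \<omega>) + (X g n \<omega> - \<iota> g \<omega>))" by (simp add: algebra_simps)
    also have "\<dots> \<le> ennreal (2 powr 2) * (Lp_int \<Gamma> 2 (\<lambda>\<omega>. s * (X f n \<omega> - \<iota> f \<omega>)) + Lp_int \<Gamma> 2 (\<lambda>\<omega>. X g n \<omega> - \<iota> g \<omega>))"
      by (intro Lp_int_add_le) auto
    also have "Lp_int \<Gamma> 2 (\<lambda>\<omega>. s * (X f n \<omega> - \<iota> f \<omega>)) = ennreal (\<bar>s\<bar> powr 2) * Lp_int \<Gamma> 2 (\<lambda>\<omega>. X f n \<omega> - \<iota> f \<omega>)"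
      by (intro Lp_int_scale) auto
    finally show ?thesis .
  qed
  have "?C \<longlonglongrightarrow> ennreal (2 powr 2) * (ennreal (\<bar>s\<bar> powr 2) * 0 + 0)"
    by (intro ennreal_tendsto_cmult tendsto_add \<iota>_lim f g) auto
  then have "?C \<longlonglongrightarrow> 0" by simp
  then show "(\<lambda>n. Lp_int \<Gamma> 2 (\<lambda>\<omega>. s * X f n \<omega> + X g n \<omega> - (s * \<iota> f \<omega> + \<iota> g \<omega>))) \<longlonglongrightarrow> 0"
  proof (rule tendsto_sandwich[OF _ _ tendsto_const, rotated 2])
    show "\<forall>\<^sub>F n in sequentially. Lp_int \<Gamma> 2 (\<lambda>\<omega>. s * X f n \<omega> + X g n \<omega> - (s * \<iota> f \<omega> + \<iota> g \<omega>)) \<le> ?C n"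
      by (intro always_eventually allI le)
  qed simp
qed

lemma \<iota>_diff:
  assumes f: "f \<in> Lp N 2" and g: "g \<in> Lp N 2"
  shows "Lp_int \<Gamma> 2 (\<lambda>\<omega>. \<iota> f \<omega> - \<iota> g \<omega>) = Lp_int N 2 (\<lambda>x. f x - g x)"
proof -
  have "AE \<omega> in \<Gamma>. \<iota> f \<omega> - \<iota> g \<omega> = \<iota> (\<lambda>x. f x - g x) \<omega>"
    using \<iota>_lin[OF g f, of "-1"] by eventually_elim simp
  then have "Lp_int \<Gamma> 2 (\<lambda>\<omega>. \<iota> f \<omega> - \<iota> g \<omega>) = Lp_int \<Gamma> 2 (\<iota> (\<lambda>x. f x - g x))" by (rule Lp_int_cong_AE)
  also have "\<dots> = Lp_int N 2 (\<lambda>x. f x - g x)" by (intro \<iota>_norm Lp_diff f g) simp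
  finally show ?thesis .
qed

lemma \<iota>_cong:
  assumes f: "f \<in> Lp N 2" and g: "g \<in> Lp N 2" and "AE x in N. f x = g x"
  shows "AE \<omega> in \<Gamma>. \<iota> f \<omega> = \<iota> g \<omega>"
proof -
  have "Lp_int N 2 (\<lambda>x. f x - g x) = Lp_int N 2 (\<lambda>_. 0)"
    by (rule Lp_int_cong_AE, use assms(3) in eventually_elim) simp
  then have "Lp_int \<Gamma> 2 (\<lambda>\<omega>. \<iota> f \<omega> - \<iota> g \<omega>) = 0" by (simp add: \<iota>_diff[OF f g] Lp_int_zero)
  moreover have "(\<lambda>\<omega>. \<iota> f \<omega> - \<iota> g \<omega>) \<in> borel_measurable \<Gamma>"
    by (intro borel_measurable_diff Lp_measurable[OF \<iota>_L2] f g)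
  ultimately show ?thesis by (auto simp: Lp_int_eq_0_iff)
qed

lemma \<iota>_comb:
  fixes n :: nat
  assumes u: "\<And>k. u k \<in> Lp N 2"
  shows "AE \<omega> in \<Gamma>. \<iota> (\<lambda>x. \<Sum>k<n. d k * u k x) \<omega> = (\<Sum>k<n. d k * \<iota> (u k) \<omega>)"
proof (induction n)
  case 0
  have "Lp_int \<Gamma> 2 (\<iota> (\<lambda>_. 0)) = 0" using \<iota>_norm[OF Lp_zero] by (simp add: Lp_int_zero)
  then show ?case using Lp_measurable[OF \<iota>_L2[OF Lp_zero]] by (simp add: Lp_int_eq_0_iff)
next
  case (Suc n)
  have "AE \<omega> in \<Gamma>. \<iota> (\<lambda>x. d n * u n x + (\<Sum>k<n. d k * u k x)) \<omega> = d n * \<iota> (u n) \<omega> + \<iota> (\<lambda>x. \<Sum>k<n. d k * u k x) \<omega>"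
    by (intro \<iota>_lin L2_sum u)
  with Suc show ?case by eventually_elim (simp add: add.commute)
qed

text \<open>Partial sums are taken from length \<open>Suc k\<close> on, where the k-th term is
  already present; by orthogonality they all equal \<open>v k\<close> times the coordinate. If
  \<open>v k\<close> = 0, the coordinate vanishes almost everywhere.\<close>

lemma \<iota>_e: "AE \<omega> in \<Gamma>. \<iota> (e k) \<omega> = \<omega> k"
proof (rule L2_limit_unique[where Y="\<lambda>n. X (e k) (Suc k + n)" and Z="\<lambda>n \<omega>. \<omega> k"])
  have coord: "AE \<omega> in \<Gamma>. v k * \<omega> k = \<omega> k"
  proof (cases "v k = 0")
    case True
    have "AE x in return borel (0::real). x = 0" by (subst AE_return) auto
    moreover have "\<gamma> k = return borel 0" using True by (simp add: \<gamma>_def)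
    ultimately have "AE x in \<gamma> k. x = 0" by (simp only:)
    then have "AE x in distr \<Gamma> borel (\<lambda>\<omega>. \<omega> k). x = 0" by (simp only: coordinate_law)
    then have "AE \<omega> in \<Gamma>. \<omega> k = 0" by (subst (asm) AE_distr_iff) auto
    then show ?thesis by eventually_elim (simp add: True)
  qed (use v_cases[of k] in auto)
  have "(\<lambda>\<omega>. \<Sum>j<Suc k. (if j = k then 1 else 0) * \<omega> j) = (\<lambda>\<omega>. \<omega> k :: real)" by (simp add: if_distrib[of "\<lambda>x. x * _"] cong: if_cong)
  then have "Lp_int \<Gamma> 2 (\<lambda>\<omega>. \<omega> k) < \<infinity>"
    using Lp_int_comb[where n="Suc k" and d="\<lambda>j. if j = k then 1 else 0"] by simp
  then show "(\<lambda>\<omega>. \<omega> k) \<in> Lp \<Gamma> 2" "(\<lambda>\<omega>. \<omega> k) \<in> Lp \<Gamma> 2" by (auto simp: Lp_def)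
  show "\<iota> (e k) \<in> Lp \<Gamma> 2" by (rule \<iota>_L2[OF e_L2])
  show "X (e k) (Suc k + n) \<in> Lp \<Gamma> 2" for n by (rule X_L2)
  have "X (e k) (Suc k + n) \<omega> = v k * \<omega> k" for n \<omega>
  proof -
    have "X (e k) (Suc k + n) \<omega> = (\<Sum>j<Suc k + n. if j = k then v k * \<omega> k else 0)"
      unfolding X_def by (intro sum.cong) (auto simp: v_def e_orth)
    then show ?thesis by simp
  qed
  with coord show "AE \<omega> in \<Gamma>. X (e k) (Suc k + n) \<omega> = \<omega> k" for n by simp
  show "(\<lambda>n. Lp_int \<Gamma> 2 (\<lambda>\<omega>. X (e k) (Suc k + n) \<omega> - \<iota> (e k) \<omega>)) \<longlonglongrightarrow> 0"
    using LIMSEQ_ignore_initial_segment[OF \<iota>_lim[OF e_L2[of k]], of "Suc k"] by (simp add: add.commute)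
  show "(\<lambda>n. Lp_int \<Gamma> 2 (\<lambda>\<omega>. \<omega> k - \<omega> k)) \<longlonglongrightarrow> 0" by (simp add: Lp_int_zero)
qed

end

section \<open>Orthogonal maps as point maps of the Gaussian space\<close>

locale Lp_rep_gauss = Lp_rep M 2 U b + gauss_space M e
  for M and U :: "'g::topological_group_add \<Rightarrow> (real \<Rightarrow> real) \<Rightarrow> real \<Rightarrow> real" and b e
begin

text \<open>The coordinates are the random variables \<open>\<iota> (e k)\<close>, so a point map is
  determined by saying that its k-th coordinate is \<open>\<iota> (U g (e k))\<close>.\<close>

definition S :: "'g \<Rightarrow> (nat \<Rightarrow> real) \<Rightarrow> nat \<Rightarrow> real" where
  "S g \<omega> k = \<iota> (U g (e k)) \<omega>"

lemma S_coordinate_measurable: "(\<lambda>\<omega>. S g \<omega> k) \<in> borel_measurable borel"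
  unfolding S_def by (intro \<iota>_measurable U_Lp e_L2)

lemma S_measurable [measurable]: "S g \<in> borel_measurable borel"
  by (intro measurable_coordinatewise_then_product S_coordinate_measurable)

lemma U_comb:
  fixes n :: nat
  assumes u: "\<And>k. u k \<in> Lp M 2"
  shows "AE x in M. U g (\<lambda>x. \<Sum>k<n. d k * u k x) x = (\<Sum>k<n. d k * U g (u k) x)"
proof (induction n)
  case 0
  have "Lp_int M 2 (U g (\<lambda>_. 0)) = 0" using U_iso[OF Lp_zero] by (simp add: Lp_int_zero)
  then show ?case using Lp_measurable[OF U_Lp[OF Lp_zero]] by (simp add: Lp_int_eq_0_iff)
next
  case (Suc n)
  have "AE x in M. U g (\<lambda>x. d n * u n x + (\<Sum>k<n. d k * u k x)) x = d n * U g (u n) x + U g (\<lambda>x. \<Sum>k<n. d k * u k x) x"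
    by (intro U_lin L2_sum u)
  with Suc show ?case by eventually_elim (simp add: add.commute)
qed

lemma \<iota>_U_comb:
  fixes n :: nat
  shows "AE \<omega> in \<Gamma>. (\<Sum>k<n. d k * S g \<omega> k) = \<iota> (U g (\<lambda>x. \<Sum>k<n. d k * e k x)) \<omega>"
proof -
  have "AE \<omega> in \<Gamma>. \<iota> (U g (\<lambda>x. \<Sum>k<n. d k * e k x)) \<omega> = \<iota> (\<lambda>x. \<Sum>k<n. d k * U g (e k) x) \<omega>"
    by (intro \<iota>_cong U_Lp L2_sum e_L2 U_comb)
  moreover have "AE \<omega> in \<Gamma>. \<iota> (\<lambda>x. \<Sum>k<n. d k * U g (e k) x) \<omega> = (\<Sum>k<n. d k * \<iota> (U g (e k)) \<omega>)"
    by (intro \<iota>_comb U_Lp e_L2)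
  ultimately show ?thesis by eventually_elim (simp add: S_def)
qed

lemma ip_U: "f \<in> Lp M 2 \<Longrightarrow> ip M (U g f) (U g f) = ip M f f"
  using U_iso[of f g] by (simp add: L2_int U_Lp ip_nonneg)

text \<open>A finite combination of the new coordinates with coefficients t is
  \<open>\<iota>\<close> of the image under \<open>U g\<close> of the same combination of the
  \<open>e k\<close>. Orthogonality leaves its variance equal to the sum of t_k^2
  \<open>v k\<close>, so the joint characteristic function is that of the product measure.\<close>

lemma S_law: "distr \<Gamma> borel (S g) = \<Gamma>"
proof -
  have "distr \<Gamma> (PiM UNIV \<gamma>) (\<lambda>\<omega> k. S g \<omega> k) = PiM UNIV \<gamma>"
  proof (rule G.char_determines_product_law[OF _ \<gamma>_real_distribution])
    show "(\<lambda>\<omega>. S g \<omega> k) \<in> borel_measurable \<Gamma>" for k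
      using S_coordinate_measurable by (simp add: measurable_cong_sets[OF sets_\<Gamma> refl])
    fix n and t :: "nat \<Rightarrow> real"
    let ?f = "\<lambda>x. \<Sum>k<n. t k * e k x"
    have f: "?f \<in> Lp M 2" by (rule L2_sum[OF e_L2])
    have "G.expectation (\<lambda>\<omega>. \<Prod>k<n. iexp (t k * S g \<omega> k)) = G.expectation (\<lambda>\<omega>. iexp (1 * \<iota> (U g ?f) \<omega>))"
    proof (rule integral_cong_AE)
      have "AE \<omega> in \<Gamma>. (\<Sum>k<n. t k * S g \<omega> k) = \<iota> (U g ?f) \<omega>" by (rule \<iota>_U_comb)
      then show "AE \<omega> in \<Gamma>. (\<Prod>k<n. iexp (t k * S g \<omega> k)) = iexp (1 * \<iota> (U g ?f) \<omega>)"
      proof eventually_elim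
        case (elim \<omega>)
        have "(\<Prod>k<n. iexp (t k * S g \<omega> k)) = exp (\<Sum>k<n. \<i> * complex_of_real (t k * S g \<omega> k))"
          by (rule exp_sum[symmetric]) simp
        also have "(\<Sum>k<n. \<i> * complex_of_real (t k * S g \<omega> k)) = \<i> * complex_of_real (\<Sum>k<n. t k * S g \<omega> k)"
          by (simp only: of_real_sum sum_distrib_left)
        finally show ?case by (simp only: elim mult_1)
      qed
      note [measurable] = S_coordinate_measurable \<iota>_measurable[OF U_Lp[OF f]]
      show "(\<lambda>\<omega>. \<Prod>k<n. iexp (t k * S g \<omega> k)) \<in> borel_measurable \<Gamma>" by measurable
      show "(\<lambda>\<omega>. iexp (1 * \<iota> (U g ?f) \<omega>)) \<in> borel_measurable \<Gamma>" by measurable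
    qed
    also have "\<dots> = char (distr \<Gamma> borel (\<iota> (U g ?f))) 1"
      by (rule G.char_distr_eq[symmetric]) (rule Lp_measurable[OF \<iota>_L2[OF U_Lp[OF f]]])
    also have "\<dots> = exp (- ((\<Sum>k<n. (t k)\<^sup>2 * v k) * 1\<^sup>2) / 2)"
      unfolding \<iota>_char[OF U_Lp[OF f]] ip_U[OF f] ip_comb ..
    also have "\<dots> = (\<Prod>k<n. char (\<gamma> k) (t k))"
    proof -
      have "- ((\<Sum>k<n. (t k)\<^sup>2 * v k) * 1\<^sup>2) / 2 = (\<Sum>k<n. - (v k * (t k)\<^sup>2) / 2)"
        unfolding sum_distrib_right sum_negf[symmetric] sum_divide_distrib by (simp add: mult_ac)
      then show ?thesis by (simp only: exp_sum finite_lessThan char_\<gamma> of_real_prod)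
    qed
    finally show "G.expectation (\<lambda>\<omega>. \<Prod>k<n. iexp (t k * S g \<omega> k)) = (\<Prod>k<n. char (\<gamma> k) (t k))" .
  qed
  moreover have "distr \<Gamma> borel (S g) = distr \<Gamma> (PiM UNIV \<gamma>) (\<lambda>\<omega> k. S g \<omega> k)"
    using sets_\<Gamma> by (intro distr_cong) (auto simp: \<Gamma>_def)
  ultimately show ?thesis by (simp add: \<Gamma>_def)
qed

lemma S_law': "S g \<in> measurable \<Gamma> \<Gamma>" "distr \<Gamma> \<Gamma> (S g) = \<Gamma>"
proof -
  show "S g \<in> measurable \<Gamma> \<Gamma>" by measurable
  have "distr \<Gamma> \<Gamma> (S g) = distr \<Gamma> borel (S g)" by (intro distr_cong sets_\<Gamma> refl)
  then show "distr \<Gamma> \<Gamma> (S g) = \<Gamma>" by (simp add: S_law)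
qed

text \<open>It holds for finite combinations of the \<open>e k\<close> by construction. Both sides
  are continuous in f: the left because \<open>S g\<close> preserves \<open>\<Gamma>\<close>, the
  right because \<open>U g\<close> and \<open>\<iota>\<close> are isometric.\<close>

lemma \<iota>_S:
  assumes f: "f \<in> Lp M 2"
  shows "AE \<omega> in \<Gamma>. \<iota> f (S g \<omega>) = \<iota> (U g f) \<omega>"
proof -
  define P where "P n x = (\<Sum>k<n. ip M f (e k) * e k x)" for n x
  have P: "P n \<in> Lp M 2" for n unfolding P_def by (rule L2_sum[OF e_L2])
  have comp: "(\<lambda>\<omega>. F (S g \<omega>)) \<in> Lp \<Gamma> 2" if F: "F \<in> Lp \<Gamma> 2" for F
  proof -
    note [measurable] = Lp_measurable[OF F] S_law'(1)
    show ?thesis using F Lp_int_distr[OF S_law'(1) Lp_measurable[OF F] S_law'(2), of 2] by (simp add: Lp_def)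
  qed
  show ?thesis
  proof (rule L2_limit_unique[where Y="\<lambda>n \<omega>. X f n (S g \<omega>)" and Z="\<lambda>n. \<iota> (U g (P n))"])
    show "(\<lambda>\<omega>. \<iota> f (S g \<omega>)) \<in> Lp \<Gamma> 2" by (rule comp[OF \<iota>_L2[OF f]])
    show "\<iota> (U g f) \<in> Lp \<Gamma> 2" by (intro \<iota>_L2 U_Lp f)
    show "(\<lambda>\<omega>. X f n (S g \<omega>)) \<in> Lp \<Gamma> 2" for n by (rule comp[OF X_L2])
    show "\<iota> (U g (P n)) \<in> Lp \<Gamma> 2" for n by (intro \<iota>_L2 U_Lp P)
    show "AE \<omega> in \<Gamma>. X f n (S g \<omega>) = \<iota> (U g (P n)) \<omega>" for n
      unfolding X_def P_def by (rule \<iota>_U_comb)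
    have "Lp_int \<Gamma> 2 (\<lambda>\<omega>. X f n (S g \<omega>) - \<iota> f (S g \<omega>)) = Lp_int \<Gamma> 2 (\<lambda>\<omega>. X f n \<omega> - \<iota> f \<omega>)" for n
      by (rule Lp_int_distr[OF S_law'(1) _ S_law'(2)])
         (intro borel_measurable_diff Lp_measurable[OF X_L2] Lp_measurable[OF \<iota>_L2[OF f]])
    with \<iota>_lim[OF f] show "(\<lambda>n. Lp_int \<Gamma> 2 (\<lambda>\<omega>. X f n (S g \<omega>) - \<iota> f (S g \<omega>))) \<longlonglongrightarrow> 0" by simp
    have "Lp_int \<Gamma> 2 (\<lambda>\<omega>. \<iota> (U g (P n)) \<omega> - \<iota> (U g f) \<omega>) = Lp_int M 2 (\<lambda>x. f x - P n x)" for n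
      using \<iota>_diff[OF U_Lp[OF P] U_Lp[OF f]] U_dist[OF P f] Lp_int_minus_commute[of M 2 "P n" f] by simp
    with projection_tendsto[OF f] show "(\<lambda>n. Lp_int \<Gamma> 2 (\<lambda>\<omega>. \<iota> (U g (P n)) \<omega> - \<iota> (U g f) \<omega>)) \<longlonglongrightarrow> 0"
      by (simp add: P_def)
  qed
qed

text \<open>With \<open>c\<close> = 1 the push condition says that the point maps preserve
  \<open>\<Gamma>\<close>. As \<open>\<iota>\<close> is an L_2 isometry, passing from
  \<open>b\<close> to \<open>\<iota> (b g)\<close> keeps the integrals of squares.\<close>

theorem skew: "skew_system \<Gamma> 2 S (\<lambda>_ _. 1) (\<lambda>g. \<iota> (b g))"
proof (intro skew_system.intro skew_system_axioms.intro)
  show "finite_measure \<Gamma>" by (rule G.finite_measure_axioms)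
  show "sets \<Gamma> = sets borel" by (rule sets_\<Gamma>)
  fix g g' :: 'g
  show "S g \<in> borel_measurable borel" by measurable
  show "\<iota> (b g) \<in> borel_measurable borel" by (rule \<iota>_measurable[OF b_Lp])
  show "(\<integral>\<^sup>+\<omega>. ennreal (\<bar>1\<bar> powr 2) * indicator A (S g \<omega>) \<partial>\<Gamma>) = emeasure \<Gamma> A" if A: "A \<in> sets borel" for A
  proof -
    have "(\<integral>\<^sup>+\<omega>. indicator A \<omega> \<partial>distr \<Gamma> borel (S g)) = (\<integral>\<^sup>+\<omega>. indicator A (S g \<omega>) \<partial>\<Gamma>)"
      using A by (intro nn_integral_distr) auto
    then show ?thesis using A by (simp add: S_law sets_\<Gamma>)
  qed
  have "AE \<omega> in \<Gamma>. \<forall>k. S 0 \<omega> k = \<omega> k"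
    unfolding AE_all_countable
  proof
    fix k
    have "AE \<omega> in \<Gamma>. \<iota> (U 0 (e k)) \<omega> = \<iota> (e k) \<omega>" by (intro \<iota>_cong U_Lp e_L2 U_0)
    with \<iota>_e[of k] show "AE \<omega> in \<Gamma>. S 0 \<omega> k = \<omega> k"
      by eventually_elim (simp add: S_def)
  qed
  then show "AE \<omega> in \<Gamma>. S 0 \<omega> = \<omega>" by eventually_elim auto
  have "AE \<omega> in \<Gamma>. \<forall>k. S (g + g') \<omega> k = S g' (S g \<omega>) k"
    unfolding AE_all_countable
  proof
    fix k
    have "AE \<omega> in \<Gamma>. \<iota> (U (g + g') (e k)) \<omega> = \<iota> (U g (U g' (e k))) \<omega>"
      by (intro \<iota>_cong U_Lp e_L2 U_add)
    moreover have "AE \<omega> in \<Gamma>. \<iota> (U g' (e k)) (S g \<omega>) = \<iota> (U g (U g' (e k))) \<omega>"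
      by (intro \<iota>_S U_Lp e_L2)
    ultimately show "AE \<omega> in \<Gamma>. S (g + g') \<omega> k = S g' (S g \<omega>) k"
      by eventually_elim (simp add: S_def)
  qed
  then show "AE \<omega> in \<Gamma>. S (g + g') \<omega> = S g' (S g \<omega>)" by eventually_elim auto
  have "AE \<omega> in \<Gamma>. \<iota> (b (g + g')) \<omega> = \<iota> (\<lambda>x. 1 * U g (b g') x + b g x) \<omega>"
    using b_add by (intro \<iota>_cong Lp_add Lp_scale U_Lp b_Lp) auto
  moreover have "AE \<omega> in \<Gamma>. \<iota> (\<lambda>x. 1 * U g (b g') x + b g x) \<omega> = 1 * \<iota> (U g (b g')) \<omega> + \<iota> (b g) \<omega>"
    by (intro \<iota>_lin U_Lp b_Lp)
  moreover have "AE \<omega> in \<Gamma>. \<iota> (b g') (S g \<omega>) = \<iota> (U g (b g')) \<omega>" by (intro \<iota>_S b_Lp)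
  ultimately show "AE \<omega> in \<Gamma>. \<iota> (b (g + g')) \<omega> = 1 * \<iota> (b g') (S g \<omega>) + \<iota> (b g) \<omega>"
    by eventually_elim simp
  \<comment> \<open>One neighbourhood can control only finitely many coordinates at once; the n-th
    one controls those up to n.\<close>
  define P where "P n h \<longleftrightarrow> (\<forall>k\<in>{..n}. Lp_int M 2 (\<lambda>x. U h (e k) x - U g (e k) x) < ennreal ((1/2) ^ n)) \<and>
      Lp_int M 2 (\<lambda>x. b h x - b g x) < ennreal ((1/2) ^ n)" for n :: nat and h
  have "\<forall>\<^sub>F h in nhds g. P n h" for n
    unfolding P_def by (intro eventually_conj eventually_ball_finite ballI U_cont b_cont e_L2) auto
  moreover have "AE \<omega> in \<Gamma>. (\<lambda>n. S (\<gamma>' n) \<omega>) \<longlonglongrightarrow> S g \<omega> \<and> (\<lambda>n. 1::real) \<longlonglongrightarrow> 1 \<and> (\<lambda>n. \<iota> (b (\<gamma>' n)) \<omega>) \<longlonglongrightarrow> \<iota> (b g) \<omega>"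
    if P: "\<forall>n. P n (\<gamma>' n)" for \<gamma>'
  proof -
    have "AE \<omega> in \<Gamma>. (\<lambda>n. \<iota> (b (\<gamma>' n)) \<omega> - \<iota> (b g) \<omega>) \<longlonglongrightarrow> 0"
      using P by (intro Lp_int_fast_AE_tendsto[where p=2] borel_measurable_diff Lp_measurable[OF \<iota>_L2] b_Lp)
        (auto simp: P_def \<iota>_diff[OF b_Lp b_Lp] intro: less_imp_le)
    moreover have "AE \<omega> in \<Gamma>. \<forall>k. (\<lambda>n. S (\<gamma>' n) \<omega> k) \<longlonglongrightarrow> S g \<omega> k"
      unfolding AE_all_countable
    proof
      fix k
      \<comment> \<open>For a fixed k the sequence is started at index k, from where on the
        neighbourhoods do control \<open>e k\<close>.\<close>
      have "AE \<omega> in \<Gamma>. (\<lambda>n. \<iota> (U (\<gamma>' (n + k)) (e k)) \<omega> - \<iota> (U g (e k)) \<omega>) \<longlonglongrightarrow> 0"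
      proof (rule Lp_int_fast_AE_tendsto[where p=2])
        show "(\<lambda>\<omega>. \<iota> (U (\<gamma>' (n + k)) (e k)) \<omega> - \<iota> (U g (e k)) \<omega>) \<in> borel_measurable \<Gamma>" for n
          by (intro borel_measurable_diff Lp_measurable[OF \<iota>_L2] U_Lp e_L2)
        fix n
        have "Lp_int \<Gamma> 2 (\<lambda>\<omega>. \<iota> (U (\<gamma>' (n + k)) (e k)) \<omega> - \<iota> (U g (e k)) \<omega>) < ennreal ((1/2) ^ (n + k))"
          using P unfolding \<iota>_diff[OF U_Lp[OF e_L2] U_Lp[OF e_L2]] P_def by auto
        also have "\<dots> \<le> ennreal ((1/2) ^ n)" by (intro ennreal_leI power_decreasing) auto
        finally show "Lp_int \<Gamma> 2 (\<lambda>\<omega>. \<iota> (U (\<gamma>' (n + k)) (e k)) \<omega> - \<iota> (U g (e k)) \<omega>) \<le> ennreal ((1/2) ^ n)"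
          by (rule less_imp_le)
      qed simp
      then show "AE \<omega> in \<Gamma>. (\<lambda>n. S (\<gamma>' n) \<omega> k) \<longlonglongrightarrow> S g \<omega> k"
      proof eventually_elim
        case (elim \<omega>)
        then have "(\<lambda>n. S (\<gamma>' (n + k)) \<omega> k) \<longlonglongrightarrow> S g \<omega> k" by (simp add: S_def LIM_zero_iff)
        then show ?case by (rule LIMSEQ_offset)
      qed
    qed
    ultimately show ?thesis
      by eventually_elim (auto intro: tendsto_fun_componentwise simp: LIM_zero_iff)
  qed
  ultimately show "\<exists>P. (\<forall>n::nat. \<forall>\<^sub>F h in nhds g. P n h) \<and>
        (\<forall>\<gamma>. (\<forall>n. P n (\<gamma> n)) \<longrightarrow> (AE \<omega> in \<Gamma>. (\<lambda>n. S (\<gamma> n) \<omega>) \<longlonglongrightarrow> S g \<omega> \<and>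
            (\<lambda>n. 1::real) \<longlonglongrightarrow> 1 \<and> (\<lambda>n. \<iota> (b (\<gamma> n)) \<omega>) \<longlonglongrightarrow> \<iota> (b g) \<omega>))" by blast
qed simp_all

end

theorem theorem4p3:
  fixes p q :: real and \<psi> :: "'g::topological_group_add \<Rightarrow> real"
  assumes "0 < p" and "p < q" and "\<psi> \<in> Kp TYPE('x) p"
  shows "\<exists>(N::real measure) \<sigma> h.
           sigma_finite_standard N \<and> continuous_mp_action N \<sigma> \<and> h \<in> Linf N \<and>
           (\<forall>g. (\<lambda>y. koopman \<sigma> g h y - h y) \<in> Lp N q \<and>
                \<psi> g = Lp_norm N q (\<lambda>y. koopman \<sigma> g h y - h y) powr q)
         \<and> \<psi> \<in> Kp TYPE(real) q"
proof -
  obtain M U b where rep: "Lp_rep M p (U :: 'g \<Rightarrow> _) b" and \<psi>: "\<And>g. \<psi> g = enn2real (Lp_int M p (b g))"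
    using Kp_imp_Lp_rep[OF assms(1,3)] by blast
  interpret Lp_rep M p U b by (rule rep)
  have \<psi>_cont: "continuous_on UNIV \<psi>" using assms(3) by (simp add: Kp_def)
  have \<psi>_nonneg: "0 \<le> \<psi> g" for g by (simp add: \<psi>)
  have \<psi>': "Lp_int M p (b g) = ennreal (\<psi> g)" for g
    using b_Lp[of g] by (simp add: \<psi> Lp_def less_top)
  show ?thesis
  proof (cases "p = 2")
    case False
    interpret L: Lp_rep_lamperti M p U b by unfold_locales (rule False)
    show ?thesis by (rule skew_system_realization[OF L.skew assms(2) \<psi>' \<psi>_nonneg \<psi>_cont])
  next
    case True
    obtain e where "orthosystem M e"
      using orthosystem_exists[OF finite_measure_axioms sets_M] .
    with rep True interpret L: Lp_rep_gauss M U b e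
      by (simp add: Lp_rep_gauss_def gauss_space_def)
    have "Lp_int L.\<Gamma> p (L.\<iota> (b g)) = ennreal (\<psi> g)" for g
      using L.\<iota>_norm[OF L.b_Lp, of g] \<psi>'[of g] True by simp
    then show ?thesis
      using L.skew True by (intro skew_system_realization[OF _ assms(2) _ \<psi>_nonneg \<psi>_cont]) auto
  qed
qed

end
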